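(* For $\omega\in\{0,1\}^{\mathbb Z_{\ge0}}$ let $(X^\omega,\mu^\omega,(T^\omega_n)_{n\in\mathbb Z})$ be the associated infinite Chacon like system. Then for each $\omega$ the transformation $T_1^\omega$ is not conjugate (isomorphic as a measure preserving transformation of $(X^\omega,\mu^\omega)$) to its inverse. Moreover, $T_1^\omega$ and its inverse are Radon disjoint.
   Context: **Infinite Chacon like systems.** Put $h_0:=1$, $h_{n+1}:=6h_n+1$ for $n\ge 0$. Given $\omega\in\{0,1\}^{\mathbb Z_{\ge0}}$, for $n\ge 0$ let $$F_n:=\left\{-\tfrac{h_n-1}2,-\tfrac{h_n-3}2,\dots,\tfrac{h_n-1}2\right\}\subset\mathbb Z,\qquad C^\omega_{n+1}:=\{-h_n-1+\omega(n),\,0,\,h_n+\omega(n)\}.$$ Let $X^\omega_n:=F_n\times C^\omega_{n+1}\times C^\omega_{n+2}\times\cdots$ with the product topology. The map $(f_n,c_{n+1},c_{n+2},\dots)\mapsto(f_n+c_{n+1},c_{n+2},\dots)$ is a topological embedding $X^\omega_n\to X^\omega_{n+1}$, by which $X^\omega_n$ is regarded as a (compact open) subset of $X^\omega_{n+1}$; $X^\omega=\bigcup_nX^\omega_n$ is the inductive limit, a locally compact non-compact Cantor space. For $f\in F_n$ let $[f]_n:=\{(f_n,c_{n+1},\dots)\in X^\omega_n: f_n=f\}$. For $g\in\mathbb Z$ and $x\in X^\omega$, for all large $n$ one has $x=(f_n,c_{n+1},\dots)\in X^\omega_n$ with $g+f_n\in F_n$, and $T^\omega_gx:=(g+f_n,c_{n+1},\dots)\in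 X^\omega_n$; this is a well-defined free continuous $\mathbb Z$-action. $\mu^\omega$ is the unique Borel measure on $X^\omega$ with $\mu^\omega([f]_n)=3^{-n}$ for all $f\in F_n$, $n\ge0$; it is infinite, Radon (finite on compact sets), $T_1^\omega$-invariant and ergodic. **Radon disjointness.** Let $T$, $S$ be homeomorphisms of locally compact Cantor spaces $X$, $Y$ with ergodic invariant Radon measures $\mu$, $\nu$. They are Radon disjoint if $\mu\times\nu$ is the only (up to a multiplicative constant) ergodic Radon $(T\times S)$-invariant measure on $X\times Y$ whose coordinate projections (which need not be $\sigma$-finite) are equivalent (same null sets) to $\mu$ and $\nu$ respectively. Here this is applied to $T=T_1^\omega$ and $S=(T_1^\omega)^{-1}$, both on $X=Y=X^\omega$ with $\mu=\nu=\mu^\omega$. *)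

theory Defs
  imports "HOL-Analysis.Analysis"
begin

section \<open>Isomorphism, ergodicity and Radon disjointness\<close>

definition borel_of :: "'a topology \<Rightarrow> 'a measure" where
  "borel_of X = sigma (topspace X) {U. openin X U}"

definition measure_preserving_map :: "'a measure \<Rightarrow> ('a \<Rightarrow> 'a) \<Rightarrow> bool" where
  "measure_preserving_map M T \<longleftrightarrow> T \<in> measurable M M \<and> distr M M T = M"

definition ergodic_map :: "'a measure \<Rightarrow> ('a \<Rightarrow> 'a) \<Rightarrow> bool" where
  "ergodic_map M T \<longleftrightarrow>
     (\<forall>A \<in> sets M. T -` A \<inter> space M = A \<longrightarrow> emeasure M A = 0 \<or> emeasure M (space M - A) = 0)"

text \<open>Isomorphism modulo null sets of two measure preserving transformations: a bimeasurable
  measure preserving bijection between conull forward invariant sets that intertwines the maps.\<close>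

definition mp_isomorphic ::
  "'a measure \<Rightarrow> ('a \<Rightarrow> 'a) \<Rightarrow> 'b measure \<Rightarrow> ('b \<Rightarrow> 'b) \<Rightarrow> bool" where
  "mp_isomorphic M T N S \<longleftrightarrow>
     (\<exists>A \<in> sets M. \<exists>B \<in> sets N. \<exists>\<phi>.
        emeasure M (space M - A) = 0 \<and> emeasure N (space N - B) = 0 \<and>
        T ` A \<subseteq> A \<and> S ` B \<subseteq> B \<and>
        bij_betw \<phi> A B \<and>
        \<phi> \<in> measurable (restrict_space M A) (restrict_space N B) \<and>
        inv_into A \<phi> \<in> measurable (restrict_space N B) (restrict_space M A) \<and>
        (\<forall>E \<in> sets N. E \<subseteq> B \<longrightarrow> emeasure M (\<phi> -` E \<inter> A) = emeasure N E) \<and>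
        (\<forall>x \<in> A. \<phi> (T x) = S (\<phi> x)))"

definition radon_measure_on :: "'a topology \<Rightarrow> 'a measure \<Rightarrow> bool" where
  "radon_measure_on X M \<longleftrightarrow>
     sets M = sets (borel_of X) \<and> (\<forall>K. compactin X K \<longrightarrow> emeasure M K < \<infinity>)"

text \<open>The ergodic Radon measures invariant under \<open>T \<times> S\<close> whose coordinate projections are
  equivalent to \<open>\<mu>\<close> and \<open>\<nu>\<close>. The projections are push-forwards and may take only the
  values \<open>0\<close> and \<open>\<infinity>\<close>; equivalence is equality of null sets.\<close>

definition radon_joining ::
  "'a topology \<Rightarrow> 'a measure \<Rightarrow> ('a \<Rightarrow> 'a) \<Rightarrow> 'b topology \<Rightarrow> 'b measure \<Rightarrow> ('b \<Rightarrow> 'b) \<Rightarrow>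
   ('a \<times> 'b) measure \<Rightarrow> bool" where
  "radon_joining X \<mu> T Y \<nu> S \<rho> \<longleftrightarrow>
     radon_measure_on (prod_topology X Y) \<rho> \<and>
     measure_preserving_map \<rho> (map_prod T S) \<and>
     ergodic_map \<rho> (map_prod T S) \<and>
     null_sets (distr \<rho> \<mu> fst) = null_sets \<mu> \<and>
     null_sets (distr \<rho> \<nu> snd) = null_sets \<nu>"

definition radon_disjoint ::
  "'a topology \<Rightarrow> 'a measure \<Rightarrow> ('a \<Rightarrow> 'a) \<Rightarrow> 'b topology \<Rightarrow> 'b measure \<Rightarrow> ('b \<Rightarrow> 'b) \<Rightarrow> bool" where
  "radon_disjoint X \<mu> T Y \<nu> S \<longleftrightarrow>
     radon_joining X \<mu> T Y \<nu> S (\<mu> \<Otimes>\<^sub>M \<nu>) \<and>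
     (\<forall>\<rho>. radon_joining X \<mu> T Y \<nu> S \<rho> \<longrightarrow>
        (\<exists>c>0. \<rho> = scale_measure (ennreal c) (\<mu> \<Otimes>\<^sub>M \<nu>)))"


section \<open>The infinite Chacon like systems\<close>

primrec chacon_h :: "nat \<Rightarrow> int" where
  "chacon_h 0 = 1"
| "chacon_h (Suc n) = 6 * chacon_h n + 1"

text \<open>All \<open>chacon_h n\<close> are odd, so the division below is exact.\<close>

definition chacon_F :: "nat \<Rightarrow> int set" where
  "chacon_F n = {- ((chacon_h n - 1) div 2) .. (chacon_h n - 1) div 2}"

text \<open>Only the values at \<open>k \<ge> 1\<close> are used.\<close>

definition chacon_C :: "(nat \<Rightarrow> int) \<Rightarrow> nat \<Rightarrow> int set" where
  "chacon_C \<omega> k =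
     {- chacon_h (k - 1) - 1 + \<omega> (k - 1), 0, chacon_h (k - 1) + \<omega> (k - 1)}"

text \<open>The point \<open>(f\<^sub>n, c\<^sub>n\<^sub>+\<^sub>1, c\<^sub>n\<^sub>+\<^sub>2, \<dots>)\<close> of the \<open>n\<close>-th level is the function \<open>x\<close> on \<open>{n..}\<close> with
  \<open>x n = f\<^sub>n\<close> and \<open>x k = c\<^sub>k\<close> for \<open>k > n\<close>.\<close>

definition chacon_level :: "(nat \<Rightarrow> int) \<Rightarrow> nat \<Rightarrow> (nat \<Rightarrow> int) topology" where
  "chacon_level \<omega> n =
     product_topology
       (\<lambda>k. discrete_topology (if k = n then chacon_F n else chacon_C \<omega> k)) {n..}"

text \<open>The composite \<open>X\<^sub>n \<rightarrow> X\<^sub>n\<^sub>+\<^sub>1 \<rightarrow> \<dots> \<rightarrow> X\<^sub>m\<close> of the embeddings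
  \<open>(f\<^sub>n, c\<^sub>n\<^sub>+\<^sub>1, c\<^sub>n\<^sub>+\<^sub>2, \<dots>) \<mapsto> (f\<^sub>n + c\<^sub>n\<^sub>+\<^sub>1, c\<^sub>n\<^sub>+\<^sub>2, \<dots>)\<close>, for \<open>n \<le> m\<close>; see \<open>chacon_emb_Suc\<close> and
  \<open>chacon_emb_comp\<close>.\<close>

definition chacon_emb :: "nat \<Rightarrow> nat \<Rightarrow> (nat \<Rightarrow> int) \<Rightarrow> nat \<Rightarrow> int" where
  "chacon_emb n m x = (\<lambda>k\<in>{m..}. if k = m then \<Sum>i=n..m. x i else x k)"

lemma chacon_emb_Suc:
  "chacon_emb n (Suc n) x =
     (\<lambda>k\<in>{Suc n..}. if k = Suc n then x n + x (Suc n) else x k)"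
  unfolding chacon_emb_def by (intro restrict_ext) simp

lemma chacon_emb_comp:
  assumes "n \<le> m" "m \<le> l"
  shows "chacon_emb m l (chacon_emb n m x) = chacon_emb n l x"
proof -
  have "(\<Sum>i=m..l. chacon_emb n m x i) = (\<Sum>i=n..l. x i)"
  proof -
    have "(\<Sum>i=m..l. chacon_emb n m x i) =
        chacon_emb n m x m + (\<Sum>i=Suc m..l. chacon_emb n m x i)"
      using assms by (intro sum.atLeast_Suc_atMost)
    also have "(\<Sum>i=Suc m..l. chacon_emb n m x i) = (\<Sum>i=Suc m..l. x i)"
      by (rule sum.cong) (auto simp: chacon_emb_def)
    also have "chacon_emb n m x m = (\<Sum>i=n..m. x i)"
      by (simp add: chacon_emb_def)
    also have "(\<Sum>i=n..m. x i) + (\<Sum>i=Suc m..l. x i) = (\<Sum>i=n..l. x i)"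
    proof -
      have "{n..l} = {n..m} \<union> {Suc m..l}" using assms by auto
      moreover have "sum x ({n..m} \<union> {Suc m..l}) = sum x {n..m} + sum x {Suc m..l}"
        by (rule sum.union_disjoint) auto
      ultimately show ?thesis by presburger
    qed
    finally show ?thesis .
  qed
  moreover have "chacon_emb n m x k = x k" if "l < k" for k
    using that assms by (simp add: chacon_emb_def)
  ultimately show ?thesis
    unfolding chacon_emb_def[of m l] chacon_emb_def[of n l] by (intro restrict_ext) simp
qed

lemma chacon_emb_self: "x \<in> topspace (chacon_level \<omega> n) \<Longrightarrow> chacon_emb n n x = x"
  unfolding chacon_emb_def chacon_level_def topspace_product_topology
  by (rule ext) (simp add: PiE_def extensional_def)

text \<open>The inductive limit is the quotient of the disjoint union of the levels that identifies
  two points as soon as they agree in some common higher level. It carries the final topology.\<close>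

definition chacon_rel ::
  "(nat \<Rightarrow> int) \<Rightarrow> ((nat \<times> (nat \<Rightarrow> int)) \<times> (nat \<times> (nat \<Rightarrow> int))) set" where
  "chacon_rel \<omega> = {((n, x), (m, y)).
     x \<in> topspace (chacon_level \<omega> n) \<and> y \<in> topspace (chacon_level \<omega> m) \<and>
     (\<exists>k. n \<le> k \<and> m \<le> k \<and> chacon_emb n k x = chacon_emb m k y)}"

definition chacon_X :: "(nat \<Rightarrow> int) \<Rightarrow> (nat \<times> (nat \<Rightarrow> int)) set set" where
  "chacon_X \<omega> = (SIGMA n:UNIV. topspace (chacon_level \<omega> n)) // chacon_rel \<omega>"

definition chacon_incl :: "(nat \<Rightarrow> int) \<Rightarrow> nat \<Rightarrow> (nat \<Rightarrow> int) \<Rightarrow> (nat \<times> (nat \<Rightarrow> int)) set" where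
  "chacon_incl \<omega> n x = chacon_rel \<omega> `` {(n, x)}"

definition chacon_top :: "(nat \<Rightarrow> int) \<Rightarrow> (nat \<times> (nat \<Rightarrow> int)) set topology" where
  "chacon_top \<omega> = topology (\<lambda>U. U \<subseteq> chacon_X \<omega> \<and>
     (\<forall>n. openin (chacon_level \<omega> n)
            {x \<in> topspace (chacon_level \<omega> n). chacon_incl \<omega> n x \<in> U}))"

lemma equiv_chacon_rel:
  "equiv (SIGMA n:UNIV. topspace (chacon_level \<omega> n)) (chacon_rel \<omega>)"
proof (rule equivI)
  show "chacon_rel \<omega> \<subseteq> (SIGMA n:UNIV. topspace (chacon_level \<omega> n)) \<times>
      (SIGMA n:UNIV. topspace (chacon_level \<omega> n))"
    by (auto simp: chacon_rel_def)
  show "refl_on (SIGMA n:UNIV. topspace (chacon_level \<omega> n)) (chacon_rel \<omega>)"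
    by (auto simp: refl_on_def chacon_rel_def)
  show "sym (chacon_rel \<omega>)"
  proof (rule symI)
    fix p q
    assume "(p, q) \<in> chacon_rel \<omega>"
    then obtain n x m y k where
      pq: "p = (n, x)" "q = (m, y)"
        "x \<in> topspace (chacon_level \<omega> n)" "y \<in> topspace (chacon_level \<omega> m)" and
      k: "n \<le> k" "m \<le> k" "chacon_emb n k x = chacon_emb m k y"
      unfolding chacon_rel_def by blast
    have "\<exists>k. m \<le> k \<and> n \<le> k \<and> chacon_emb m k y = chacon_emb n k x"
      using k(1,2) k(3)[symmetric] by (intro exI[of _ k] conjI)
    then show "(q, p) \<in> chacon_rel \<omega>"
      using pq unfolding chacon_rel_def by simp
  qed
  show "trans (chacon_rel \<omega>)"
  proof (rule transI)
    fix p q r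
    assume "(p, q) \<in> chacon_rel \<omega>" "(q, r) \<in> chacon_rel \<omega>"
    then obtain n x m y l z k j where
      pqr: "p = (n, x)" "q = (m, y)" "r = (l, z)"
        "x \<in> topspace (chacon_level \<omega> n)" "z \<in> topspace (chacon_level \<omega> l)" and
      k: "n \<le> k" "m \<le> k" "chacon_emb n k x = chacon_emb m k y" and
      j: "m \<le> j" "l \<le> j" "chacon_emb m j y = chacon_emb l j z"
      unfolding chacon_rel_def by blast
    have "chacon_emb n (max k j) x = chacon_emb m (max k j) y"
      using chacon_emb_comp[OF k(1) max.cobounded1[of k j], of x]
        chacon_emb_comp[OF k(2) max.cobounded1[of k j], of y] k(3) by simp
    also have "\<dots> = chacon_emb l (max k j) z"
      using chacon_emb_comp[OF j(1) max.cobounded2[of j k], of y]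
        chacon_emb_comp[OF j(2) max.cobounded2[of j k], of z] j(3) by simp
    finally have "chacon_emb n (max k j) x = chacon_emb l (max k j) z" .
    moreover have "n \<le> max k j" "l \<le> max k j" using k j by auto
    ultimately show "(p, r) \<in> chacon_rel \<omega>"
      using pqr unfolding chacon_rel_def by (simp, intro exI[of _ "max k j"], simp)
  qed
qed

lemma openin_chacon_top:
  "openin (chacon_top \<omega>) U \<longleftrightarrow> U \<subseteq> chacon_X \<omega> \<and>
     (\<forall>n. openin (chacon_level \<omega> n)
            {x \<in> topspace (chacon_level \<omega> n). chacon_incl \<omega> n x \<in> U})"
proof -
  let ?P = "\<lambda>n U. {x \<in> topspace (chacon_level \<omega> n). chacon_incl \<omega> n x \<in> U}"
  have int: "?P n (S \<inter> T) = ?P n S \<inter> ?P n T" for n S T by auto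
  have un: "?P n (\<Union>K) = \<Union> (?P n ` K)" for n K by auto
  have "istopology (\<lambda>U. U \<subseteq> chacon_X \<omega> \<and> (\<forall>n. openin (chacon_level \<omega> n) (?P n U)))"
    unfolding istopology_def int un by (auto intro!: openin_Union)
  then show ?thesis
    by (simp add: chacon_top_def)
qed

lemma topspace_chacon_top: "topspace (chacon_top \<omega>) = chacon_X \<omega>"
proof
  show "topspace (chacon_top \<omega>) \<subseteq> chacon_X \<omega>"
    using openin_chacon_top openin_topspace by blast
  have "chacon_incl \<omega> n x \<in> chacon_X \<omega>" if "x \<in> topspace (chacon_level \<omega> n)" for n x
    using that by (auto simp: chacon_incl_def chacon_X_def intro!: quotientI)
  then have "{x \<in> topspace (chacon_level \<omega> n). chacon_incl \<omega> n x \<in> chacon_X \<omega>} =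
      topspace (chacon_level \<omega> n)" for n
    by auto
  then have "openin (chacon_top \<omega>) (chacon_X \<omega>)"
    by (simp add: openin_chacon_top)
  then show "chacon_X \<omega> \<subseteq> topspace (chacon_top \<omega>)"
    by (rule openin_subset)
qed

definition chacon_cyl :: "(nat \<Rightarrow> int) \<Rightarrow> nat \<Rightarrow> int \<Rightarrow> (nat \<times> (nat \<Rightarrow> int)) set set" where
  "chacon_cyl \<omega> n f = chacon_incl \<omega> n ` {x \<in> topspace (chacon_level \<omega> n). x n = f}"

text \<open>The action of \<open>g\<close>: the value does not depend on the level \<open>n\<close> at which it is computed, as
  \<open>chacon_T_eq\<close> shows, and every sufficiently high level can be used.\<close>

definition chacon_T ::
  "(nat \<Rightarrow> int) \<Rightarrow> int \<Rightarrow> (nat \<times> (nat \<Rightarrow> int)) set \<Rightarrow> (nat \<times> (nat \<Rightarrow> int)) set" where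
  "chacon_T \<omega> g p = (THE q. \<exists>n x. x \<in> topspace (chacon_level \<omega> n) \<and> p = chacon_incl \<omega> n x \<and>
     g + x n \<in> chacon_F n \<and> q = chacon_incl \<omega> n (x(n := g + x n)))"

lemma chacon_incl_eq_iff:
  assumes "x \<in> topspace (chacon_level \<omega> n)" "y \<in> topspace (chacon_level \<omega> m)"
  shows "chacon_incl \<omega> n x = chacon_incl \<omega> m y \<longleftrightarrow>
    (\<exists>k. n \<le> k \<and> m \<le> k \<and> chacon_emb n k x = chacon_emb m k y)"
  using eq_equiv_class_iff[OF equiv_chacon_rel, of "(n, x)" \<omega> "(m, y)"] assms
  unfolding chacon_incl_def by (simp add: chacon_rel_def)

lemma chacon_level_shift:
  assumes "x \<in> topspace (chacon_level \<omega> n)" "g + x n \<in> chacon_F n"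
  shows "x(n := g + x n) \<in> topspace (chacon_level \<omega> n)"
proof -
  let ?A = "\<lambda>k. if k = n then chacon_F n else chacon_C \<omega> k"
  have eq: "topspace (chacon_level \<omega> n) = Pi\<^sub>E {n..} ?A"
    unfolding chacon_level_def topspace_product_topology by (simp add: comp_def)
  have "x(n := g + x n) \<in> Pi\<^sub>E (insert n {n..}) ?A"
    by (rule PiE_fun_upd) (use assms in \<open>simp_all add: eq\<close>)
  moreover have "insert n {n..} = {n..}"
    by auto
  ultimately show ?thesis
    by (simp only: eq)
qed

lemma chacon_emb_shift:
  assumes "n \<le> k"
  shows "chacon_emb n k (x(n := g + x n)) = (chacon_emb n k x)(k := g + chacon_emb n k x k)"
proof -
  have "(\<Sum>i=n..k. (x(n := g + x n)) i) = g + (\<Sum>i=n..k. x i)"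
    using assms by (subst (1 2) sum.atLeast_Suc_atMost) (auto intro!: sum.cong)
  then show ?thesis
    unfolding chacon_emb_def using assms by (intro ext) simp
qed

lemma chacon_T_eq:
  assumes "x \<in> topspace (chacon_level \<omega> n)" "g + x n \<in> chacon_F n"
  shows "chacon_T \<omega> g (chacon_incl \<omega> n x) = chacon_incl \<omega> n (x(n := g + x n))"
  unfolding chacon_T_def
proof (rule the_equality)
  show "\<exists>m y. y \<in> topspace (chacon_level \<omega> m) \<and> chacon_incl \<omega> n x = chacon_incl \<omega> m y \<and>
     g + y m \<in> chacon_F m \<and>
     chacon_incl \<omega> n (x(n := g + x n)) = chacon_incl \<omega> m (y(m := g + y m))"
    using assms by (intro exI[of _ n] exI[of _ x] conjI refl)
next
  fix q
  assume "\<exists>m y. y \<in> topspace (chacon_level \<omega> m) \<and> chacon_incl \<omega> n x = chacon_incl \<omega> m y \<and>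
     g + y m \<in> chacon_F m \<and> q = chacon_incl \<omega> m (y(m := g + y m))"
  then obtain m y where y: "y \<in> topspace (chacon_level \<omega> m)"
      "chacon_incl \<omega> n x = chacon_incl \<omega> m y" "g + y m \<in> chacon_F m"
    and q: "q = chacon_incl \<omega> m (y(m := g + y m))"
    by (elim exE conjE)
  obtain k where k: "n \<le> k" "m \<le> k" "chacon_emb n k x = chacon_emb m k y"
    using y(2) unfolding chacon_incl_eq_iff[OF assms(1) y(1)] by (elim exE conjE)
  have "chacon_emb m k (y(m := g + y m)) = chacon_emb n k (x(n := g + x n))"
    unfolding chacon_emb_shift[OF k(1)] chacon_emb_shift[OF k(2)] k(3) by (rule refl)
  then show "q = chacon_incl \<omega> n (x(n := g + x n))"
    unfolding q chacon_incl_eq_iff[OF chacon_level_shift[OF y(1,3)] chacon_level_shift[OF assms]]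
    using k(1,2) by (intro exI[of _ k] conjI)
qed

text \<open>The unique Borel measure giving every cylinder \<open>chacon_cyl \<omega> n f\<close> the measure \<open>1 / 3 ^ n\<close>.\<close>

definition chacon_measure :: "(nat \<Rightarrow> int) \<Rightarrow> (nat \<times> (nat \<Rightarrow> int)) set measure" where
  "chacon_measure \<omega> = (THE M. sets M = sets (borel_of (chacon_top \<omega>)) \<and>
     (\<forall>n. \<forall>f \<in> chacon_F n. emeasure M (chacon_cyl \<omega> n f) = ennreal (1 / 3 ^ n)))"

end

theory Submission
  imports Defs
begin

text \<open>
  Let \<open>s\<^sub>n(x, y)\<close> be the sum of the level \<open>n\<close> coordinates of \<open>x\<close> and \<open>y\<close>. A Radon measure invariant
  under \<open>T \<times> T\<^sup>-\<^sup>1\<close> gives the product of two level \<open>n\<close> cylinders a value depending only on \<open>s\<^sub>n\<close>,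
  so invariant measures are positive harmonic functions of \<open>(n, s\<^sub>n)\<close>. Bounded ones are constant,
  because the digit pairs \<open>(0, 0)\<close> and \<open>(- h - 1 + \<omega>, h + \<omega>)\<close> have sums differing by \<open>1\<close>; hence
  \<open>\<mu> \<times> \<mu>\<close> is ergodic.

  Let \<open>\<rho>\<close> be an ergodic joining. If these two kinds of digit pairs occur infinitely often almost
  everywhere, switching between them shows that \<open>\<rho>\<close> is dominated by its images under \<open>T \<times> id\<close> and
  \<open>T\<^sup>-\<^sup>1 \<times> id\<close>. By ergodicity \<open>\<rho>\<close> is then proportional to its image under \<open>T \<times> id\<close>; a factor other
  than \<open>1\<close> would force the digit \<open>0\<close> to occur only finitely often, so \<open>\<rho>\<close> is invariant under
  \<open>T \<times> id\<close> and proportional to \<open>\<mu> \<times> \<mu>\<close>. Otherwise they eventually do not occur, and the sums of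
  digits are then constant along orbits, hence deterministic, so that \<open>x\<close> omits one digit at
  almost all levels, which has \<open>\<mu>\<close>-measure \<open>0\<close>. An isomorphism of \<open>T\<close> with \<open>T\<^sup>-\<^sup>1\<close> would yield a
  joining supported on its graph, different from \<open>\<mu> \<times> \<mu>\<close>.
\<close>

section \<open>Measures determined by compact open cells\<close>

text \<open>What separates \<open>T\<close> from its inverse is that \<open>lo n + hi n\<close> is 1
  or -1. For \<open>T \<times> T\<close> the pairs of equal digits all have difference 0, and the
  diagonal joining lives on exactly these pairs. For the inverse the corresponding pairs are (0, 0),
  (lo, hi) and (hi, lo), and their sums are not all equal.

  The obstacle is that the projections of a joining need not be sigma-finite, so there is no
  disintegration over a coordinate. The marginals contribute only null sets and, apart from making
  \<open>\<rho>\<close> nonzero, only through one family: points whose digits avoid a prescribed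
  value at all high levels. The rest compares measures on cells and uses Radon-Nikodym derivatives
  between invariant measures.

  The growth \<open>6 * h n + 1\<close> leaves \<open>F n + C (Suc n)\<close> well inside
  \<open>F (Suc n)\<close>. Hence a fixed translation is harmless at high levels, and digit sums
  that are \<open>h\<close> apart can be decoded. The graph joining is not the product because
  \<open>cyl 0 0 \<times> X\<close> has measure 1 for one and infinite measure for the
  other.\<close>

definition add_measure :: "'a measure \<Rightarrow> 'a measure \<Rightarrow> 'a measure" where
  "add_measure M N = measure_of (space M) (sets M) (\<lambda>A. emeasure M A + emeasure N A)"

lemma sets_add_measure [simp, measurable_cong]: "sets (add_measure M N) = sets M"
  and space_add_measure [simp]: "space (add_measure M N) = space M"
  by (auto simp: add_measure_def sets.space_closed)

lemma emeasure_add_measure: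
  assumes "sets N = sets M" "A \<in> sets M"
  shows "emeasure (add_measure M N) A = emeasure M A + emeasure N A"
  unfolding add_measure_def
proof (rule emeasure_measure_of_sigma)
  show "sigma_algebra (space M) (sets M)" by (rule sets.sigma_algebra_axioms)
  show "positive (sets M) (\<lambda>A. emeasure M A + emeasure N A)" by (auto simp: positive_def)
  show "countably_additive (sets M) (\<lambda>A. emeasure M A + emeasure N A)"
  proof (rule countably_additiveI)
    fix A :: "nat \<Rightarrow> _"
    assume A: "range A \<subseteq> sets M" "disjoint_family A"
    have "(\<Sum>i. emeasure M (A i) + emeasure N (A i)) = (\<Sum>i. emeasure M (A i)) + (\<Sum>i. emeasure N (A i))"
      by (rule suminf_add[symmetric]) auto
    also have "\<dots> = emeasure M (\<Union>(range A)) + emeasure N (\<Union>(range A))"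
      using A assms(1) by (simp add: suminf_emeasure)
    finally show "(\<Sum>i. emeasure M (A i) + emeasure N (A i)) = emeasure M (\<Union>(range A)) + emeasure N (\<Union>(range A))" .
  qed
qed (use assms in auto)

lemma space_borel_of [simp]: "space (borel_of Y) = topspace Y"
  unfolding borel_of_def by (rule space_measure_of) (auto dest: openin_subset)

lemma sets_borel_of: "sets (borel_of Y) = sigma_sets (topspace Y) {U. openin Y U}"
  unfolding borel_of_def by (rule sets_measure_of) (auto dest: openin_subset)

lemma openin_in_borel_of: "openin Y U \<Longrightarrow> U \<in> sets (borel_of Y)"
  by (simp add: sets_borel_of)

text \<open>If the intersection is empty, the sets \<open>A 0 - A i\<close> form an open cover of
  \<open>A 0\<close>. This compactness is the source of countable additivity in
  \<open>ex_cell_measure\<close>.\<close>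

lemma compactin_decseq_Int:
  assumes "compactin Y (A 0)" "\<And>i. openin Y (A 0 - A i)" "decseq A" "(\<Inter>i. A i) = {}"
  shows "\<exists>n. A n = {}"
proof -
  obtain I where I: "finite I" "I \<subseteq> range (\<lambda>i. A 0 - A i)" "A 0 \<subseteq> \<Union>I"
    using compactinD[OF assms(1), of "range (\<lambda>i. A 0 - A i)"] assms(2,4) by auto
  then obtain J where J: "finite J" "I = (\<lambda>i. A 0 - A i) ` J"
    by (meson finite_subset_image)
  obtain n where n: "\<forall>j\<in>J. j \<le> n" using J(1) finite_nat_set_iff_bounded_le by auto
  have "A n \<subseteq> A j" if "j \<in> J" for j using assms(3) n that by (auto simp: decseq_def)
  moreover have "A n \<subseteq> A 0" using assms(3) by (auto simp: decseq_def)
  moreover have "A 0 \<subseteq> (\<Union>j\<in>J. A 0 - A j)" using I(3) J by simp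
  ultimately have "A n = {}" by blast
  then show ?thesis by blast
qed

text \<open>Instantiated for \<open>chacon_top\<close> and for its square, so that existence,
  uniqueness and comparison of measures are proved once. \<open>determined\<close> makes the
  partition of \<open>V m\<close> into cells refine that of every earlier \<open>V n\<close>; in
  particular \<open>V n\<close> is a union of level \<open>m\<close> cells.\<close>

locale cell_space =
  fixes Y :: "'a topology" and V :: "nat \<Rightarrow> 'a set" and \<phi> :: "nat \<Rightarrow> 'a \<Rightarrow> 'b"
  assumes V_cover: "(\<Union>n. V n) = topspace Y"
    and V_mono: "n \<le> m \<Longrightarrow> V n \<subseteq> V m"
    and determined: "p \<in> V n \<Longrightarrow> q \<in> V m \<Longrightarrow> n \<le> m \<Longrightarrow> \<phi> m q = \<phi> m p \<Longrightarrow> q \<in> V n \<and> \<phi> n q = \<phi> n p"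
    and finite_labels: "finite (\<phi> n ` V n)"
    and open_cell: "openin Y {p \<in> V n. \<phi> n p = v}"
    and compact_cell: "compactin Y {p \<in> V n. \<phi> n p = v}"
    and cell_base: "openin Y U \<Longrightarrow> p \<in> U \<Longrightarrow> \<exists>n. p \<in> V n \<and> {q \<in> V n. \<phi> n q = \<phi> n p} \<subseteq> U"
begin

definition cell :: "nat \<Rightarrow> 'b \<Rightarrow> 'a set" where
  "cell n v = {p \<in> V n. \<phi> n p = v}"

lemma V_sub: "V n \<subseteq> topspace Y"
  using V_cover by auto

lemma cell_sub: "cell n v \<subseteq> topspace Y"
  using V_sub by (auto simp: cell_def)

lemma cell_nested: "p \<in> cell n v \<Longrightarrow> p \<in> cell m w \<Longrightarrow> n \<le> m \<Longrightarrow> cell m w \<subseteq> cell n v"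
  unfolding cell_def using determined[of p n _ m] by auto

definition cells :: "'a set set" where
  "cells = (\<lambda>(n, v). cell n v) ` (SIGMA n:UNIV. \<phi> n ` V n)"

lemma countable_cells: "countable cells"
  unfolding cells_def by (rule countable_image, rule countable_SIGMA) (simp_all add: countable_finite finite_labels)

lemma sets_borel_of_cells: "sets (borel_of Y) = sigma_sets (topspace Y) cells"
  unfolding sets_borel_of
proof (rule sigma_sets_eqI)
  fix U assume "U \<in> {U. openin Y U}"
  then have U: "openin Y U" by simp
  have "U = \<Union>{c \<in> cells. c \<subseteq> U}"
  proof
    show "U \<subseteq> \<Union>{c \<in> cells. c \<subseteq> U}"
    proof
      fix p assume p: "p \<in> U"
      then obtain n where n: "p \<in> V n" "cell n (\<phi> n p) \<subseteq> U"
        using cell_base[OF U p] unfolding cell_def by auto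
      then have "cell n (\<phi> n p) \<in> cells" unfolding cells_def by auto
      then show "p \<in> \<Union>{c \<in> cells. c \<subseteq> U}" using n unfolding cell_def by blast
    qed
  qed auto
  moreover have "\<Union>{c \<in> cells. c \<subseteq> U} \<in> sigma_sets (topspace Y) cells"
  proof (rule sigma_sets_UNION)
    show "countable {c \<in> cells. c \<subseteq> U}"
      by (rule countable_subset[OF _ countable_cells]) auto
  qed (auto intro: sigma_sets.Basic)
  ultimately show "U \<in> sigma_sets (topspace Y) cells" by simp
next
  fix c assume "c \<in> cells"
  then show "c \<in> sigma_sets (topspace Y) {U. openin Y U}"
    using open_cell unfolding cells_def cell_def by auto
qed

lemma cell_borel: "cell n v \<in> sets (borel_of Y)"
  unfolding cell_def by (rule openin_in_borel_of) (rule open_cell)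

lemma V_borel: "V n \<in> sets (borel_of Y)"
proof -
  have "V n = (\<Union>v\<in>\<phi> n ` V n. cell n v)" by (auto simp: cell_def)
  also have "\<dots> \<in> sets (borel_of Y)"
    using finite_labels cell_borel by (intro sets.finite_UN) auto
  finally show ?thesis .
qed

lemma Union_cells: "\<Union>cells = topspace Y"
proof
  show "topspace Y \<subseteq> \<Union>cells"
  proof
    fix p assume "p \<in> topspace Y"
    then obtain n where "p \<in> V n" using V_cover by auto
    then show "p \<in> \<Union>cells" unfolding cells_def cell_def by auto
  qed
qed (use cell_sub in \<open>auto simp: cells_def\<close>)

text \<open>Two cells are nested or disjoint, so with the empty set they form a generator that is
  stable under intersection.\<close>

lemma measure_eqI_cells:
  assumes M: "sets M = sets (borel_of Y)" and N: "sets N = sets (borel_of Y)"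
    and eq: "\<And>n v. v \<in> \<phi> n ` V n \<Longrightarrow> emeasure M (cell n v) = emeasure N (cell n v)"
    and fin: "\<And>n v. v \<in> \<phi> n ` V n \<Longrightarrow> emeasure M (cell n v) \<noteq> \<infinity>"
  shows "M = N"
proof (rule measure_eqI_generator_eq_countable[where E = "insert {} cells" and A = cells])
  show "Int_stable (insert {} cells)"
  proof (rule Int_stableI)
    fix a b assume ab: "a \<in> insert {} cells" "b \<in> insert {} cells"
    show "a \<inter> b \<in> insert {} cells"
    proof (cases "a \<inter> b = {}")
      case False
      then obtain p where p: "p \<in> a" "p \<in> b" by auto
      with ab obtain n v m w where *: "a = cell n v" "b = cell m w" by (auto simp: cells_def)
      then have "a \<subseteq> b \<or> b \<subseteq> a"
        using p cell_nested[of p n v m w] cell_nested[of p m w n v] by (cases "n \<le> m") auto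
      then show ?thesis using ab by (metis inf.absorb1 inf.absorb2)
    qed simp
  qed
  have "sigma_sets (topspace Y) (insert {} cells) = sigma_sets (topspace Y) cells"
    by (rule sigma_sets_eqI) (auto intro: sigma_sets.Basic sigma_sets.Empty)
  then show "sets M = sigma_sets (topspace Y) (insert {} cells)"
    "sets N = sigma_sets (topspace Y) (insert {} cells)"
    by (simp_all add: M N sets_borel_of_cells)
  show "insert {} cells \<subseteq> Pow (topspace Y)"
    using cell_sub by (auto simp: cells_def)
  show "emeasure M a = emeasure N a" if "a \<in> insert {} cells" for a
    using that eq by (auto simp: cells_def)
  show "emeasure M a \<noteq> \<infinity>" if "a \<in> cells" for a
    using that fin by (auto simp: cells_def)
qed (use countable_cells Union_cells in auto)

lemma sigma_finite_cells:
  assumes M: "sets M = sets (borel_of Y)"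
    and fin: "\<And>n v. v \<in> \<phi> n ` V n \<Longrightarrow> emeasure M (cell n v) \<noteq> \<infinity>"
  shows "sigma_finite_measure M"
proof (rule sigma_finite_measure.intro, intro exI conjI)
  show "countable cells" by (rule countable_cells)
  show "cells \<subseteq> sets M" using cell_borel by (auto simp: cells_def M)
  show "\<Union>cells = space M" unfolding Union_cells by (simp add: sets_eq_imp_space_eq[OF M])
  show "\<forall>a\<in>cells. emeasure M a \<noteq> \<infinity>" using fin by (auto simp: cells_def)
qed

text \<open>The finite unions of level \<open>n\<close> cells. Taken over all \<open>n\<close> they
  form a ring of compact open sets, the domain of the premeasure in
  \<open>ex_cell_measure\<close>.\<close>

definition lvl :: "nat \<Rightarrow> 'a set \<Rightarrow> bool" where
  "lvl n A \<longleftrightarrow> A \<subseteq> V n \<and> (\<forall>p\<in>A. cell n (\<phi> n p) \<subseteq> A)"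

lemma lvl_mono: "lvl n A \<Longrightarrow> n \<le> m \<Longrightarrow> lvl m A"
  unfolding lvl_def
proof (intro conjI ballI)
  assume a: "A \<subseteq> V n \<and> (\<forall>p\<in>A. cell n (\<phi> n p) \<subseteq> A)" "n \<le> m"
  then show "A \<subseteq> V m" using V_mono by blast
  fix p assume p: "p \<in> A"
  then have "cell m (\<phi> m p) \<subseteq> cell n (\<phi> n p)"
    using a V_mono[of n m] by (intro cell_nested[of p]) (auto simp: cell_def)
  then show "cell m (\<phi> m p) \<subseteq> A" using a p by auto
qed

lemma lvl_eq: "lvl n A \<Longrightarrow> A = (\<Union>v\<in>\<phi> n ` A. cell n v)"
  unfolding lvl_def cell_def by auto

lemma lvl_cell: "lvl n (cell n v)"
  unfolding lvl_def cell_def by auto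

lemma finite_lvl: "lvl n A \<Longrightarrow> finite (\<phi> n ` A)"
  unfolding lvl_def by (rule finite_subset[OF _ finite_labels[of n]]) auto

lemma lvl_open: "lvl n A \<Longrightarrow> openin Y A"
proof -
  assume A: "lvl n A"
  have "openin Y (\<Union>v\<in>\<phi> n ` A. cell n v)"
    by (intro openin_Union) (auto simp: cell_def open_cell)
  then show ?thesis unfolding lvl_eq[OF A, symmetric] .
qed

lemma lvl_compact: "lvl n A \<Longrightarrow> compactin Y A"
proof -
  assume A: "lvl n A"
  have "compactin Y (\<Union>v\<in>\<phi> n ` A. cell n v)"
    using finite_lvl[OF A] by (intro compactin_Union) (auto simp: cell_def compact_cell)
  then show ?thesis unfolding lvl_eq[OF A, symmetric] .
qed

lemma lvl_Un: "lvl n A \<Longrightarrow> lvl n B \<Longrightarrow> lvl n (A \<union> B)"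
  unfolding lvl_def by auto

lemma lvl_Diff: "lvl n A \<Longrightarrow> lvl n B \<Longrightarrow> lvl n (A - B)"
  unfolding lvl_def cell_def by fastforce

lemma ring_lvl: "ring_of_sets (topspace Y) {A. \<exists>n. lvl n A}"
proof (rule ring_of_setsI)
  show "{A. \<exists>n. lvl n A} \<subseteq> Pow (topspace Y)" using V_sub by (auto simp: lvl_def)
  show "{} \<in> {A. \<exists>n. lvl n A}" by (auto simp: lvl_def)
  fix a b assume "a \<in> {A. \<exists>n. lvl n A}" "b \<in> {A. \<exists>n. lvl n A}"
  then obtain n m where "lvl n a" "lvl m b" by auto
  then have *: "lvl (max n m) a" "lvl (max n m) b" by (simp_all add: lvl_mono[of n a] lvl_mono[of m b])
  show "a \<union> b \<in> {A. \<exists>n. lvl n A}" using lvl_Un[OF *] by auto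
  show "a - b \<in> {A. \<exists>n. lvl n A}" using lvl_Diff[OF *] by auto
qed

text \<open>Every level \<open>Suc n\<close> cell inside \<open>A\<close> lies in exactly one level
  \<open>n\<close> cell, so the sum can be grouped. It makes the premeasure independent of the level
  at which a set is described.\<close>

lemma sum_lvl_Suc:
  fixes w :: "nat \<Rightarrow> 'b \<Rightarrow> ennreal"
  assumes w: "\<And>n v. v \<in> \<phi> n ` V n \<Longrightarrow> w n v = (\<Sum>u\<in>\<phi> (Suc n) ` cell n v. w (Suc n) u)"
    and A: "lvl n A"
  shows "(\<Sum>u\<in>\<phi> (Suc n) ` A. w (Suc n) u) = (\<Sum>v\<in>\<phi> n ` A. w n v)"
proof -
  have "\<phi> (Suc n) ` A = (\<Union>v\<in>\<phi> n ` A. \<phi> (Suc n) ` cell n v)"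
    using arg_cong[OF lvl_eq[OF A], of "\<lambda>A. \<phi> (Suc n) ` A"] by (simp add: image_UN)
  also have "sum (w (Suc n)) \<dots> = (\<Sum>v\<in>\<phi> n ` A. \<Sum>u\<in>\<phi> (Suc n) ` cell n v. w (Suc n) u)"
  proof (rule sum.UNION_disjoint)
    show "finite (\<phi> n ` A)" using A by (rule finite_lvl)
    show "\<forall>v\<in>\<phi> n ` A. finite (\<phi> (Suc n) ` cell n v)"
      using finite_lvl[OF lvl_mono[OF lvl_cell]] by auto
    have "v = v'" if "p \<in> cell n v" "q \<in> cell n v'" "\<phi> (Suc n) p = \<phi> (Suc n) q" for p q v v'
      using determined[of p n q "Suc n"] that V_mono[of n "Suc n"] by (auto simp: cell_def)
    then show "\<forall>v\<in>\<phi> n ` A. \<forall>v'\<in>\<phi> n ` A. v \<noteq> v' \<longrightarrow>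
        \<phi> (Suc n) ` cell n v \<inter> \<phi> (Suc n) ` cell n v' = {}"
      by blast
  qed
  also have "\<dots> = (\<Sum>v\<in>\<phi> n ` A. w n v)"
    using A by (intro sum.cong) (auto simp: lvl_def intro!: w[symmetric])
  finally show ?thesis .
qed

text \<open>Caratheodory extension of a consistent system of finite weights. Continuity at the empty
  set costs nothing: a decreasing sequence of compact open sets with empty intersection is
  eventually empty.\<close>

lemma ex_cell_measure:
  fixes w :: "nat \<Rightarrow> 'b \<Rightarrow> ennreal"
  assumes w: "\<And>n v. v \<in> \<phi> n ` V n \<Longrightarrow> w n v = (\<Sum>u\<in>\<phi> (Suc n) ` cell n v. w (Suc n) u)"
    and fin: "\<And>n v. v \<in> \<phi> n ` V n \<Longrightarrow> w n v \<noteq> \<infinity>"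
  shows "\<exists>M. sets M = sets (borel_of Y) \<and> (\<forall>n. \<forall>v\<in>\<phi> n ` V n. emeasure M (cell n v) = w n v)"
proof -
  let ?R = "{A. \<exists>n. lvl n A}"
  interpret ring_of_sets "topspace Y" ?R by (rule ring_lvl)
  \<comment> \<open>\<open>LEAST\<close> only fixes a choice of level; the next fact gives the same
    value for every admissible level.\<close>
  define f where "f A = (\<Sum>v\<in>\<phi> (LEAST n. lvl n A) ` A. w (LEAST n. lvl n A) v)" for A
  have f: "f A = (\<Sum>v\<in>\<phi> n ` A. w n v)" if "lvl n A" for A n
  proof -
    have L: "lvl (LEAST n. lvl n A) A" using that by (rule LeastI)
    have "(LEAST n. lvl n A) \<le> n" using that by (rule Least_le)
    then show ?thesis unfolding f_def
    proof (induction n rule: dec_induct)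
      case (step k)
      then show ?case using sum_lvl_Suc[of w k A, OF w lvl_mono[OF L]] by simp
    qed simp
  qed
  have f0: "f {} = 0" using f[of 0 "{}"] by (simp add: lvl_def)
  have "\<exists>\<mu>. (\<forall>s\<in>?R. \<mu> s = f s) \<and> measure_space (topspace Y) (sigma_sets (topspace Y) ?R) \<mu>"
  proof (rule caratheodory_empty_continuous)
    show "positive ?R f" using f0 by (simp add: positive_def)
    show "additive ?R f"
    proof (unfold additive_def, intro ballI impI)
      fix x y assume xy: "x \<in> ?R" "y \<in> ?R" "x \<inter> y = {}"
      then obtain n m where "lvl n x" "lvl m y" by auto
      then have *: "lvl (max n m) x" "lvl (max n m) y" by (simp_all add: lvl_mono[of n x] lvl_mono[of m y])
      let ?k = "max n m"
      have "\<phi> ?k ` x \<inter> \<phi> ?k ` y = {}"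
      proof (rule ccontr)
        assume "\<phi> ?k ` x \<inter> \<phi> ?k ` y \<noteq> {}"
        then obtain p q where pq: "p \<in> x" "q \<in> y" "\<phi> ?k p = \<phi> ?k q" by blast
        have "q \<in> V ?k" using *(2) pq(2) unfolding lvl_def by blast
        then have "q \<in> cell ?k (\<phi> ?k p)" using pq(3) by (simp add: cell_def)
        then have "q \<in> x" using *(1) pq(1) unfolding lvl_def by blast
        then show False using pq(2) xy(3) by blast
      qed
      then have "(\<Sum>v\<in>\<phi> ?k ` (x \<union> y). w ?k v) = (\<Sum>v\<in>\<phi> ?k ` x. w ?k v) + (\<Sum>v\<in>\<phi> ?k ` y. w ?k v)"
        unfolding image_Un by (intro sum.union_disjoint finite_lvl *)
      then show "f (x \<union> y) = f x + f y" using f[OF lvl_Un[OF *]] f[OF *(1)] f[OF *(2)] by simp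
    qed
    show "f A \<noteq> \<infinity>" if "A \<in> ?R" for A
    proof -
      from that obtain n where n: "lvl n A" by auto
      have "A \<subseteq> V n" using n unfolding lvl_def by simp
      then have "\<forall>v\<in>\<phi> n ` A. w n v \<noteq> \<infinity>" using fin[of _ n] by blast
      then show ?thesis using finite_lvl[OF n] unfolding f[OF n] by (simp add: less_top)
    qed
    show "(\<lambda>i. f (A i)) \<longlonglongrightarrow> 0" if A: "range A \<subseteq> ?R" "decseq A" "(\<Inter>i. A i) = {}" for A
    proof -
      have R: "A i \<in> ?R" for i using A(1) by blast
      have "compactin Y (A 0)" using R[of 0] lvl_compact by auto
      moreover have "openin Y (A 0 - A i)" for i
        using Diff[OF R[of 0] R[of i]] lvl_open by auto
      ultimately obtain n where n: "A n = {}" using compactin_decseq_Int A by metis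
      have "A i = {}" if "n \<le> i" for i using A(2) n that by (auto simp: decseq_def)
      then have "eventually (\<lambda>i. f (A i) = 0) sequentially"
        using f0 unfolding eventually_sequentially by metis
      then show ?thesis by (rule tendsto_eventually)
    qed
  qed
  then obtain \<mu> where \<mu>: "\<And>s. s \<in> ?R \<Longrightarrow> \<mu> s = f s"
    "measure_space (topspace Y) (sigma_sets (topspace Y) ?R) \<mu>" by auto
  define M where "M = measure_of (topspace Y) ?R \<mu>"
  have sig: "sigma_sets (topspace Y) ?R = sets (borel_of Y)"
    unfolding sets_borel_of_cells
  proof (rule sigma_sets_eqI)
    fix a assume "a \<in> ?R"
    then obtain n where "lvl n a" by auto
    then have "a \<in> sets (borel_of Y)" by (intro openin_in_borel_of lvl_open)
    then show "a \<in> sigma_sets (topspace Y) cells" by (simp add: sets_borel_of_cells)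
  next
    fix b assume "b \<in> cells"
    then show "b \<in> sigma_sets (topspace Y) ?R"
      using lvl_cell unfolding cells_def by (auto intro!: sigma_sets.Basic)
  qed
  have sub: "?R \<subseteq> Pow (topspace Y)" using V_sub by (auto simp: lvl_def)
  have sM: "sets M = sigma_sets (topspace Y) ?R"
    unfolding M_def by (rule sets_measure_of[OF sub])
  have "emeasure M s = \<mu> s" if "s \<in> sets M" for s
    by (rule emeasure_measure_of[OF M_def sub _ _ that])
      (use \<mu>(2) in \<open>auto simp: sM measure_space_def\<close>)
  moreover have "cell n v \<in> sets M" for n v using cell_borel sig sM by simp
  ultimately have "emeasure M (cell n v) = w n v" if "v \<in> \<phi> n ` V n" for n v
  proof -
    have "\<phi> n ` cell n v = {v}" using that by (auto simp: cell_def)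
    then show ?thesis
      using \<open>\<And>s. s \<in> sets M \<Longrightarrow> emeasure M s = \<mu> s\<close>[OF \<open>cell n v \<in> sets M\<close>] \<mu>(1)[of "cell n v"]
        f[OF lvl_cell[of n v]] lvl_cell[of n v] by auto
  qed
  then show ?thesis using sM sig by auto
qed

lemma emeasure_cell_lvl:
  assumes "sets M = sets (borel_of Y)" "n \<le> k"
  shows "emeasure M (cell n v) = (\<Sum>u\<in>\<phi> k ` cell n v. emeasure M (cell k u))"
proof -
  have l: "lvl k (cell n v)" by (rule lvl_mono[OF lvl_cell assms(2)])
  have "emeasure M (\<Union>u\<in>\<phi> k ` cell n v. cell k u) = (\<Sum>u\<in>\<phi> k ` cell n v. emeasure M (cell k u))"
  proof (rule sum_emeasure[symmetric])
    show "finite (\<phi> k ` cell n v)" by (rule finite_lvl[OF l])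
    show "disjoint_family_on (cell k) (\<phi> k ` cell n v)"
      by (auto simp: disjoint_family_on_def cell_def)
  qed (use cell_borel assms in auto)
  then show ?thesis unfolding lvl_eq[OF l, symmetric] .
qed

lemmas emeasure_cell_Suc = emeasure_cell_lvl[OF _ le_SucI[OF order_refl]]

text \<open>The differences of the two weights are again consistent, hence come from a measure
  \<open>D\<close> with \<open>N = D + M\<close>. This passes from cells to all Borel sets without
  any approximation argument.\<close>

lemma emeasure_le_cells:
  assumes M: "sets M = sets (borel_of Y)" and N: "sets N = sets (borel_of Y)"
    and le: "\<And>n v. v \<in> \<phi> n ` V n \<Longrightarrow> emeasure M (cell n v) \<le> emeasure N (cell n v)"
    and fin: "\<And>n v. v \<in> \<phi> n ` V n \<Longrightarrow> emeasure N (cell n v) \<noteq> \<infinity>"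
    and A: "A \<in> sets (borel_of Y)"
  shows "emeasure M A \<le> emeasure N A"
proof -
  have lab: "u \<in> \<phi> (Suc n) ` V (Suc n)" if "u \<in> \<phi> (Suc n) ` cell n v" for n u v
    using that V_mono[of n "Suc n"] by (auto simp: cell_def)
  have "\<exists>D. sets D = sets (borel_of Y) \<and> (\<forall>n. \<forall>v\<in>\<phi> n ` V n. emeasure D (cell n v) =
      emeasure N (cell n v) - emeasure M (cell n v))"
  proof (rule ex_cell_measure)
    fix n v assume v: "v \<in> \<phi> n ` V n"
    show "emeasure N (cell n v) - emeasure M (cell n v) \<noteq> \<infinity>"
      using fin[OF v] by (simp add: ennreal_minus_eq_top)
    let ?S = "\<phi> (Suc n) ` cell n v"
    \<comment> \<open>Subtraction in \<open>ennreal\<close> can be moved past the sum because the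
      subtracted sum is finite and each of its terms is at most the term it is taken from.\<close>
    have finM: "(\<Sum>u\<in>?S. emeasure M (cell (Suc n) u)) \<noteq> \<infinity>"
      using le[OF v] fin[OF v] unfolding emeasure_cell_Suc[OF M, of n v, symmetric]
      by (auto simp: top_unique)
    have "(\<Sum>u\<in>?S. emeasure N (cell (Suc n) u) - emeasure M (cell (Suc n) u))
        + (\<Sum>u\<in>?S. emeasure M (cell (Suc n) u)) = (\<Sum>u\<in>?S. emeasure N (cell (Suc n) u))"
      unfolding sum.distrib[symmetric]
      by (rule sum.cong[OF refl]) (rule diff_add_cancel_ennreal[OF le[OF lab]])
    then show "emeasure N (cell n v) - emeasure M (cell n v) =
        (\<Sum>u\<in>?S. emeasure N (cell (Suc n) u) - emeasure M (cell (Suc n) u))"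
      unfolding emeasure_cell_Suc[OF M, of n v] emeasure_cell_Suc[OF N, of n v]
      using ennreal_add_diff_cancel_right[of "\<Sum>u\<in>?S. emeasure M (cell (Suc n) u)"
        "\<Sum>u\<in>?S. emeasure N (cell (Suc n) u) - emeasure M (cell (Suc n) u)"] finM
      by simp
  qed
  then obtain D where D: "sets D = sets (borel_of Y)" "\<And>n v. v \<in> \<phi> n ` V n \<Longrightarrow>
      emeasure D (cell n v) = emeasure N (cell n v) - emeasure M (cell n v)" by auto
  have DM: "emeasure (add_measure D M) B = emeasure D B + emeasure M B" if "B \<in> sets (borel_of Y)" for B
    using that D(1) M by (intro emeasure_add_measure) auto
  have "N = add_measure D M"
  proof (rule measure_eqI_cells)
    show "sets (add_measure D M) = sets (borel_of Y)" using D(1) by simp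
    fix n v assume v: "v \<in> \<phi> n ` V n"
    show "emeasure N (cell n v) = emeasure (add_measure D M) (cell n v)"
      unfolding DM[OF cell_borel] D(2)[OF v] using le[OF v] by (simp add: diff_add_cancel_ennreal)
  qed (use N fin in auto)
  then show ?thesis using DM[OF A] by (simp add: add_increasing)
qed

lemma compact_sub_V:
  assumes "compactin Y K"
  obtains n where "K \<subseteq> V n"
proof -
  have K: "K \<subseteq> topspace Y" using assms by (rule compactin_subset_topspace)
  have "openin Y (V n)" for n by (rule lvl_open[of n]) (auto simp: lvl_def cell_def)
  moreover have "K \<subseteq> \<Union>(range V)" using K V_cover by auto
  ultimately obtain I where I: "finite I" "I \<subseteq> range V" "K \<subseteq> \<Union>I"
    using compactinD[OF assms, of "range V"] by auto
  then obtain J where J: "finite J" "I = V ` J" using finite_subset_image by metis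
  obtain n where n: "\<forall>j\<in>J. j \<le> n" using J(1) finite_nat_set_iff_bounded_le by auto
  have "V j \<subseteq> V n" if "j \<in> J" for j using n that by (intro V_mono) simp
  then have "\<Union>I \<subseteq> V n" unfolding J(2) by (rule UN_least)
  with I(3) have "K \<subseteq> V n" by (rule subset_trans)
  then show ?thesis by (rule that)
qed

text \<open>Each compact set lies in one \<open>V n\<close>, which is a finite union of
  cells.\<close>

lemma radon_measure_on_iff:
  "radon_measure_on Y M \<longleftrightarrow> sets M = sets (borel_of Y) \<and>
     (\<forall>n. \<forall>v\<in>\<phi> n ` V n. emeasure M (cell n v) \<noteq> \<infinity>)"
proof (intro iffI conjI)
  assume "radon_measure_on Y M"
  then show "sets M = sets (borel_of Y)" unfolding radon_measure_on_def by simp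
  have "emeasure M (cell n v) < \<infinity>" for n v
    using \<open>radon_measure_on Y M\<close> compact_cell unfolding radon_measure_on_def cell_def by simp
  then show "\<forall>n. \<forall>v\<in>\<phi> n ` V n. emeasure M (cell n v) \<noteq> \<infinity>" by (simp add: less_top)
next
  assume M: "sets M = sets (borel_of Y) \<and> (\<forall>n. \<forall>v\<in>\<phi> n ` V n. emeasure M (cell n v) \<noteq> \<infinity>)"
  have "emeasure M K < \<infinity>" if K: "compactin Y K" for K
  proof -
    obtain n where n: "K \<subseteq> V n" using compact_sub_V[OF K] .
    have eq: "(\<Union>v\<in>\<phi> n ` V n. cell n v) = V n" by (auto simp: cell_def)
    have "emeasure M (\<Union>v\<in>\<phi> n ` V n. cell n v) \<le> (\<Sum>v\<in>\<phi> n ` V n. emeasure M (cell n v))"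
      using emeasure_subadditive_finite[of "\<phi> n ` V n" "cell n" M] M cell_borel finite_labels[of n]
      by (simp add: image_subset_iff)
    then have "emeasure M (V n) \<le> (\<Sum>v\<in>\<phi> n ` V n. emeasure M (cell n v))"
      unfolding eq .
    also have "\<dots> < \<infinity>" using M finite_labels[of n] by (simp add: less_top)
    finally have "emeasure M (V n) < \<infinity>" .
    moreover have "emeasure M K \<le> emeasure M (V n)"
      by (rule emeasure_mono[OF n]) (simp add: M V_borel)
    ultimately show ?thesis by (rule le_less_trans[rotated])
  qed
  then show "radon_measure_on Y M" using M unfolding radon_measure_on_def by auto
qed

end

lemma nn_integral_eq_imp_AE_eq:
  fixes u v :: "'x \<Rightarrow> ennreal"
  assumes [measurable]: "u \<in> borel_measurable M" "v \<in> borel_measurable M"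
    and le: "AE x in M. u x \<le> v x" and eq: "integral\<^sup>N M u = integral\<^sup>N M v"
    and fin: "integral\<^sup>N M u \<noteq> \<infinity>"
  shows "AE x in M. v x \<le> u x"
proof -
  have "(\<integral>\<^sup>+x. v x - u x \<partial>M) = integral\<^sup>N M v - integral\<^sup>N M u"
    by (rule nn_integral_diff) (use fin le in auto)
  also have "\<dots> = 0" using eq fin by simp
  finally have "AE x in M. v x - u x = 0"
    by (subst (asm) nn_integral_0_iff_AE) auto
  then show ?thesis by eventually_elim (simp add: diff_eq_0_iff_ennreal)
qed

lemma const_on_int_interval:
  fixes f :: "int \<Rightarrow> 'a"
  assumes step: "\<And>u. a \<le> u \<Longrightarrow> u < b \<Longrightarrow> f (u + 1) = f u"
    and "a \<le> s" "s \<le> b" "a \<le> t" "t \<le> b"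
  shows "f s = f t"
proof -
  have "f v = f u" if "u \<le> v" "a \<le> u" "v \<le> b" for u v
    using that
  proof (induction v rule: int_ge_induct)
    case (step i)
    then show ?case using assms(1)[of i] by simp
  qed simp
  from this[of s t] this[of t s] show ?thesis
    using assms(2-5) by (cases "s \<le> t") auto
qed

section \<open>Coordinates and the action\<close>

lemma chacon_h_ge: "int n + 1 \<le> chacon_h n"
  by (induction n) auto

lemma chacon_h_pos: "1 \<le> chacon_h n"
  using chacon_h_ge[of n] by linarith

lemma odd_chacon_h: "odd (chacon_h n)"
  by (cases n) auto

lemma mem_chacon_F: "f \<in> chacon_F n \<longleftrightarrow> 2 * \<bar>f\<bar> < chacon_h n"
  unfolding chacon_F_def by auto

lemma finite_chacon_F: "finite (chacon_F n)"
  unfolding chacon_F_def by simp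

locale chacon =
  fixes \<omega> :: "nat \<Rightarrow> int"
  assumes omega: "\<omega> n \<in> {0, 1}"
begin

abbreviation "h \<equiv> chacon_h"
abbreviation "F \<equiv> chacon_F"
abbreviation "C \<equiv> chacon_C \<omega>"
abbreviation "L n \<equiv> topspace (chacon_level \<omega> n)"
abbreviation "X \<equiv> chacon_X \<omega>"
abbreviation "incl \<equiv> chacon_incl \<omega>"
abbreviation "cyl \<equiv> chacon_cyl \<omega>"
abbreviation "T \<equiv> chacon_T \<omega>"
abbreviation "topo \<equiv> chacon_top \<omega>"

definition lo :: "nat \<Rightarrow> int" where "lo n = - h n - 1 + \<omega> n"
definition hi :: "nat \<Rightarrow> int" where "hi n = h n + \<omega> n"

lemma C_Suc: "C (Suc n) = {lo n, 0, hi n}"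
  by (simp add: chacon_C_def lo_def hi_def)

text \<open>The asymmetry of the construction: the two outer digits cancel up to a spacer, so for
  \<omega> in {0, 1} the result is \<plusminus>1 and never 0.\<close>

lemma lo_hi_sum: "lo n + hi n = 2 * \<omega> n - 1"
  by (simp add: lo_def hi_def)

lemma lo_neg: "lo n \<le> - h n" and hi_pos: "h n \<le> hi n"
  using omega[of n] by (auto simp: lo_def hi_def)

lemma lo_hi_distinct [simp]: "lo n \<noteq> 0" "hi n \<noteq> 0" "lo n \<noteq> hi n" "0 \<noteq> lo n" "0 \<noteq> hi n" "hi n \<noteq> lo n"
  using lo_neg[of n] hi_pos[of n] chacon_h_pos[of n] by auto

lemma L_eq: "L n = Pi\<^sub>E {n..} (\<lambda>k. if k = n then F n else C k)"
  unfolding chacon_level_def topspace_product_topology by (simp add: comp_def)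

lemma L_D:
  assumes "x \<in> L n"
  shows "x n \<in> F n" "n < k \<Longrightarrow> x k \<in> C k" "k < n \<Longrightarrow> x k = undefined"
  using assms unfolding L_eq by (auto simp: PiE_iff extensional_def split: if_splits)

text \<open>Distinct digits are at least \<open>h n\<close> apart while \<open>F n\<close> has
  diameter \<open>h n - 1\<close>, so the translates of \<open>F n\<close> by digits are
  disjoint.\<close>

lemma FC_unique:
  assumes "f \<in> F n" "f' \<in> F n" "c \<in> C (Suc n)" "c' \<in> C (Suc n)" "f + c = f' + c'"
  shows "f = f'" "c = c'"
proof -
  have "\<bar>c - c'\<bar> < h n"
    using assms(1,2,5) unfolding mem_chacon_F by linarith
  with assms(3,4) show "c = c'"
    using omega[of n] chacon_h_pos[of n] unfolding C_Suc lo_def hi_def by auto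
  with assms show "f = f'" by simp
qed

text \<open>Elements of \<open>F (Suc n)\<close> may reach \<open>6 * h n\<close> here, so the
  translates fill only about its middle half. The free margin absorbs any fixed translation at high
  levels (\<open>shift_in_F\<close>).\<close>

lemma FC_bound:
  assumes "f \<in> F n" "c \<in> C (Suc n)"
  shows "2 * \<bar>f + c\<bar> \<le> 3 * h n + 1"
  using assms omega[of n] chacon_h_pos[of n] unfolding mem_chacon_F C_Suc lo_def hi_def by auto

lemma FC_in: "f \<in> F n \<Longrightarrow> c \<in> C (Suc n) \<Longrightarrow> f + c \<in> F (Suc n)"
  using FC_bound[of f n c] chacon_h_pos[of n] by (simp add: mem_chacon_F)

lemma emb_Suc_in:
  assumes "x \<in> L n"
  shows "chacon_emb n (Suc n) x \<in> L (Suc n)"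
proof -
  have x: "x n \<in> F n" "x (Suc n) \<in> C (Suc n)" "\<And>k. k > n \<Longrightarrow> x k \<in> C k"
    using L_D[OF assms] by auto
  then have "x n + x (Suc n) \<in> F (Suc n)" by (intro FC_in)
  then show ?thesis
    using x unfolding L_eq chacon_emb_Suc by auto
qed

lemma emb_Suc_inj:
  assumes "x \<in> L n" "y \<in> L n" "chacon_emb n (Suc n) x = chacon_emb n (Suc n) y"
  shows "x = y"
proof
  fix k
  have x: "x n \<in> F n" "x (Suc n) \<in> C (Suc n)" and y: "y n \<in> F n" "y (Suc n) \<in> C (Suc n)"
    using L_D[OF assms(1)] L_D[OF assms(2)] by auto
  have "x n + x (Suc n) = y n + y (Suc n)"
    using fun_cong[OF assms(3), of "Suc n"] by (simp add: chacon_emb_Suc)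
  note eq = FC_unique[OF x(1) y(1) x(2) y(2) this]
  consider "k < n" | "k = n" | "k = Suc n" | "k > Suc n" by linarith
  then show "x k = y k"
  proof cases
    case 1
    then show ?thesis using L_D(3) assms(1,2) by metis
  next
    case 4
    then show ?thesis using fun_cong[OF assms(3), of k] by (simp add: chacon_emb_Suc)
  qed (use eq in auto)
qed

lemma emb_in: "n \<le> k \<Longrightarrow> x \<in> L n \<Longrightarrow> chacon_emb n k x \<in> L k"
proof (induction k rule: dec_induct)
  case base
  then show ?case by (simp add: chacon_emb_self)
next
  case (step k)
  then have "chacon_emb k (Suc k) (chacon_emb n k x) \<in> L (Suc k)" by (intro emb_Suc_in)
  then show ?case using step by (simp add: chacon_emb_comp)
qed

lemma emb_inj:
  "n \<le> k \<Longrightarrow> x \<in> L n \<Longrightarrow> y \<in> L n \<Longrightarrow> chacon_emb n k x = chacon_emb n k y \<Longrightarrow> x = y"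
proof (induction k rule: dec_induct)
  case base
  then show ?case by (simp add: chacon_emb_self)
next
  case (step k)
  have "chacon_emb k (Suc k) (chacon_emb n k x) = chacon_emb k (Suc k) (chacon_emb n k y)"
    using step by (simp add: chacon_emb_comp)
  then have "chacon_emb n k x = chacon_emb n k y"
    by (rule emb_Suc_inj[rotated 2]) (use step in \<open>auto intro: emb_in\<close>)
  then show ?case using step by blast
qed

lemma incl_inj: "x \<in> L n \<Longrightarrow> y \<in> L n \<Longrightarrow> incl n x = incl n y \<longleftrightarrow> x = y"
  using emb_inj by (auto simp: chacon_incl_eq_iff)

lemma incl_emb:
  assumes "x \<in> L n" "n \<le> k"
  shows "incl k (chacon_emb n k x) = incl n x"
proof -
  have "chacon_emb k k (chacon_emb n k x) = chacon_emb n k x"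
    by (rule chacon_emb_comp) (use assms in auto)
  then show ?thesis
    using assms by (auto simp: chacon_incl_eq_iff emb_in)
qed

definition XX :: "nat \<Rightarrow> (nat \<times> (nat \<Rightarrow> int)) set set" where
  "XX n = incl n ` L n"

text \<open>The first entry of a point at level \<open>n\<close>; sequences of these integers
  replace the quotient from here on. The value 0 off \<open>XX n\<close> is a placeholder that makes
  \<open>coord n\<close> total and measurable.\<close>

definition coord :: "nat \<Rightarrow> (nat \<times> (nat \<Rightarrow> int)) set \<Rightarrow> int" where
  "coord n p = (if p \<in> XX n then (THE z. z \<in> L n \<and> p = incl n z) n else 0)"

lemma coord_incl_self: "z \<in> L n \<Longrightarrow> coord n (incl n z) = z n"
proof -
  assume z: "z \<in> L n"
  then have "(THE y. y \<in> L n \<and> incl n z = incl n y) = z"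
    using incl_inj by (intro the_equality) auto
  with z show ?thesis by (simp add: coord_def XX_def)
qed

lemma incl_in_XX: "z \<in> L n \<Longrightarrow> n \<le> m \<Longrightarrow> incl n z \<in> XX m"
  using incl_emb[of z n m] emb_in[of n m z] unfolding XX_def by (metis imageI)

lemma coord_incl: "z \<in> L n \<Longrightarrow> n \<le> m \<Longrightarrow> coord m (incl n z) = (\<Sum>i=n..m. z i)"
proof -
  assume a: "z \<in> L n" "n \<le> m"
  have "coord m (incl n z) = chacon_emb n m z m"
    using coord_incl_self[OF emb_in[OF a(2,1)]] incl_emb[OF a] by simp
  then show ?thesis by (simp add: chacon_emb_def)
qed

lemma XX_mono: "n \<le> m \<Longrightarrow> XX n \<subseteq> XX m"
  using incl_in_XX unfolding XX_def[of n] by auto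

lemma X_eq: "X = (\<Union>n. XX n)"
  unfolding chacon_X_def XX_def chacon_incl_def quotient_def by auto

lemma XX_sub_X: "XX n \<subseteq> X"
  unfolding X_eq by auto

lemma coord_in_F: "p \<in> XX n \<Longrightarrow> coord n p \<in> F n"
  unfolding XX_def by (auto simp: coord_incl_self L_D)

lemma coord_step: "p \<in> XX n \<Longrightarrow> n \<le> k \<Longrightarrow> coord (Suc k) p - coord k p \<in> C (Suc k)"
proof -
  assume a: "p \<in> XX n" "n \<le> k"
  then obtain z where z: "z \<in> L n" "p = incl n z" unfolding XX_def by auto
  then have "coord (Suc k) p - coord k p = z (Suc k)"
    using a by (simp add: coord_incl)
  then show ?thesis using L_D(2)[OF z(1)] a by simp
qed

text \<open>Together with \<open>coord_inject\<close> it identifies \<open>XX n\<close> with the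
  sequences that start in \<open>F n\<close> and have their increments in the sets \<open>C\<close>,
  so points can be built and compared without returning to the quotient.\<close>

lemma ex_coord:
  assumes "a n \<in> F n" "\<And>k. n \<le> k \<Longrightarrow> a (Suc k) - a k \<in> C (Suc k)"
  shows "\<exists>p \<in> XX n. \<forall>k\<ge>n. coord k p = a k"
proof -
  define z where "z = (\<lambda>k\<in>{n..}. if k = n then a n else a k - a (k - 1))"
  have z: "z \<in> L n"
    unfolding L_eq z_def
  proof (rule restrict_PiE_iff[THEN iffD2], rule ballI)
    fix k assume "k \<in> {n..}"
    then have "k = n \<or> (\<exists>j. k = Suc j \<and> n \<le> j)" by (cases k) auto
    then show "(if k = n then a n else a k - a (k - 1)) \<in> (if k = n then F n else C k)"
      using assms by auto
  qed
  have "(\<Sum>i=n..k. z i) = a k" if "n \<le> k" for k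
    using that by (induction k rule: dec_induct) (auto simp: z_def)
  then show ?thesis
    using z coord_incl[OF z] incl_in_XX[OF z, of n] by (intro bexI[of _ "incl n z"]) auto
qed

lemma coord_inject:
  assumes "p \<in> XX n" "q \<in> XX n" "\<And>k. n \<le> k \<Longrightarrow> coord k p = coord k q"
  shows "p = q"
proof -
  obtain y z where yz: "y \<in> L n" "p = incl n y" "z \<in> L n" "q = incl n z"
    using assms unfolding XX_def by auto
  have s: "(\<Sum>i=n..k. y i) = (\<Sum>i=n..k. z i)" if "n \<le> k" for k
    using assms(3)[OF that] yz that by (simp add: coord_incl)
  have "y k = z k" for k
  proof (cases "k < n")
    case True
    then show ?thesis using L_D(3) yz by metis
  next
    case False
    show ?thesis
    proof (cases "k = n")
      case True
      then show ?thesis using s[of n] by simp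
    next
      case False
      with \<open>\<not> k < n\<close> obtain j where j: "k = Suc j" "n \<le> j" by (cases k) auto
      then show ?thesis using s[of j] s[of k] by simp
    qed
  qed
  then have "y = z" by auto
  with yz show ?thesis by simp
qed

text \<open>Prepending \<open>f\<close> to the coordinates of \<open>p\<close> gives an admissible
  sequence, hence a point of \<open>XX n\<close>, and \<open>coord_inject\<close> at level
  \<open>Suc n\<close> identifies it with \<open>p\<close>.\<close>

lemma coord_down:
  assumes "p \<in> XX (Suc n)" "f \<in> F n" "c \<in> C (Suc n)" "coord (Suc n) p = f + c"
  shows "p \<in> XX n" "coord n p = f"
proof -
  define a where "a = (\<lambda>k. if k = n then f else coord k p)"
  obtain q where q: "q \<in> XX n" "\<And>k. k \<ge> n \<Longrightarrow> coord k q = a k"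
    using ex_coord[of a n] assms coord_step[OF assms(1)] by (force simp: a_def)
  have "q = p"
    by (rule coord_inject[of _ "Suc n"]) (use q assms(1) XX_mono[of n "Suc n"] in \<open>auto simp: a_def\<close>)
  with q(1) q(2)[of n] show "p \<in> XX n" "coord n p = f" by (auto simp: a_def)
qed

lemma coord_determined:
  assumes "p \<in> XX n" "q \<in> XX m" "n \<le> m" "coord m p = coord m q"
  shows "q \<in> XX n" "n \<le> k \<Longrightarrow> k \<le> m \<Longrightarrow> coord k q = coord k p"
proof -
  have *: "q \<in> XX j \<and> coord j q = coord j p" if "n \<le> j" "j \<le> m" for j
    using that(2,1)
  proof (induction j rule: inc_induct)
    case base
    then show ?case using assms by auto
  next
    case (step j)
    then have q: "q \<in> XX (Suc j)" "coord (Suc j) q = coord (Suc j) p" by auto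
    have p: "p \<in> XX j" using assms(1) XX_mono[of n j] step by auto
    show ?case
      using coord_down[OF q(1) coord_in_F[OF p] coord_step[OF p order_refl]] q(2) by auto
  qed
  show "q \<in> XX n" using *[of n] assms by simp
  show "n \<le> k \<Longrightarrow> k \<le> m \<Longrightarrow> coord k q = coord k p" using *[of k] by simp
qed

lemma cyl_eq: "cyl n f = {p \<in> XX n. coord n p = f}"
  unfolding chacon_cyl_def XX_def by (auto simp: coord_incl_self)

lemma cyl_sub: "cyl n f \<subseteq> X"
  unfolding cyl_eq using XX_sub_X by auto

lemma XX_cyl: "XX n = (\<Union>f\<in>F n. cyl n f)"
  unfolding cyl_eq using coord_in_F by auto

lemma cyl_disjoint: "f \<noteq> g \<Longrightarrow> cyl n f \<inter> cyl n g = {}"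
  unfolding cyl_eq by auto

lemma cyl_nonempty: "f \<in> F n \<Longrightarrow> cyl n f \<noteq> {}"
  using ex_coord[of "\<lambda>_. f" n] unfolding cyl_eq by (force simp: C_Suc)

lemma cyl_subset:
  assumes "n \<le> m" "p \<in> cyl m g" "p \<in> cyl n f"
  shows "cyl m g \<subseteq> cyl n f"
proof
  fix q assume "q \<in> cyl m g"
  then show "q \<in> cyl n f"
    using coord_determined[of p n q m] assms unfolding cyl_eq by auto
qed

lemma coord_bound: "p \<in> XX n \<Longrightarrow> 2 * \<bar>coord (Suc n) p\<bar> \<le> 3 * h n + 1"
  using FC_bound[OF coord_in_F[of p n] coord_step[of p n n]] by simp

text \<open>The digits spread over \<open>2 * h n + 1\<close> and \<open>F n\<close> over
  \<open>h n - 1\<close>. The sum of two such differences is below \<open>h (Suc n)\<close>, as the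
  decoding in \<open>coord_sum_orbit\<close> requires.\<close>

lemma coord_diff_bound:
  assumes "p \<in> XX n" "q \<in> XX n"
  shows "\<bar>coord (Suc n) p - coord (Suc n) q\<bar> \<le> 3 * h n"
proof -
  have "coord n p \<in> F n" "coord n q \<in> F n" using assms by (auto intro: coord_in_F)
  moreover have "coord (Suc n) p - coord n p \<in> C (Suc n)" "coord (Suc n) q - coord n q \<in> C (Suc n)"
    using assms by (auto intro: coord_step)
  ultimately show ?thesis
    using omega[of n] unfolding mem_chacon_F C_Suc lo_def hi_def by auto
qed

text \<open>The margin left by \<open>coord_bound\<close> at level \<open>Suc m\<close> exceeds
  \<open>m\<close>, because \<open>h m\<close> does.\<close>

lemma shift_in_F:
  assumes "p \<in> XX n" "\<bar>g\<bar> \<le> int m" "n \<le> m"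
  shows "g + coord (Suc m) p \<in> F (Suc m)"
proof -
  have "p \<in> XX m" using assms XX_mono by blast
  from coord_bound[OF this] assms(2) chacon_h_ge[of m] show ?thesis
    unfolding mem_chacon_F by simp
qed

lemma T_coord:
  assumes "p \<in> XX n" "g + coord n p \<in> F n"
  shows "T g p \<in> XX n" "n \<le> m \<Longrightarrow> coord m (T g p) = g + coord m p"
proof -
  obtain z where z: "z \<in> L n" "p = incl n z" using assms unfolding XX_def by auto
  have zn: "coord n p = z n" using z coord_incl_self by simp
  have T: "T g p = incl n (z(n := g + z n))"
    unfolding z(2) by (rule chacon_T_eq) (use z assms zn in auto)
  have z': "z(n := g + z n) \<in> L n"
    by (rule chacon_level_shift) (use z assms zn in auto)
  show "T g p \<in> XX n" unfolding T XX_def using z' by auto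
  show "coord m (T g p) = g + coord m p" if "n \<le> m"
    unfolding T coord_incl[OF z' that] unfolding z(2) coord_incl[OF z(1) that]
    using that by (subst (1 2) sum.atLeast_Suc_atMost) (auto intro!: sum.cong)
qed

lemma T_large:
  assumes "p \<in> X"
  obtains n where "\<And>m. n \<le> m \<Longrightarrow> p \<in> XX m \<and> g + coord m p \<in> F m \<and> T g p \<in> XX m \<and>
    coord m (T g p) = g + coord m p"
proof -
  obtain k where k: "p \<in> XX k" using assms X_eq by auto
  define n where "n = max k (nat \<bar>g\<bar>)"
  have "g + coord (Suc m) p \<in> F (Suc m)" "p \<in> XX (Suc m)" if "n \<le> m" for m
    using shift_in_F[OF k, of g m] XX_mono[of k "Suc m"] k that by (auto simp: n_def)
  then have "p \<in> XX m \<and> g + coord m p \<in> F m" if "Suc n \<le> m" for m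
    using that by (cases m) auto
  then show ?thesis
    by (intro that[of "Suc n"]) (metis T_coord order_refl)
qed

lemma T_in: "p \<in> X \<Longrightarrow> T g p \<in> X"
  by (meson T_large XX_sub_X order_refl subsetD)

lemma X_eqI:
  assumes "p \<in> X" "q \<in> X" "\<And>m. n \<le> m \<Longrightarrow> coord m p = coord m q"
  shows "p = q"
proof -
  obtain a b where "p \<in> XX a" "q \<in> XX b" using assms X_eq by auto
  moreover have "a \<le> max n (max a b)" "b \<le> max n (max a b)" by auto
  ultimately have "p \<in> XX (max n (max a b))" "q \<in> XX (max n (max a b))"
    using XX_mono by blast+
  then show ?thesis
    by (rule coord_inject) (use assms in auto)
qed

lemma T_zero: "p \<in> X \<Longrightarrow> T 0 p = p"
proof -
  assume p: "p \<in> X"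
  obtain n where "\<And>m. n \<le> m \<Longrightarrow> p \<in> XX m \<and> 0 + coord m p \<in> F m \<and> T 0 p \<in> XX m \<and>
    coord m (T 0 p) = 0 + coord m p" using T_large[OF p, of 0] by blast
  then show ?thesis using p T_in by (intro X_eqI[of _ _ n]) auto
qed

lemma T_add: "p \<in> X \<Longrightarrow> T g (T k p) = T (g + k) p"
proof -
  assume p: "p \<in> X"
  obtain a where a: "\<And>m. a \<le> m \<Longrightarrow> coord m (T k p) = k + coord m p"
    using T_large[OF p, of k] by metis
  obtain b where b: "\<And>m. b \<le> m \<Longrightarrow> coord m (T g (T k p)) = g + coord m (T k p)"
    using T_large[OF T_in[OF p], of k g] by metis
  obtain c where c: "\<And>m. c \<le> m \<Longrightarrow> coord m (T (g + k) p) = (g + k) + coord m p"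
    using T_large[OF p, of "g + k"] by metis
  show ?thesis
    by (rule X_eqI[of _ _ "max a (max b c)"]) (use p T_in a b c in auto)
qed

lemma T_inverse: "p \<in> X \<Longrightarrow> T (- g) (T g p) = p" "p \<in> X \<Longrightarrow> T g (T (- g) p) = p"
  by (auto simp: T_add T_zero)

lemma inv_T: "p \<in> X \<Longrightarrow> inv_into X (T 1) p = T (- 1) p"
proof (rule inv_into_f_eq)
  show "inj_on (T 1) X" by (metis T_inverse(1) inj_onI)
qed (auto simp: T_in T_inverse)

lemma T_cyl_iff:
  assumes "p \<in> X" "f \<in> F n" "f - g \<in> F n"
  shows "T g p \<in> cyl n f \<longleftrightarrow> p \<in> cyl n (f - g)"
proof
  assume "T g p \<in> cyl n f"
  then have "T g p \<in> XX n" "coord n (T g p) = f" unfolding cyl_eq by auto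
  then have "T (- g) (T g p) \<in> XX n" "coord n (T (- g) (T g p)) = f - g"
    using T_coord[of "T g p" n "- g"] assms by auto
  then show "p \<in> cyl n (f - g)" using assms T_inverse unfolding cyl_eq by simp
next
  assume "p \<in> cyl n (f - g)"
  then show "T g p \<in> cyl n f" using T_coord[of p n g] assms unfolding cyl_eq by simp
qed

text \<open>Digits can be altered within an orbit: translating by \<open>c - c'\<close> turns
  \<open>f + c'\<close> into \<open>f + c\<close>, again a level \<open>Suc k\<close> position over
  the same level \<open>k\<close> position \<open>f\<close>, so nothing below is disturbed. The
  later switching arguments rest on this.\<close>

lemma T_switch:
  assumes "p \<in> XX k" "coord (Suc k) p - coord k p = c'" "c \<in> C (Suc k)" "g = c - c'"
  shows "T g p \<in> XX k" "coord k (T g p) = coord k p" "coord (Suc k) (T g p) = coord k p + c"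
    "n \<le> k \<Longrightarrow> T g p \<in> XX n \<longleftrightarrow> p \<in> XX n"
    "p \<in> XX n \<Longrightarrow> n \<le> j \<Longrightarrow> j \<le> k \<Longrightarrow> coord j (T g p) = coord j p"
proof -
  have p: "p \<in> XX (Suc k)" using assms XX_mono[of k "Suc k"] by auto
  have f: "g + coord (Suc k) p = coord k p + c" using assms by simp
  have "coord k p + c \<in> F (Suc k)" using FC_in coord_in_F[OF assms(1)] assms(3) by simp
  then have T: "T g p \<in> XX (Suc k)" "coord (Suc k) (T g p) = coord k p + c"
    using T_coord(2)[OF p, of g "Suc k"] f T_coord(1)[OF p, of g] by auto
  show "coord (Suc k) (T g p) = coord k p + c" by fact
  show Tk: "T g p \<in> XX k" "coord k (T g p) = coord k p"
    using coord_down[OF T(1) coord_in_F[OF assms(1)] assms(3)] T by auto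
  show "n \<le> k \<Longrightarrow> T g p \<in> XX n \<longleftrightarrow> p \<in> XX n"
    using coord_determined(1)[of p n "T g p" k] coord_determined(1)[of "T g p" n p k] Tk assms(1)
    by auto
  show "p \<in> XX n \<Longrightarrow> n \<le> j \<Longrightarrow> j \<le> k \<Longrightarrow> coord j (T g p) = coord j p"
    using coord_determined(2)[of p n "T g p"] Tk by auto
qed

section \<open>The topology\<close>

text \<open>The factors are discrete, so a basic neighbourhood shrinks to fixing all coordinates up
  to the last restricted one.\<close>

lemma openin_level_iff:
  "openin (chacon_level \<omega> m) S \<longleftrightarrow>
     S \<subseteq> L m \<and> (\<forall>x\<in>S. \<exists>k. \<forall>y\<in>L m. (\<forall>i\<in>{m..k}. y i = x i) \<longrightarrow> y \<in> S)"
proof (intro iffI conjI ballI)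
  assume o: "openin (chacon_level \<omega> m) S"
  then show "S \<subseteq> L m" by (rule openin_subset)
  fix x assume x: "x \<in> S"
  let ?T = "\<lambda>k. discrete_topology (if k = m then F m else C k)"
  obtain U where U: "finite {i \<in> {m..}. U i \<noteq> topspace (?T i)}" "x \<in> Pi\<^sub>E {m..} U" "Pi\<^sub>E {m..} U \<subseteq> S"
    using o x unfolding chacon_level_def openin_product_topology_alt by blast
  obtain k where k: "\<forall>i\<in>{i \<in> {m..}. U i \<noteq> topspace (?T i)}. i \<le> k"
    using U(1) finite_nat_set_iff_bounded_le by auto
  have "y \<in> S" if y: "y \<in> L m" "\<forall>i\<in>{m..k}. y i = x i" for y
  proof -
    have "y i \<in> U i" if i: "i \<in> {m..}" for i
    proof (cases "i \<le> k")
      case True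
      then show ?thesis using y(2) U(2) i by (auto simp: PiE_iff)
    next
      case False
      then have "U i = topspace (?T i)" using k i by auto
      then show ?thesis using y(1) i unfolding L_eq by (auto simp: PiE_iff)
    qed
    then have "y \<in> Pi\<^sub>E {m..} U" using y(1) unfolding L_eq by (auto simp: PiE_iff)
    then show ?thesis using U(3) by auto
  qed
  then show "\<exists>k. \<forall>y\<in>L m. (\<forall>i\<in>{m..k}. y i = x i) \<longrightarrow> y \<in> S" by blast
next
  assume a: "S \<subseteq> L m \<and> (\<forall>x\<in>S. \<exists>k. \<forall>y\<in>L m. (\<forall>i\<in>{m..k}. y i = x i) \<longrightarrow> y \<in> S)"
  let ?A = "\<lambda>k. if k = m then F m else C k"
  show "openin (chacon_level \<omega> m) S"
    unfolding chacon_level_def openin_product_topology_alt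
  proof
    fix x assume x: "x \<in> S"
    then obtain k where k: "\<And>y. y \<in> L m \<Longrightarrow> (\<forall>i\<in>{m..k}. y i = x i) \<Longrightarrow> y \<in> S" using a by blast
    have xL: "x \<in> Pi\<^sub>E {m..} ?A" using a x unfolding L_eq by auto
    define U where "U i = (if i \<le> k then {x i} else ?A i)" for i
    have sub: "U i \<subseteq> ?A i" if "i \<in> {m..}" for i
      using PiE_mem[OF xL that] by (auto simp: U_def)
    have "finite {i \<in> {m..}. U i \<noteq> topspace (discrete_topology (?A i))}"
      by (rule finite_subset[of _ "{..k}"]) (auto simp: U_def)
    moreover have "\<forall>i\<in>{m..}. openin (discrete_topology (?A i)) (U i)"
      using sub by simp
    moreover have "x \<in> Pi\<^sub>E {m..} U" using xL by (auto simp: U_def PiE_iff)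
    moreover have "Pi\<^sub>E {m..} U \<subseteq> S"
    proof
      fix y assume y: "y \<in> Pi\<^sub>E {m..} U"
      then have "y \<in> L m" unfolding L_eq using PiE_mono[of "{m..}" U ?A] sub by blast
      moreover have "\<forall>i\<in>{m..k}. y i = x i"
      proof
        fix i assume "i \<in> {m..k}"
        then show "y i = x i" using PiE_mem[OF y, of i] by (simp add: U_def)
      qed
      ultimately show "y \<in> S" by (rule k)
    qed
    ultimately show "\<exists>U. finite {i \<in> {m..}. U i \<noteq> topspace (discrete_topology (?A i))} \<and>
        (\<forall>i\<in>{m..}. openin (discrete_topology (?A i)) (U i)) \<and> x \<in> Pi\<^sub>E {m..} U \<and> Pi\<^sub>E {m..} U \<subseteq> S"
      by (intro exI[of _ U] conjI)
  qed
qed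

lemma incl_agree:
  assumes "x \<in> L n" "y \<in> L n" "\<And>i. n \<le> i \<Longrightarrow> i \<le> k \<Longrightarrow> coord i (incl n y) = coord i (incl n x)"
    "n \<le> i" "i \<le> k"
  shows "y i = x i"
proof (cases "i = n")
  case True
  then show ?thesis using assms(3)[of n] assms by (simp add: coord_incl)
next
  case False
  with assms obtain j where j: "i = Suc j" "n \<le> j" by (cases i) auto
  then show ?thesis using assms(3)[of j] assms(3)[of i] assms by (simp add: coord_incl)
qed

text \<open>The cylinders form a base of the inductive limit: fixing the coordinate at a high level
  \<open>m\<close> fixes all earlier ones by \<open>coord_determined\<close>, hence all digits on
  which a basic neighbourhood in a level depends.\<close>

lemma openin_topo_iff:
  "openin topo U \<longleftrightarrow> U \<subseteq> X \<and> (\<forall>p\<in>U. \<exists>n. p \<in> XX n \<and> cyl n (coord n p) \<subseteq> U)"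
proof (intro iffI conjI ballI)
  assume o: "openin topo U"
  then show "U \<subseteq> X" unfolding openin_chacon_top by blast
  fix p assume p: "p \<in> U"
  with \<open>U \<subseteq> X\<close> obtain n x where x: "x \<in> L n" "p = incl n x" unfolding X_eq XX_def by auto
  have "openin (chacon_level \<omega> n) {x \<in> L n. incl n x \<in> U}" using o unfolding openin_chacon_top by blast
  then obtain k where k: "\<And>y. y \<in> L n \<Longrightarrow> (\<forall>i\<in>{n..k}. y i = x i) \<Longrightarrow> incl n y \<in> U"
    unfolding openin_level_iff using x p by blast
  define m where "m = max n k"
  have pn: "p \<in> XX n" and m: "n \<le> m" using x XX_def by (auto simp: m_def)
  have "cyl m (coord m p) \<subseteq> U"
  proof
    fix q assume "q \<in> cyl m (coord m p)"
    then have q: "q \<in> XX m" "coord m p = coord m q" unfolding cyl_eq by auto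
    note d = coord_determined[OF pn q(1) m q(2)]
    obtain y where y: "y \<in> L n" "q = incl n y" using d(1) XX_def by auto
    have "\<forall>i\<in>{n..k}. y i = x i"
      using incl_agree[OF x(1) y(1), of m] d(2) x y by (auto simp: m_def)
    then show "q \<in> U" using k y by blast
  qed
  then show "\<exists>n. p \<in> XX n \<and> cyl n (coord n p) \<subseteq> U" using pn XX_mono[OF m] by blast
next
  assume a: "U \<subseteq> X \<and> (\<forall>p\<in>U. \<exists>n. p \<in> XX n \<and> cyl n (coord n p) \<subseteq> U)"
  show "openin topo U"
    unfolding openin_chacon_top
  proof (intro conjI allI)
    show "U \<subseteq> X" using a by simp
    fix n
    show "openin (chacon_level \<omega> n) {x \<in> L n. incl n x \<in> U}"
      unfolding openin_level_iff
    proof (intro conjI ballI)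
      fix x assume x: "x \<in> {x \<in> L n. incl n x \<in> U}"
      then obtain m where m: "incl n x \<in> XX m" "cyl m (coord m (incl n x)) \<subseteq> U" using a by blast
      define k where "k = max n m"
      have "incl n y \<in> U" if y: "y \<in> L n" "\<forall>i\<in>{n..k}. y i = x i" for y
      proof -
        have "coord k (incl n y) = coord k (incl n x)"
          using x y by (simp add: coord_incl k_def)
        then have "incl n y \<in> cyl m (coord m (incl n x))"
          using coord_determined[OF m(1), of "incl n y" k] incl_in_XX[OF y(1), of k]
          by (auto simp: cyl_eq k_def)
        then show ?thesis using m by auto
      qed
      then show "\<exists>k. \<forall>y\<in>L n. (\<forall>i\<in>{n..k}. y i = x i) \<longrightarrow> y \<in> {x \<in> L n. incl n x \<in> U}"
        by blast
    qed auto
  qed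
qed

lemma topspace_topo [simp]: "topspace topo = X"
  by (rule topspace_chacon_top)

lemma openin_cyl: "openin topo (cyl n f)"
  unfolding openin_topo_iff using cyl_sub by (auto simp: cyl_eq)

lemma compact_level: "compact_space (chacon_level \<omega> n)"
  unfolding chacon_level_def compact_space_product_topology
  by (intro disjI2 ballI) (auto simp: compact_space_discrete_topology finite_chacon_F chacon_C_def)

lemma continuous_incl: "continuous_map (chacon_level \<omega> n) topo (incl n)"
  unfolding continuous_map_def
  by (auto simp: openin_chacon_top X_eq XX_def)

lemma compactin_cyl: "compactin topo (cyl n f)"
proof -
  let ?S = "{x \<in> L n. x n = f}"
  have "openin (chacon_level \<omega> n) (L n - ?S)"
    unfolding openin_level_iff by (auto intro!: exI[of _ n])
  then have "closedin (chacon_level \<omega> n) ?S"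
    by (auto simp: closedin_def)
  then have "compactin (chacon_level \<omega> n) ?S"
    using compact_level closedin_compact_space by blast
  then show ?thesis
    unfolding chacon_cyl_def using continuous_incl image_compactin by blast
qed

section \<open>The space and its square as cell spaces\<close>

definition XX2 :: "nat \<Rightarrow> ((nat \<times> (nat \<Rightarrow> int)) set \<times> (nat \<times> (nat \<Rightarrow> int)) set) set" where
  "XX2 n = XX n \<times> XX n"

definition coord2 where "coord2 n p = (coord n (fst p), coord n (snd p))"

sublocale C1: cell_space topo XX coord
proof
  show "(\<Union>n. XX n) = topspace topo" by (simp add: X_eq)
  show "n \<le> m \<Longrightarrow> XX n \<subseteq> XX m" for n m by (rule XX_mono)
  show "p \<in> XX n \<Longrightarrow> q \<in> XX m \<Longrightarrow> n \<le> m \<Longrightarrow> coord m q = coord m p \<Longrightarrow>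
     q \<in> XX n \<and> coord n q = coord n p" for p q n m
    using coord_determined[of p n q m] by simp
  show "finite (coord n ` XX n)" for n
    by (rule finite_subset[OF _ finite_chacon_F[of n]]) (auto intro: coord_in_F)
  show "openin topo {p \<in> XX n. coord n p = v}" for n v using openin_cyl unfolding cyl_eq .
  show "compactin topo {p \<in> XX n. coord n p = v}" for n v using compactin_cyl unfolding cyl_eq .
  show "openin topo U \<Longrightarrow> p \<in> U \<Longrightarrow> \<exists>n. p \<in> XX n \<and> {q \<in> XX n. coord n q = coord n p} \<subseteq> U" for U p
    unfolding openin_topo_iff cyl_eq by blast
qed

abbreviation "topo2 \<equiv> prod_topology topo topo"

lemma cell2_eq: "{p \<in> XX2 n. coord2 n p = v} = cyl n (fst v) \<times> cyl n (snd v)"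
  by (auto simp: XX2_def coord2_def cyl_eq)

sublocale C2: cell_space topo2 XX2 coord2
proof
  have "p \<in> (\<Union>n. XX2 n)" if "p \<in> X \<times> X" for p
  proof -
    from that obtain n m where "fst p \<in> XX n" "snd p \<in> XX m" unfolding X_eq by auto
    then have "fst p \<in> XX (max n m)" "snd p \<in> XX (max n m)"
      using XX_mono[of n "max n m"] XX_mono[of m "max n m"] by auto
    then show ?thesis unfolding XX2_def by (auto simp: mem_Times_iff)
  qed
  then show "(\<Union>n. XX2 n) = topspace topo2"
    using XX_sub_X by (auto simp: XX2_def topspace_prod_topology)
  show "n \<le> m \<Longrightarrow> XX2 n \<subseteq> XX2 m" for n m using XX_mono[of n m] by (auto simp: XX2_def)
  show "p \<in> XX2 n \<Longrightarrow> q \<in> XX2 m \<Longrightarrow> n \<le> m \<Longrightarrow> coord2 m q = coord2 m p \<Longrightarrow>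
     q \<in> XX2 n \<and> coord2 n q = coord2 n p" for p q n m
    unfolding XX2_def coord2_def
    using C1.determined[of "fst p" n "fst q" m] C1.determined[of "snd p" n "snd q" m]
    by (auto simp: mem_Times_iff)
  show "finite (coord2 n ` XX2 n)" for n
    by (rule finite_subset[of _ "F n \<times> F n"])
      (auto simp: coord2_def XX2_def finite_chacon_F intro: coord_in_F)
  show "openin topo2 {p \<in> XX2 n. coord2 n p = v}" for n v
    unfolding cell2_eq using openin_cyl by (simp add: openin_prod_Times_iff)
  show "compactin topo2 {p \<in> XX2 n. coord2 n p = v}" for n v
    unfolding cell2_eq using compactin_cyl by (simp add: compactin_Times)
  show "\<exists>n. p \<in> XX2 n \<and> {q \<in> XX2 n. coord2 n q = coord2 n p} \<subseteq> U" if U: "openin topo2 U" "p \<in> U" for U p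
  proof -
    obtain A B where AB: "openin topo A" "openin topo B" "fst p \<in> A" "snd p \<in> B" "A \<times> B \<subseteq> U"
      using U unfolding openin_prod_topology_alt by (metis prod.collapse)
    obtain n where n: "fst p \<in> XX n" "cyl n (coord n (fst p)) \<subseteq> A"
      using AB(1,3) unfolding openin_topo_iff by blast
    obtain m where m: "snd p \<in> XX m" "cyl m (coord m (snd p)) \<subseteq> B"
      using AB(2,4) unfolding openin_topo_iff by blast
    let ?k = "max n m"
    have k: "fst p \<in> XX ?k" "snd p \<in> XX ?k"
      using n m XX_mono[of n ?k] XX_mono[of m ?k] by auto
    have "cyl ?k (coord ?k (fst p)) \<subseteq> cyl n (coord n (fst p))"
      by (rule cyl_subset[of _ _ "fst p"]) (use n k in \<open>auto simp: cyl_eq\<close>)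
    moreover have "cyl ?k (coord ?k (snd p)) \<subseteq> cyl m (coord m (snd p))"
      by (rule cyl_subset[of _ _ "snd p"]) (use m k in \<open>auto simp: cyl_eq\<close>)
    ultimately have "cyl ?k (coord ?k (fst p)) \<times> cyl ?k (coord ?k (snd p)) \<subseteq> A \<times> B"
      using n(2) m(2) by (intro Sigma_mono) auto
    then have "{q \<in> XX2 ?k. coord2 ?k q = coord2 ?k p} \<subseteq> U"
      unfolding cell2_eq using AB(5) by (simp add: coord2_def)
    moreover have "p \<in> XX2 ?k" using k by (auto simp: XX2_def mem_Times_iff)
    ultimately show ?thesis by blast
  qed
qed

lemma C1_cell: "C1.cell n f = cyl n f"
  by (simp add: C1.cell_def cyl_eq)

lemma C2_cell: "C2.cell n v = cyl n (fst v) \<times> cyl n (snd v)"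
  unfolding C2.cell_def by (rule cell2_eq)

lemma coord_image: "coord n ` XX n = F n"
proof
  show "F n \<subseteq> coord n ` XX n"
  proof
    fix f assume "f \<in> F n"
    from cyl_nonempty[OF this] show "f \<in> coord n ` XX n" unfolding cyl_eq by auto
  qed
qed (auto intro: coord_in_F)

lemma coord2_image: "coord2 n ` XX2 n = F n \<times> F n"
proof
  show "F n \<times> F n \<subseteq> coord2 n ` XX2 n"
  proof
    fix v assume "v \<in> F n \<times> F n"
    then obtain p q where "p \<in> XX n" "q \<in> XX n" "v = (coord n p, coord n q)"
      unfolding coord_image[symmetric] by auto
    then show "v \<in> coord2 n ` XX2 n" by (intro image_eqI[of _ _ "(p, q)"]) (auto simp: XX2_def coord2_def)
  qed
qed (auto simp: XX2_def coord2_def intro: coord_in_F)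

section \<open>The measure and its square\<close>

abbreviation "\<mu> \<equiv> chacon_measure \<omega>"

lemma coord_Suc_cyl: "f \<in> F n \<Longrightarrow> coord (Suc n) ` cyl n f = (\<lambda>c. f + c) ` C (Suc n)"
proof
  show "coord (Suc n) ` cyl n f \<subseteq> (\<lambda>c. f + c) ` C (Suc n)"
    using coord_step[of _ n n] by (force simp: cyl_eq image_iff)
  assume f: "f \<in> F n"
  show "(\<lambda>c. f + c) ` C (Suc n) \<subseteq> coord (Suc n) ` cyl n f"
  proof
    fix v assume "v \<in> (\<lambda>c. f + c) ` C (Suc n)"
    then obtain c where c: "c \<in> C (Suc n)" "v = f + c" by auto
    then have "v \<in> F (Suc n)" using FC_in f by auto
    then obtain p where p: "p \<in> XX (Suc n)" "coord (Suc n) p = v"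
      using coord_image[of "Suc n"] by (metis imageE)
    then show "v \<in> coord (Suc n) ` cyl n f"
      using coord_down[OF p(1) f c(1)] c by (intro image_eqI[of _ _ p]) (auto simp: cyl_eq)
  qed
qed

lemma chacon_measure_ex:
  "\<exists>M. sets M = sets (borel_of topo) \<and> (\<forall>n. \<forall>f\<in>F n. emeasure M (cyl n f) = ennreal (1 / 3 ^ n))"
proof -
  have "\<exists>M. sets M = sets (borel_of topo) \<and>
    (\<forall>n. \<forall>f\<in>coord n ` XX n. emeasure M (C1.cell n f) = (\<lambda>n f. ennreal (1 / 3 ^ n)) n f)"
  proof (rule C1.ex_cell_measure)
    fix n f assume "f \<in> coord n ` XX n"
    then have f: "f \<in> F n" unfolding coord_image .
    \<comment> \<open>Three subcylinders of equal weight: this is the consistency of the weights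
      \<open>1 / 3 ^ n\<close>.\<close>
    have "card (coord (Suc n) ` C1.cell n f) = 3"
      unfolding C1_cell coord_Suc_cyl[OF f] by (subst card_image) (auto simp: C_Suc)
    moreover have "3 * ennreal (1 / 3 ^ Suc n) = ennreal (3 * (1 / 3 ^ Suc n))"
      by (subst ennreal_mult) auto
    ultimately show "ennreal (1 / 3 ^ n) = (\<Sum>u\<in>coord (Suc n) ` C1.cell n f. ennreal (1 / 3 ^ Suc n))"
      by simp
  qed simp
  then show ?thesis unfolding coord_image C1_cell by simp
qed

lemma chacon_measure_props:
  "sets \<mu> = sets (borel_of topo) \<and> (\<forall>n. \<forall>f\<in>F n. emeasure \<mu> (cyl n f) = ennreal (1 / 3 ^ n))"
  unfolding chacon_measure_def
proof (rule theI')
  show "\<exists>!M. sets M = sets (borel_of topo) \<and> (\<forall>n. \<forall>f\<in>F n. emeasure M (cyl n f) = ennreal (1 / 3 ^ n))"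
  proof (rule ex_ex1I[OF chacon_measure_ex])
    fix M N
    assume M: "sets M = sets (borel_of topo) \<and> (\<forall>n. \<forall>f\<in>F n. emeasure M (cyl n f) = ennreal (1 / 3 ^ n))"
      and N: "sets N = sets (borel_of topo) \<and> (\<forall>n. \<forall>f\<in>F n. emeasure N (cyl n f) = ennreal (1 / 3 ^ n))"
    show "M = N"
      by (rule C1.measure_eqI_cells) (use M N in \<open>auto simp: C1_cell coord_image\<close>)
  qed
qed

lemma sets_mu [measurable_cong]: "sets \<mu> = sets (borel_of topo)"
  using chacon_measure_props by blast

lemma space_mu [simp]: "space \<mu> = X"
  using sets_eq_imp_space_eq[OF sets_mu] by simp

lemma mu_cyl: "f \<in> F n \<Longrightarrow> emeasure \<mu> (cyl n f) = ennreal (1 / 3 ^ n)"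
  using chacon_measure_props by blast

lemma sigma_finite_mu: "sigma_finite_measure \<mu>"
  by (rule C1.sigma_finite_cells[OF sets_mu]) (simp add: C1_cell coord_image mu_cyl)

lemma cyl_measurable [measurable]: "cyl n f \<in> sets (borel_of topo)"
  using C1.cell_borel by (simp add: C1_cell)

lemma XX_measurable [measurable]: "XX n \<in> sets (borel_of topo)"
  by (rule C1.V_borel)

lemma coord_outside: "p \<notin> XX n \<Longrightarrow> coord n p = 0"
  by (simp add: coord_def)

lemma coord_measurable [measurable]: "coord n \<in> measurable (borel_of topo) (count_space UNIV)"
proof -
  have "coord n -` {v} \<inter> X = (if v = 0 then cyl n v \<union> (X - XX n) else cyl n v)" for v
    using XX_sub_X[of n] coord_outside[of _ n] by (auto simp: cyl_eq)
  moreover have "X - XX n \<in> sets (borel_of topo)"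
    using sets.compl_sets[OF XX_measurable[of n]] by simp
  ultimately have "coord n -` {v} \<inter> X \<in> sets (borel_of topo)" for v
    by simp
  then show ?thesis
    by (subst measurable_count_space_eq2_countable) auto
qed

lemma T_measurable [measurable]: "T g \<in> measurable (borel_of topo) (borel_of topo)"
proof -
  have "T g \<in> measurable (borel_of topo) (sigma X {U. openin topo U})"
  proof (rule measurable_measure_of)
    show "{U. openin topo U} \<subseteq> Pow X" using openin_subset by fastforce
    show "T g \<in> space (borel_of topo) \<rightarrow> X" by (simp add: T_in)
    fix U assume "U \<in> {U. openin topo U}"
    then have U: "openin topo U" by simp
    have "openin topo (T g -` U \<inter> X)"
      unfolding openin_topo_iff
    proof (intro conjI ballI)
      fix p assume p: "p \<in> T g -` U \<inter> X"
      then obtain a where a: "T g p \<in> XX a" "cyl a (coord a (T g p)) \<subseteq> U"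
        using U unfolding openin_topo_iff by blast
      obtain n where n: "\<And>m. n \<le> m \<Longrightarrow> p \<in> XX m \<and> g + coord m p \<in> F m \<and> T g p \<in> XX m \<and>
          coord m (T g p) = g + coord m p" using T_large p by blast
      define m where "m = max a n"
      have m: "p \<in> XX m" "g + coord m p \<in> F m" "T g p \<in> XX m" "coord m (T g p) = g + coord m p"
        using n[of m] by (auto simp: m_def)
      have "cyl m (coord m (T g p)) \<subseteq> cyl a (coord a (T g p))"
        by (rule cyl_subset[of _ _ "T g p"]) (use a m in \<open>auto simp: cyl_eq m_def\<close>)
      moreover have "T g q \<in> cyl m (coord m (T g p))" if "q \<in> cyl m (coord m p)" for q
        using T_coord[of q m g] m that by (auto simp: cyl_eq)
      ultimately have "cyl m (coord m p) \<subseteq> T g -` U \<inter> X"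
        using a cyl_sub[of m "coord m p"] by blast
      then show "\<exists>n. p \<in> XX n \<and> cyl n (coord n p) \<subseteq> T g -` U \<inter> X" using m by blast
    qed auto
    then show "T g -` U \<inter> space (borel_of topo) \<in> sets (borel_of topo)"
      by (simp add: openin_in_borel_of)
  qed
  then show ?thesis by (simp add: borel_of_def)
qed

text \<open>At level \<open>n\<close> a translation may leave \<open>F n\<close>. The preimages of
  the level \<open>Suc k\<close> pieces of a cylinder, for \<open>k\<close> at least
  \<open>\<bar>g\<bar>\<close>, are cylinders of the same level, and the measure of a cylinder
  depends only on its level.\<close>

lemma distr_T: "distr \<mu> (borel_of topo) (T g) = \<mu>"
proof (rule C1.measure_eqI_cells)
  let ?N = "distr \<mu> (borel_of topo) (T g)"
  fix n f assume "f \<in> coord n ` XX n"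
  define k where "k = max n (nat \<bar>g\<bar>)"
  have k: "n \<le> Suc k" by (simp add: k_def)
  have "emeasure ?N (cyl (Suc k) u) = emeasure \<mu> (cyl (Suc k) u)" if u: "u \<in> coord (Suc k) ` C1.cell n f" for u
  proof -
    from u obtain p where p: "p \<in> XX n" "u = coord (Suc k) p" by (auto simp: C1.cell_def)
    have uF: "u \<in> F (Suc k)" "u - g \<in> F (Suc k)"
      using shift_in_F[OF p(1), of 0 k] shift_in_F[OF p(1), of "- g" k] p by (auto simp: k_def)
    have "emeasure ?N (cyl (Suc k) u) = emeasure \<mu> (T g -` cyl (Suc k) u \<inter> X)"
      by (subst emeasure_distr) (auto simp: measurable_cong_sets[OF sets_mu refl])
    also have "T g -` cyl (Suc k) u \<inter> X = cyl (Suc k) (u - g)"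
      using T_cyl_iff[OF _ uF] cyl_sub by blast
    finally show ?thesis using uF by (simp add: mu_cyl)
  qed
  then show "emeasure ?N (C1.cell n f) = emeasure \<mu> (C1.cell n f)"
    using C1.emeasure_cell_lvl[OF _ k, of ?N] C1.emeasure_cell_lvl[OF _ k, of \<mu>] sets_mu
    by (simp add: C1_cell)
  then show "emeasure ?N (C1.cell n f) \<noteq> \<infinity>"
    using mu_cyl \<open>f \<in> coord n ` XX n\<close> by (simp add: C1_cell coord_image)
qed (auto simp: sets_mu)

lemma emeasure_T: "E \<in> sets \<mu> \<Longrightarrow> emeasure \<mu> (T g -` E \<inter> X) = emeasure \<mu> E"
  using emeasure_distr[of "T g" \<mu> "borel_of topo" E] distr_T[of g] sets_mu
  by (simp add: measurable_cong_sets[OF sets_mu refl])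

abbreviation "B1 \<equiv> borel_of topo"
abbreviation "B2 \<equiv> borel_of topo \<Otimes>\<^sub>M borel_of topo"

text \<open>One inclusion holds since the projections are Borel, the other since the countably many
  cells, which are rectangles of cylinders, generate the Borel sets of the product.\<close>

lemma sets_topo2: "sets (borel_of topo2) = sets B2"
proof
  have fst: "fst \<in> measurable (borel_of topo2) B1"
  proof -
    have "fst \<in> measurable (borel_of topo2) (sigma X {U. openin topo U})"
    proof (rule measurable_measure_of)
      show "{U. openin topo U} \<subseteq> Pow X" using openin_subset by fastforce
      fix U assume "U \<in> {U. openin topo U}"
      then have U: "openin topo U" "U \<subseteq> X" using openin_subset by fastforce+
      then have "fst -` U \<inter> X \<times> X = U \<times> X" by auto
      moreover have "openin topo2 (U \<times> X)" using U openin_topspace[of topo] by (simp add: openin_prod_Times_iff)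
      ultimately show "fst -` U \<inter> space (borel_of topo2) \<in> sets (borel_of topo2)"
        by (simp add: openin_in_borel_of)
    qed auto
    then show ?thesis by (simp add: borel_of_def)
  qed
  have snd: "snd \<in> measurable (borel_of topo2) B1"
  proof -
    have "snd \<in> measurable (borel_of topo2) (sigma X {U. openin topo U})"
    proof (rule measurable_measure_of)
      show "{U. openin topo U} \<subseteq> Pow X" using openin_subset by fastforce
      fix U assume "U \<in> {U. openin topo U}"
      then have U: "openin topo U" "U \<subseteq> X" using openin_subset by fastforce+
      then have "snd -` U \<inter> X \<times> X = X \<times> U" by auto
      moreover have "openin topo2 (X \<times> U)" using U openin_topspace[of topo] by (simp add: openin_prod_Times_iff)
      ultimately show "snd -` U \<inter> space (borel_of topo2) \<in> sets (borel_of topo2)"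
        by (simp add: openin_in_borel_of)
    qed auto
    then show ?thesis by (simp add: borel_of_def)
  qed
  have "A \<times> B \<in> sets (borel_of topo2)" if "A \<in> sets B1" "B \<in> sets B1" for A B
  proof -
    have "A \<subseteq> X" "B \<subseteq> X" using sets.sets_into_space[OF that(1)] sets.sets_into_space[OF that(2)] by auto
    then have "A \<times> B = (fst -` A \<inter> space (borel_of topo2)) \<inter> (snd -` B \<inter> space (borel_of topo2))"
      by auto
    then show ?thesis using measurable_sets[OF fst that(1)] measurable_sets[OF snd that(2)] by auto
  qed
  then have "{a \<times> b |a b. a \<in> sets B1 \<and> b \<in> sets B1} \<subseteq> sets (borel_of topo2)" by auto
  from sets.sigma_sets_subset[OF this] show "sets B2 \<subseteq> sets (borel_of topo2)"
    by (simp add: sets_pair_measure)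
  have "C2.cells \<subseteq> sets B2" unfolding C2.cells_def by (auto simp: C2_cell)
  from sets.sigma_sets_subset[OF this] show "sets (borel_of topo2) \<subseteq> sets B2"
    unfolding C2.sets_borel_of_cells by (simp add: space_pair_measure)
qed

section \<open>Translations of pairs and invariant measures on the square\<close>

definition act :: "int \<Rightarrow> int \<Rightarrow> _ \<Rightarrow> _" where
  "act i j p = (T i (fst p), T j (snd p))"

lemma act_measurable [measurable]: "act i j \<in> measurable B2 B2"
  unfolding act_def[abs_def] by measurable

text \<open>Cut down to \<open>X \<times> X\<close> because \<open>chacon_T\<close> is unspecified
  off \<open>X\<close>.\<close>

definition pre where "pre i j E = act i j -` E \<inter> X \<times> X"

lemma space_B2: "space B2 = X \<times> X"
  by (simp add: space_pair_measure)

lemma pre_sets [measurable]: "E \<in> sets B2 \<Longrightarrow> pre i j E \<in> sets B2"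
  using measurable_sets[OF act_measurable, of E i j] by (simp add: pre_def space_B2)

lemma act_in: "p \<in> X \<times> X \<Longrightarrow> act i j p \<in> X \<times> X"
  by (auto simp: act_def T_in)

lemma act_act: "p \<in> X \<times> X \<Longrightarrow> act i j (act k l p) = act (i + k) (j + l) p"
  by (auto simp: act_def T_add)

lemma act_zero: "p \<in> X \<times> X \<Longrightarrow> act 0 0 p = p"
  by (auto simp: act_def T_zero)

lemma pre_pre: "pre i j (pre k l E) = pre (i + k) (j + l) E"
proof (rule set_eqI)
  fix p
  show "p \<in> pre i j (pre k l E) \<longleftrightarrow> p \<in> pre (i + k) (j + l) E"
  proof (cases "p \<in> X \<times> X")
    case True
    then show ?thesis
      using act_act[OF True, of k l i j] act_in[OF True, of i j] unfolding pre_def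
      by (simp only: Int_iff vimage_eq add.commute simp_thms)
  qed (simp add: pre_def)
qed

lemma pre_zero: "E \<subseteq> X \<times> X \<Longrightarrow> pre 0 0 E = E"
  using act_zero by (auto simp: pre_def)

lemma B2_sub: "E \<in> sets B2 \<Longrightarrow> E \<subseteq> X \<times> X"
  using sets.sets_into_space[of E B2] by (simp add: space_B2)

definition rect where "rect n f g = cyl n f \<times> cyl n g"

lemma rect_measurable [measurable]: "rect n f g \<in> sets B2"
  unfolding rect_def by measurable

lemma C2_cell_rect: "C2.cell n (f, g) = rect n f g"
  by (simp add: C2_cell rect_def)

lemma pre_rect:
  assumes "f \<in> F n" "g \<in> F n" "f - i \<in> F n" "g - j \<in> F n"
  shows "pre i j (rect n f g) = rect n (f - i) (g - j)"
  using T_cyl_iff[of _ f n i] T_cyl_iff[of _ g n j] assms cyl_sub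
  unfolding pre_def rect_def act_def by fastforce

lemma measure_eqI_rect:
  assumes "sets M = sets B2" "sets N = sets B2"
    "\<And>n f g. f \<in> F n \<Longrightarrow> g \<in> F n \<Longrightarrow> emeasure M (rect n f g) = emeasure N (rect n f g)"
    "\<And>n f g. f \<in> F n \<Longrightarrow> g \<in> F n \<Longrightarrow> emeasure M (rect n f g) \<noteq> \<infinity>"
  shows "M = N"
  by (rule C2.measure_eqI_cells)
    (use assms sets_topo2 in \<open>auto simp: coord2_image C2_cell_rect\<close>)

lemma rect_cover:
  assumes "sets M = sets B2" "\<And>n f g. f \<in> F n \<Longrightarrow> g \<in> F n \<Longrightarrow> A \<inter> rect n f g \<in> null_sets M" "A \<subseteq> X \<times> X"
  shows "A \<in> null_sets M"
proof -
  have "A = (\<Union>c\<in>C2.cells. A \<inter> c)"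
    using C2.Union_cells assms(3) by auto
  also have "\<dots> \<in> null_sets M"
    by (rule null_sets_UN'[OF C2.countable_cells])
      (use assms(2) in \<open>auto simp: C2.cells_def coord2_image C2_cell_rect\<close>)
  finally show ?thesis .
qed

text \<open>The Radon measures invariant under \<open>T 1 \<times> T (- 1)\<close>: finiteness on
  rectangles is the Radon property by \<open>C2.radon_measure_on_iff\<close>, and invariance under
  all powers is built in.\<close>

definition inv2 where
  "inv2 \<rho> \<longleftrightarrow> sets \<rho> = sets B2 \<and>
     (\<forall>n. \<forall>f\<in>F n. \<forall>g\<in>F n. emeasure \<rho> (rect n f g) \<noteq> \<infinity>) \<and>
     (\<forall>g. \<forall>E\<in>sets B2. emeasure \<rho> (pre g (- g) E) = emeasure \<rho> E)"

lemma inv2_sets: "inv2 \<rho> \<Longrightarrow> sets \<rho> = sets B2"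
  and inv2_fin: "inv2 \<rho> \<Longrightarrow> f \<in> F n \<Longrightarrow> g \<in> F n \<Longrightarrow> emeasure \<rho> (rect n f g) \<noteq> \<infinity>"
  and inv2_pre: "inv2 \<rho> \<Longrightarrow> E \<in> sets B2 \<Longrightarrow> emeasure \<rho> (pre g (- g) E) = emeasure \<rho> E"
  by (auto simp: inv2_def)

lemma inv2I:
  assumes "sets \<rho> = sets B2" "\<And>n f g. f \<in> F n \<Longrightarrow> g \<in> F n \<Longrightarrow> emeasure \<rho> (rect n f g) \<noteq> \<infinity>"
    and 1: "\<And>E. E \<in> sets B2 \<Longrightarrow> emeasure \<rho> (pre 1 (- 1) E) = emeasure \<rho> E"
  shows "inv2 \<rho>"
proof -
  have "emeasure \<rho> (pre g (- g) E) = emeasure \<rho> E" if E: "E \<in> sets B2" for g E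
  proof (induction g rule: int_induct[where k = 0])
    case base
    then show ?case using pre_zero[OF B2_sub[OF E]] by simp
  next
    case (step1 i)
    have "pre (i + 1) (- (i + 1)) E = pre 1 (- 1) (pre i (- i) E)" by (simp add: pre_pre add.commute)
    then show ?case using 1[of "pre i (- i) E"] step1 E by simp
  next
    case (step2 i)
    have "pre 1 (- 1) (pre (i - 1) (- (i - 1)) E) = pre i (- i) E" by (simp add: pre_pre)
    then show ?case using 1[of "pre (i - 1) (- (i - 1)) E"] step2 E by simp
  qed
  with assms show ?thesis by (auto simp: inv2_def)
qed

lemma inv2_rect_eq:
  assumes "inv2 \<rho>" "f \<in> F n" "g \<in> F n" "f' \<in> F n" "g' \<in> F n" "f + g = f' + g'"
  shows "emeasure \<rho> (rect n f g) = emeasure \<rho> (rect n f' g')"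
proof -
  have eq: "f - (f - f') = f'" "g - - (f - f') = g'" using assms(6) by auto
  have "pre (f - f') (- (f - f')) (rect n f g) = rect n f' g'"
    using pre_rect[of f n g "f - f'" "- (f - f')"] assms(2-5) unfolding eq by blast
  then show ?thesis using inv2_pre[OF assms(1), of "rect n f g" "f - f'"] by simp
qed

lemma rect_split:
  assumes "sets \<rho> = sets B2" "f \<in> F n" "g \<in> F n"
  shows "emeasure \<rho> (rect n f g) =
    (\<Sum>c\<in>C (Suc n). \<Sum>c'\<in>C (Suc n). emeasure \<rho> (rect (Suc n) (f + c) (g + c')))"
proof -
  have "coord2 (Suc n) ` C2.cell n (f, g) = coord (Suc n) ` cyl n f \<times> coord (Suc n) ` cyl n g"
    unfolding C2_cell coord2_def by force
  also have "\<dots> = (\<lambda>(c, c'). (f + c, g + c')) ` (C (Suc n) \<times> C (Suc n))"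
    unfolding coord_Suc_cyl[OF assms(2)] coord_Suc_cyl[OF assms(3)] by auto
  finally have im: "coord2 (Suc n) ` C2.cell n (f, g) = \<dots>" .
  have inj: "inj_on (\<lambda>(c, c'). (f + c, g + c')) (C (Suc n) \<times> C (Suc n))"
    by (auto simp: inj_on_def)
  have "emeasure \<rho> (rect n f g) = (\<Sum>u\<in>coord2 (Suc n) ` C2.cell n (f, g). emeasure \<rho> (C2.cell (Suc n) u))"
    using C2.emeasure_cell_Suc[of \<rho> n "(f, g)"] assms(1) sets_topo2 by (simp add: C2_cell_rect)
  also have "\<dots> = (\<Sum>(c, c')\<in>C (Suc n) \<times> C (Suc n). emeasure \<rho> (rect (Suc n) (f + c) (g + c')))"
    unfolding im sum.reindex[OF inj] by (simp add: case_prod_unfold comp_def C2_cell_rect)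
  finally show ?thesis by (simp add: sum.cartesian_product)
qed

text \<open>For \<open>inv2\<close> measures, the common value on the level \<open>n\<close>
  rectangles with coordinate sum \<open>s\<close>. It is read off at a balanced splitting of
  \<open>s\<close>, which lies in \<open>F n\<close> whenever some splitting does.\<close>

definition val where "val \<rho> n s = emeasure \<rho> (rect n (s div 2) (s - s div 2))"

lemma half_in_F: "\<bar>s\<bar> < h n \<Longrightarrow> s div 2 \<in> F n" "\<bar>s\<bar> < h n \<Longrightarrow> s - s div 2 \<in> F n"
proof -
  assume s: "\<bar>s\<bar> < h n"
  obtain k where "h n = 2 * k + 1" using odd_chacon_h[of n] by (auto elim: oddE)
  with s show "s div 2 \<in> F n" "s - s div 2 \<in> F n" unfolding mem_chacon_F by presburger+
qed

lemma sum_F_bound: "f \<in> F n \<Longrightarrow> g \<in> F n \<Longrightarrow> \<bar>f + g\<bar> < h n"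
  unfolding mem_chacon_F by linarith

lemma rect_val: "inv2 \<rho> \<Longrightarrow> f \<in> F n \<Longrightarrow> g \<in> F n \<Longrightarrow> emeasure \<rho> (rect n f g) = val \<rho> n (f + g)"
  unfolding val_def using sum_F_bound[of f n g] by (intro inv2_rect_eq half_in_F) auto

text \<open>The harmonicity relation: a rectangle splits into nine subrectangles, one for each pair
  of digits.\<close>

lemma val_split:
  assumes "inv2 \<rho>" "\<bar>s\<bar> < h n"
  shows "val \<rho> n s = (\<Sum>c\<in>C (Suc n). \<Sum>c'\<in>C (Suc n). val \<rho> (Suc n) (s + c + c'))"
proof -
  have "emeasure \<rho> (rect (Suc n) (s div 2 + c) (s - s div 2 + c')) = val \<rho> (Suc n) (s + c + c')"
    if "c \<in> C (Suc n)" "c' \<in> C (Suc n)" for c c'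
    using rect_val[OF assms(1) FC_in[OF half_in_F(1)[OF assms(2)] that(1)]
        FC_in[OF half_in_F(2)[OF assms(2)] that(2)]]
    by (simp add: algebra_simps)
  then show ?thesis
    using rect_split[OF inv2_sets[OF assms(1)] half_in_F[OF assms(2)]]
    unfolding val_def[of \<rho> n] by simp
qed

lemma sets_mu2: "sets (\<mu> \<Otimes>\<^sub>M \<mu>) = sets B2"
  by (intro sets_pair_measure_cong sets_mu)

lemma mu2_rect: "f \<in> F n \<Longrightarrow> g \<in> F n \<Longrightarrow> emeasure (\<mu> \<Otimes>\<^sub>M \<mu>) (rect n f g) = ennreal (1 / 9 ^ n)"
proof -
  assume "f \<in> F n" "g \<in> F n"
  moreover interpret sigma_finite_measure \<mu> by (rule sigma_finite_mu)
  have "emeasure (\<mu> \<Otimes>\<^sub>M \<mu>) (rect n f g) = emeasure \<mu> (cyl n f) * emeasure \<mu> (cyl n g)"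
    unfolding rect_def by (rule emeasure_pair_measure_Times) (auto simp: sets_mu)
  ultimately show ?thesis
    by (simp add: mu_cyl ennreal_mult[symmetric] power_mult_distrib[symmetric])
qed

lemma inv2_mu2: "inv2 (\<mu> \<Otimes>\<^sub>M \<mu>)"
proof (rule inv2I[OF sets_mu2])
  interpret pair_sigma_finite \<mu> \<mu> by (intro pair_sigma_finite.intro sigma_finite_mu)
  fix E assume E: "E \<in> sets B2"
  have "distr (\<mu> \<Otimes>\<^sub>M \<mu>) B2 (act 1 (- 1)) = distr \<mu> B1 (T 1) \<Otimes>\<^sub>M distr \<mu> B1 (T (- 1))"
    unfolding act_def[abs_def]
    using pair_measure_distr[of "T 1" \<mu> B1 "T (- 1)" \<mu> B1] sigma_finite_mu
    by (simp add: distr_T measurable_cong_sets[OF sets_mu refl] case_prod_unfold)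
  then have "distr (\<mu> \<Otimes>\<^sub>M \<mu>) B2 (act 1 (- 1)) = \<mu> \<Otimes>\<^sub>M \<mu>" by (simp add: distr_T)
  moreover have "emeasure (distr (\<mu> \<Otimes>\<^sub>M \<mu>) B2 (act 1 (- 1))) E = emeasure (\<mu> \<Otimes>\<^sub>M \<mu>) (pre 1 (- 1) E)"
    using E by (subst emeasure_distr)
      (auto simp: pre_def space_pair_measure measurable_cong_sets[OF sets_mu2 refl])
  ultimately show "emeasure (\<mu> \<Otimes>\<^sub>M \<mu>) (pre 1 (- 1) E) = emeasure (\<mu> \<Otimes>\<^sub>M \<mu>) E" by simp
qed (simp add: mu2_rect)

text \<open>If the values at each level agree, the nine terms of \<open>val_split\<close> are equal
  and the value drops by the factor 9 per level, exactly as for the product measure.\<close>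

lemma inv2_const:
  assumes \<rho>: "inv2 \<rho>"
    and const: "\<And>n s t. \<bar>s\<bar> < h n \<Longrightarrow> \<bar>t\<bar> < h n \<Longrightarrow> val \<rho> n s = val \<rho> n t"
  shows "\<rho> = scale_measure (val \<rho> 0 0) (\<mu> \<Otimes>\<^sub>M \<mu>)"
proof (rule measure_eqI_rect)
  have step: "val \<rho> n 0 = 9 * val \<rho> (Suc n) 0" for n
  proof -
    have "val \<rho> (Suc n) (0 + c + c') = val \<rho> (Suc n) 0" if "c \<in> C (Suc n)" "c' \<in> C (Suc n)" for c c'
      using that omega[of n] chacon_h_pos[of n]
      by (intro const) (auto simp: C_Suc lo_def hi_def)
    then have "(\<Sum>c\<in>C (Suc n). \<Sum>c'\<in>C (Suc n). val \<rho> (Suc n) (0 + c + c')) =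
        (\<Sum>c\<in>C (Suc n). \<Sum>c'\<in>C (Suc n). val \<rho> (Suc n) 0)"
      by (intro sum.cong refl) auto
    also have "\<dots> = 9 * val \<rho> (Suc n) 0"
      by (simp add: C_Suc)
    finally show ?thesis
      using val_split[OF \<rho>, of 0 n] chacon_h_pos[of n] by simp
  qed
  have eq: "val \<rho> 0 0 = 9 ^ n * val \<rho> n 0" for n
  proof (induction n)
    case (Suc n)
    then show ?case unfolding step[of n] by (simp only: power_Suc mult_ac)
  qed simp
  fix n f g assume fg: "f \<in> F n" "g \<in> F n"
  have "emeasure \<rho> (rect n f g) = val \<rho> n 0"
    using rect_val[OF \<rho> fg] const[OF sum_F_bound[OF fg], of 0] chacon_h_pos[of n] by simp
  also have "\<dots> = (9 ^ n * ennreal (1 / 9 ^ n)) * val \<rho> n 0"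
  proof -
    have "(9 :: ennreal) ^ n = ennreal (9 ^ n)" by (simp add: ennreal_power[symmetric])
    then have "(9 :: ennreal) ^ n * ennreal (1 / 9 ^ n) = 1" by (simp add: ennreal_mult[symmetric])
    then show ?thesis by simp
  qed
  also have "\<dots> = val \<rho> 0 0 * ennreal (1 / 9 ^ n)" unfolding eq[of n] by (simp add: mult_ac)
  finally show "emeasure \<rho> (rect n f g) = emeasure (scale_measure (val \<rho> 0 0) (\<mu> \<Otimes>\<^sub>M \<mu>)) (rect n f g)"
    using fg by (simp add: mu2_rect)
  show "emeasure \<rho> (rect n f g) \<noteq> \<infinity>" using inv2_fin[OF \<rho> fg] .
qed (use inv2_sets[OF \<rho>] sets_mu2 in auto)

section \<open>Ergodicity\<close>

text \<open>A nearly maximal increment of a bounded harmonic function spreads, one level at a time, to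
  arbitrarily long runs of consecutive nearly maximal increments, because the step \<open>2 * \<omega> n - 1\<close>
  is \<open>\<plusminus>1\<close> and has positive weight. The increments of a run telescope, so they must be small.\<close>

lemma bounded_harmonic_increment:
  fixes b :: "nat \<Rightarrow> int \<Rightarrow> real" and \<sigma> :: real
  assumes bd: "\<And>n s. \<bar>s\<bar> < h n \<Longrightarrow> 0 \<le> b n s \<and> b n s \<le> 1"
    and harm: "\<And>n s. \<bar>s\<bar> < h n \<Longrightarrow> 9 * b n s = (\<Sum>c\<in>C (Suc n). \<Sum>c'\<in>C (Suc n). b (Suc n) (s + c + c'))"
    and \<sigma>: "\<sigma> \<in> {1, -1}"
    and s: "\<bar>s\<bar> < h n" "\<bar>s + 1\<bar> < h n"
  shows "\<sigma> * (b n (s + 1) - b n s) \<le> 0"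
proof -
  define valid where "valid m u \<longleftrightarrow> \<bar>u\<bar> < h m \<and> \<bar>u + 1\<bar> < h m" for m u
  define d where "d m u = \<sigma> * (b m (u + 1) - b m u)" for m u
  define S where "S = {d m u |m u. valid m u}"
  define D where "D = Sup S"
  have d1: "d m u \<le> 1" if "valid m u" for m u
    using bd[of u m] bd[of "u + 1" m] that \<sigma> by (auto simp: valid_def d_def)
  have dD: "d m u \<le> D" if "valid m u" for m u
    unfolding D_def by (rule cSup_upper) (use that d1 in \<open>auto simp: S_def bdd_above_def\<close>)
  have valid_Suc: "valid (Suc m) (u + c + c')"
    if "valid m u" "c \<in> C (Suc m)" "c' \<in> C (Suc m)" for m u c c'
    using that omega[of m] chacon_h_pos[of m] by (auto simp: valid_def C_Suc lo_def hi_def)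
  have d_harm: "9 * d m u = (\<Sum>c\<in>C (Suc m). \<Sum>c'\<in>C (Suc m). d (Suc m) (u + c + c'))"
    if "valid m u" for m u
  proof -
    have "9 * d m u = \<sigma> * (9 * b m (u + 1) - 9 * b m u)" by (simp add: d_def algebra_simps)
    also have "\<dots> = \<sigma> * ((\<Sum>c\<in>C (Suc m). \<Sum>c'\<in>C (Suc m). b (Suc m) (u + 1 + c + c')) -
        (\<Sum>c\<in>C (Suc m). \<Sum>c'\<in>C (Suc m). b (Suc m) (u + c + c')))"
      using harm[of u m] harm[of "u + 1" m] that by (simp add: valid_def)
    also have "\<dots> = (\<Sum>c\<in>C (Suc m). \<Sum>c'\<in>C (Suc m). d (Suc m) (u + c + c'))"
      by (simp add: d_def sum_distrib_left sum_subtractf algebra_simps)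
    finally show ?thesis .
  qed
  \<comment> \<open>Nine increments of size at most \<open>D\<close> with mean at least
    \<open>D - \<eta>\<close> are each at least \<open>D - 9 * \<eta>\<close>. The two that are kept
    belong to the digit pairs (0, 0) and (lo, hi).\<close>
  have spread: "valid (Suc m) u \<and> D - 9 * \<eta> \<le> d (Suc m) u \<and>
      valid (Suc m) (u + (2 * \<omega> m - 1)) \<and> D - 9 * \<eta> \<le> d (Suc m) (u + (2 * \<omega> m - 1))"
    if u: "valid m u" "D - \<eta> \<le> d m u" for m u \<eta>
  proof -
    have v: "valid (Suc m) (u + c + c') \<and> d (Suc m) (u + c + c') \<le> D"
      if "c \<in> {lo m, 0, hi m}" "c' \<in> {lo m, 0, hi m}" for c c'
      using valid_Suc[OF u(1), of c c'] dD that by (simp add: C_Suc)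
    have e: "u + (2 * \<omega> m - 1) = u + lo m + hi m" using lo_hi_sum[of m] by simp
    have "9 * d m u = d (Suc m) (u + lo m + lo m) + d (Suc m) (u + lo m) + d (Suc m) (u + lo m + hi m)
       + d (Suc m) (u + lo m) + d (Suc m) u + d (Suc m) (u + hi m)
       + d (Suc m) (u + hi m + lo m) + d (Suc m) (u + hi m) + d (Suc m) (u + hi m + hi m)"
      using d_harm[OF u(1)] by (simp add: C_Suc)
    then show ?thesis
      unfolding e using u(2) v[of "lo m" "lo m"] v[of "lo m" 0] v[of "lo m" "hi m"] v[of 0 0]
        v[of "hi m" 0] v[of "hi m" "lo m"] v[of "hi m" "hi m"]
      by simp
  qed
  \<comment> \<open>A run gains one element per level: on the right if \<omega> is 1, on the left if
    it is 0. The defect grows by a factor 9 each time.\<close>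
  have run: "\<exists>t. \<forall>i\<le>j. valid (n + j) (t + int i) \<and> D - 9 ^ j * \<delta> \<le> d (n + j) (t + int i)"
    if "valid n u" "D - \<delta> \<le> d n u" for n u \<delta> j
  proof (induction j)
    case 0
    then show ?case using that by (intro exI[of _ u]) simp
  next
    case (Suc j)
    then obtain t where t: "\<And>i. i \<le> j \<Longrightarrow> valid (n + j) (t + int i) \<and> D - 9 ^ j * \<delta> \<le> d (n + j) (t + int i)"
      by blast
    have sp: "valid (n + Suc j) (t + int i) \<and> D - 9 ^ Suc j * \<delta> \<le> d (n + Suc j) (t + int i) \<and>
        valid (n + Suc j) (t + int i + (2 * \<omega> (n + j) - 1)) \<and>
        D - 9 ^ Suc j * \<delta> \<le> d (n + Suc j) (t + int i + (2 * \<omega> (n + j) - 1))" if "i \<le> j" for i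
      using spread[of "n + j" "t + int i" "9 ^ j * \<delta>"] t[OF that] by simp
    show ?case
    proof (cases "\<omega> (n + j) = 1")
      case True
      show ?thesis
      proof (intro exI[of _ t] allI impI)
        fix i assume "i \<le> Suc j"
        then consider "i \<le> j" | "i = Suc j" by linarith
        then show "valid (n + Suc j) (t + int i) \<and> D - 9 ^ Suc j * \<delta> \<le> d (n + Suc j) (t + int i)"
        proof cases
          case 2
          then have e: "t + int i = t + int j + (2 * \<omega> (n + j) - 1)" using True by simp
          show ?thesis unfolding e using sp[of j] by blast
        qed (use sp in blast)
      qed
    next
      case False
      then have w: "\<omega> (n + j) = 0" using omega[of "n + j"] by simp
      show ?thesis
      proof (intro exI[of _ "t - 1"] allI impI)
        fix i assume i: "i \<le> Suc j"
        show "valid (n + Suc j) (t - 1 + int i) \<and> D - 9 ^ Suc j * \<delta> \<le> d (n + Suc j) (t - 1 + int i)"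
        proof (cases i)
          case 0
          then have e: "t - 1 + int i = t + int 0 + (2 * \<omega> (n + j) - 1)" using w by simp
          show ?thesis unfolding e using sp[of 0] by blast
        next
          case (Suc k)
          then have e: "t - 1 + int i = t + int k" by simp
          show ?thesis unfolding e using sp[of k] i Suc by blast
        qed
      qed
    qed
  qed
  have "D \<le> 0"
  proof (rule ccontr)
    assume "\<not> D \<le> 0"
    then have D: "D > 0" by simp
    \<comment> \<open>\<open>j\<close> and \<open>\<delta>\<close> are chosen so that the final
      defect is \<open>D / 2\<close> and \<open>j\<close> increments of size \<open>D / 2\<close>
      exceed 1, the bound for their telescoped sum.\<close>
    obtain j where j: "2 / D < real j" using reals_Archimedean2 by blast
    define \<delta> where "\<delta> = D / (2 * 9 ^ j)"
    have \<delta>: "\<delta> > 0" using D by (simp add: \<delta>_def)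
    have "S \<noteq> {}" using s by (auto simp: S_def valid_def)
    then obtain x where "x \<in> S" "D - \<delta> < x"
      using less_cSupD[of S "D - \<delta>"] \<delta> unfolding D_def by auto
    then obtain m u where mu: "valid m u" "D - \<delta> \<le> d m u" by (auto simp: S_def)
    obtain t where t: "\<And>i. i \<le> j \<Longrightarrow> valid (m + j) (t + int i) \<and> D - 9 ^ j * \<delta> \<le> d (m + j) (t + int i)"
      using run[OF mu] by blast
    have half: "D - 9 ^ j * \<delta> = D / 2" by (simp add: \<delta>_def field_simps)
    have tele: "(\<Sum>i<k. d (m + j) (t + int i)) = \<sigma> * (b (m + j) (t + int k) - b (m + j) t)" for k
      by (induction k) (auto simp: d_def algebra_simps)
    have "real j * (D / 2) \<le> (\<Sum>i<j. d (m + j) (t + int i))"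
      using sum_bounded_below[of "{..<j}" "D / 2" "\<lambda>i. d (m + j) (t + int i)"] t half by simp
    also have "\<dots> = \<sigma> * (b (m + j) (t + int j) - b (m + j) t)" by (rule tele)
    also have "\<dots> \<le> 1"
      using bd[of "t + int j" "m + j"] bd[of t "m + j"] t[of j] t[of 0] \<sigma> by (auto simp: valid_def)
    finally show False using j D by (simp add: field_simps)
  qed
  then show ?thesis using dD[of n s] s by (auto simp: valid_def d_def)
qed

lemma bounded_harmonic_const:
  fixes b :: "nat \<Rightarrow> int \<Rightarrow> real"
  assumes bd: "\<And>n s. \<bar>s\<bar> < h n \<Longrightarrow> 0 \<le> b n s \<and> b n s \<le> 1"
    and harm: "\<And>n s. \<bar>s\<bar> < h n \<Longrightarrow> 9 * b n s = (\<Sum>c\<in>C (Suc n). \<Sum>c'\<in>C (Suc n). b (Suc n) (s + c + c'))"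
    and s: "\<bar>s\<bar> < h n" "\<bar>t\<bar> < h n"
  shows "b n s = b n t"
proof -
  have step: "b n (u + 1) = b n u" if "\<bar>u\<bar> < h n" "\<bar>u + 1\<bar> < h n" for u
    using bounded_harmonic_increment[OF bd harm, of 1 u n]
      bounded_harmonic_increment[OF bd harm, of "-1" u n] that by simp
  show ?thesis
    by (rule const_on_int_interval[of "1 - h n" "h n - 1"]) (use step s in \<open>auto simp: abs_less_iff\<close>)
qed

definition erg2 where
  "erg2 \<rho> \<longleftrightarrow> (\<forall>E\<in>sets B2. pre 1 (- 1) E = E \<longrightarrow> emeasure \<rho> E = 0 \<or> emeasure \<rho> (X \<times> X - E) = 0)"

lemma pre_Int: "pre i j (A \<inter> B) = pre i j A \<inter> pre i j B"
  by (auto simp: pre_def)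

lemma pre_compl: "pre i j (X \<times> X - A) = X \<times> X - pre i j A"
  using act_in[of _ i j] unfolding pre_def by blast

lemma compl_sets: "E \<in> sets B2 \<Longrightarrow> X \<times> X - E \<in> sets B2"
  using sets.compl_sets[of E B2] by (simp add: space_B2)

text \<open>The restriction of the product measure to an invariant set is invariant, and its values
  scaled by \<open>9 ^ n\<close> form a harmonic function with values in [0, 1]. So it is a multiple
  of the product measure. Testing this on the complement of \<open>A\<close> if the factor is 1, and
  on subsets of \<open>A\<close> otherwise, shows that one of the two sets is null.\<close>

lemma erg2_mu2: "erg2 (\<mu> \<Otimes>\<^sub>M \<mu>)"
  unfolding erg2_def
proof (intro ballI impI)
  fix A assume A: "A \<in> sets B2" "pre 1 (- 1) A = A"
  let ?m = "\<mu> \<Otimes>\<^sub>M \<mu>"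
  define \<rho> where "\<rho> = density ?m (indicator A)"
  have \<rho>: "emeasure \<rho> E = emeasure ?m (A \<inter> E)" if "E \<in> sets B2" for E
    unfolding \<rho>_def using that A sets_mu2 by (intro emeasure_restricted) auto
  have le: "emeasure \<rho> E \<le> emeasure ?m E" if "E \<in> sets B2" for E
    unfolding \<rho>[OF that] by (rule emeasure_mono) (use that sets_mu2 in auto)
  have inv: "inv2 \<rho>"
  proof (rule inv2I)
    show "sets \<rho> = sets B2" using sets_mu2 by (simp add: \<rho>_def)
    show "emeasure \<rho> (rect n f g) \<noteq> \<infinity>" if "f \<in> F n" "g \<in> F n" for n f g
      using le[of "rect n f g"] mu2_rect[OF that] by (auto simp: top_unique)
    show "emeasure \<rho> (pre 1 (- 1) E) = emeasure \<rho> E" if E: "E \<in> sets B2" for E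
      using inv2_pre[OF inv2_mu2, of "A \<inter> E" 1] E A by (simp add: \<rho> pre_Int)
  qed
  have val_le: "val \<rho> n s \<le> ennreal (1 / 9 ^ n)" if "\<bar>s\<bar> < h n" for n s
    unfolding val_def using le[of "rect n (s div 2) (s - s div 2)"] mu2_rect half_in_F[OF that] by simp
  define b where "b n s = 9 ^ n * enn2real (val \<rho> n s)" for n s
  have val_b: "val \<rho> n s = ennreal (b n s / 9 ^ n)" if "\<bar>s\<bar> < h n" for n s
    using le_less_trans[OF val_le[OF that] ennreal_less_top] by (simp add: b_def)
  have bd: "0 \<le> b n s \<and> b n s \<le> 1" if "\<bar>s\<bar> < h n" for n s
  proof -
    have "enn2real (val \<rho> n s) \<le> 1 / 9 ^ n"
      by (rule enn2real_leI) (use val_le[OF that] in auto)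
    then show ?thesis by (simp add: b_def field_simps)
  qed
  have harm: "9 * b n s = (\<Sum>c\<in>C (Suc n). \<Sum>c'\<in>C (Suc n). b (Suc n) (s + c + c'))"
    if s: "\<bar>s\<bar> < h n" for n s
  proof -
    have dom: "\<bar>s + c + c'\<bar> < h (Suc n)" if "c \<in> C (Suc n)" "c' \<in> C (Suc n)" for c c'
      using that s omega[of n] chacon_h_pos[of n] by (auto simp: C_Suc lo_def hi_def)
    have fin: "val \<rho> (Suc n) (s + c + c') < top" if "c \<in> C (Suc n)" "c' \<in> C (Suc n)" for c c'
      using val_b[OF dom[OF that]] by simp
    have "enn2real (val \<rho> n s) = (\<Sum>c\<in>C (Suc n). \<Sum>c'\<in>C (Suc n). enn2real (val \<rho> (Suc n) (s + c + c')))"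
    proof -
      have finC: "finite (C (Suc n))" by (simp add: C_Suc)
      have "(\<Sum>c'\<in>C (Suc n). val \<rho> (Suc n) (s + c + c')) < top" if "c \<in> C (Suc n)" for c
        using fin[OF that] finC by simp
      then have "enn2real (val \<rho> n s) = (\<Sum>c\<in>C (Suc n). enn2real (\<Sum>c'\<in>C (Suc n). val \<rho> (Suc n) (s + c + c')))"
        unfolding val_split[OF inv s] by (subst enn2real_sum) (simp_all add: comp_def)
      also have "\<dots> = (\<Sum>c\<in>C (Suc n). \<Sum>c'\<in>C (Suc n). enn2real (val \<rho> (Suc n) (s + c + c')))"
        by (rule sum.cong[OF refl], subst enn2real_sum) (use fin in \<open>simp_all add: comp_def\<close>)
      finally show ?thesis .
    qed
    then show ?thesis by (simp add: b_def sum_distrib_left mult.assoc)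
  qed
  have const: "val \<rho> n s = val \<rho> n t" if "\<bar>s\<bar> < h n" "\<bar>t\<bar> < h n" for n s t
    using bounded_harmonic_const[OF bd harm that] that by (simp add: val_b)
  have eq: "emeasure ?m (A \<inter> E) = val \<rho> 0 0 * emeasure ?m E" if "E \<in> sets B2" for E
    using \<rho>[OF that] inv2_const[OF inv const] by (metis emeasure_scale_measure)
  show "emeasure ?m A = 0 \<or> emeasure ?m (X \<times> X - A) = 0"
  proof (cases "val \<rho> 0 0 = 1")
    case True
    then have "emeasure ?m (X \<times> X - A) = 0"
      using eq[OF compl_sets[OF A(1)]] by simp
    then show ?thesis ..
  next
    case False
    have "A \<in> null_sets ?m"
    proof (rule rect_cover[OF sets_mu2])
      fix n f g assume fg: "f \<in> F n" "g \<in> F n"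
      let ?x = "emeasure ?m (A \<inter> rect n f g)"
      have "?x = val \<rho> 0 0 * ?x"
        using eq[of "A \<inter> rect n f g"] A by (simp add: Int_assoc[symmetric])
      moreover have "?x \<noteq> \<infinity>"
        using le[of "rect n f g"] mu2_rect[OF fg] by (auto simp: \<rho> top_unique)
      moreover have "val \<rho> 0 0 = ennreal (b 0 0)" using val_b[of 0 0] by simp
      ultimately have "?x = 0"
        using False bd[of 0 0]
        by (cases ?x rule: ennreal_cases) (auto simp: ennreal_mult[symmetric])
      then show "A \<inter> rect n f g \<in> null_sets ?m" using A sets_mu2 by (intro null_setsI) auto
    qed (rule B2_sub[OF A(1)])
    then show ?thesis by (auto simp: null_sets_def)
  qed
qed

lemma inv2_sigma_finite: "inv2 \<rho> \<Longrightarrow> sigma_finite_measure \<rho>"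
  by (rule C2.sigma_finite_cells)
    (use inv2_fin[of \<rho>] in \<open>auto simp: inv2_sets sets_topo2 coord2_image C2_cell_rect\<close>)

lemma inv2_space: "inv2 \<rho> \<Longrightarrow> space \<rho> = X \<times> X"
  using sets_eq_imp_space_eq[OF inv2_sets] space_B2 by simp

lemma inv2_distr:
  assumes "inv2 \<rho>"
  shows "distr \<rho> B2 (act g (- g)) = \<rho>"
proof (rule measure_eqI)
  fix E assume "E \<in> sets (distr \<rho> B2 (act g (- g)))"
  then have E: "E \<in> sets B2" by simp
  then show "emeasure (distr \<rho> B2 (act g (- g))) E = emeasure \<rho> E"
    using inv2_pre[OF assms E, of g]
    by (subst emeasure_distr)
      (auto simp: measurable_cong_sets[OF inv2_sets[OF assms] refl] inv2_space[OF assms] pre_def)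
qed (simp add: inv2_sets[OF assms])

text \<open>Since \<open>\<rho>\<close> and the measure with density \<open>f\<close> are both
  invariant, \<open>f\<close> and its translate are densities of the same measure, and densities
  over a sigma-finite measure are unique. One null set serves all forward translates.\<close>

lemma density_invariant:
  assumes \<rho>: "inv2 \<rho>" and \<sigma>: "inv2 (density \<rho> f)" and f[measurable]: "f \<in> borel_measurable B2"
  shows "AE p in \<rho>. \<forall>i::nat. f (act (int i) (- int i) p) = f p"
proof -
  interpret sigma_finite_measure \<rho> by (rule inv2_sigma_finite[OF \<rho>])
  note [measurable_cong] = inv2_sets[OF \<rho>]
  have "density \<rho> (\<lambda>p. f (act (int i) (- int i) p)) = density \<rho> f" for i
  proof (rule measure_eqI)
    let ?R = "act (int i) (- int i)"
    fix E assume "E \<in> sets (density \<rho> (\<lambda>p. f (?R p)))"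
    then have E[measurable]: "E \<in> sets B2" by (simp add: inv2_sets[OF \<rho>])
    define E' where "E' = pre (- int i) (int i) E"
    have E'[measurable]: "E' \<in> sets B2" using E by (simp add: E'_def)
    have EE': "pre (int i) (- int i) E' = E"
      unfolding E'_def pre_pre using pre_zero[OF B2_sub[OF E]] by simp
    have ind: "indicator E p = (indicator E' (?R p) :: ennreal)" if "p \<in> X \<times> X" for p
      using that by (subst EE'[symmetric]) (simp add: indicator_def pre_def)
    have "emeasure (density \<rho> (\<lambda>p. f (?R p))) E = (\<integral>\<^sup>+p. f (?R p) * indicator E p \<partial>\<rho>)"
      by (rule emeasure_density) auto
    also have "\<dots> = (\<integral>\<^sup>+p. f (?R p) * indicator E' (?R p) \<partial>\<rho>)"
      by (rule nn_integral_cong) (use ind inv2_space[OF \<rho>] in auto)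
    also have "\<dots> = (\<integral>\<^sup>+p. f p * indicator E' p \<partial>distr \<rho> B2 ?R)"
      by (rule nn_integral_distr[symmetric]) auto
    also have "\<dots> = (\<integral>\<^sup>+p. f p * indicator E' p \<partial>\<rho>)" by (simp add: inv2_distr[OF \<rho>])
    also have "\<dots> = emeasure (density \<rho> f) E'" by (rule emeasure_density[symmetric]) auto
    also have "\<dots> = emeasure (density \<rho> f) E"
      using inv2_pre[OF \<sigma>, of E "- int i"] E by (simp add: E'_def)
    finally show "emeasure (density \<rho> (\<lambda>p. f (?R p))) E = emeasure (density \<rho> f) E" .
  qed simp
  then have "AE p in \<rho>. f (act (int i) (- int i) p) = f p" for i
    by (subst density_unique_iff[symmetric]) auto
  then show ?thesis by (simp add: AE_all_countable)
qed

text \<open>The set of points whose forward orbit satisfies \<open>P\<close> infinitely often is strictly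
  invariant, as the definition of ergodicity requires.\<close>

definition often where
  "often P = {p \<in> X \<times> X. \<exists>\<^sub>\<infinity>i. P (act (int i) (- int i) p)}"

lemma often_invariant: "pre 1 (- 1) (often P) = often P"
proof (rule set_eqI)
  fix p
  show "p \<in> pre 1 (- 1) (often P) \<longleftrightarrow> p \<in> often P"
  proof (cases "p \<in> X \<times> X")
    case True
    have "act (int i) (- int i) (act 1 (- 1) p) = act (int (Suc i)) (- int (Suc i)) p" for i
      using act_act[OF True, of "int i" "- int i" 1 "- 1"] by (simp add: algebra_simps)
    then have "(\<exists>\<^sub>\<infinity>i. P (act (int i) (- int i) (act 1 (- 1) p))) \<longleftrightarrow>
        (\<exists>\<^sub>\<infinity>i. P (act (int (Suc i)) (- int (Suc i)) p))"
      by (simp only:)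
    also have "\<dots> \<longleftrightarrow> (\<exists>\<^sub>\<infinity>i. P (act (int i) (- int i) p))"
      unfolding frequently_def MOST_Suc_iff[of "\<lambda>i. \<not> P (act (int i) (- int i) p)"] ..
    finally have "(\<exists>\<^sub>\<infinity>i. P (act (int i) (- int i) (act 1 (- 1) p))) \<longleftrightarrow>
        (\<exists>\<^sub>\<infinity>i. P (act (int i) (- int i) p))" .
    then show ?thesis
      using True act_in[OF True] unfolding often_def pre_def by (simp only: mem_Collect_eq vimage_eq Int_iff simp_thms)
  qed (simp add: often_def pre_def)
qed

lemma often_sets:
  assumes P[measurable]: "Measurable.pred B2 P"
  shows "often P \<in> sets B2"
proof -
  have "often P = {p \<in> space B2. \<forall>m. \<exists>i>m. P (act (int i) (- int i) p)}"
    by (simp add: often_def space_B2 INFM_nat)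
  also have "\<dots> \<in> sets B2" by measurable
  finally show ?thesis .
qed

lemma often_AE_iff:
  assumes "inv2 \<rho>" "AE p in \<rho>. \<forall>i::nat. f (act (int i) (- int i) p) = f p"
  shows "AE p in \<rho>. p \<in> often (\<lambda>p. P (f p)) \<longleftrightarrow> P (f p)"
  using assms(2) AE_space
proof eventually_elim
  case (elim p)
  then have "p \<in> X \<times> X" by (simp add: inv2_space[OF assms(1)])
  then show ?case unfolding often_def using elim(1) by (simp add: frequently_const_iff)
qed

lemma erg2_AE:
  assumes \<rho>: "inv2 \<rho>" "erg2 \<rho>" and E: "E \<in> sets B2" "pre 1 (- 1) E = E"
  shows "(AE p in \<rho>. p \<in> E) \<or> (AE p in \<rho>. p \<notin> E)"
proof -
  have "emeasure \<rho> E = 0 \<or> emeasure \<rho> (X \<times> X - E) = 0" using \<rho>(2) E by (auto simp: erg2_def)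
  then show ?thesis
  proof
    assume "emeasure \<rho> E = 0"
    then have "AE p in \<rho>. p \<notin> E"
      using E by (intro AE_not_in null_setsI) (auto simp: inv2_sets[OF \<rho>(1)])
    then show ?thesis ..
  next
    assume "emeasure \<rho> (X \<times> X - E) = 0"
    then have "AE p in \<rho>. p \<notin> X \<times> X - E"
      using compl_sets[OF E(1)] by (intro AE_not_in null_setsI) (auto simp: inv2_sets[OF \<rho>(1)])
    with AE_space have "AE p in \<rho>. p \<in> E"
      by eventually_elim (auto simp: inv2_space[OF \<rho>(1)])
    then show ?thesis ..
  qed
qed

text \<open>The derivative is constant along forward orbits, so by ergodicity each of its level sets
  is null or conull. With \<open>c\<close> the ratio of the two masses of a rectangle, neither
  \<open>f > c\<close> nor \<open>f < c\<close> can hold almost everywhere, since the integrals over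
  that rectangle agree.\<close>

lemma ergodic_unique:
  assumes \<rho>: "inv2 \<rho>" "erg2 \<rho>" and \<sigma>: "inv2 \<sigma>"
    and ac: "absolutely_continuous \<rho> \<sigma>"
    and nz: "f0 \<in> F n0" "g0 \<in> F n0" "emeasure \<rho> (rect n0 f0 g0) \<noteq> 0"
  shows "\<exists>c. c \<noteq> \<infinity> \<and> \<sigma> = scale_measure c \<rho>"
proof -
  interpret sigma_finite_measure \<rho> by (rule inv2_sigma_finite[OF \<rho>(1)])
  note [measurable_cong] = inv2_sets[OF \<rho>(1)]
  obtain f where f: "f \<in> borel_measurable \<rho>" "density \<rho> f = \<sigma>"
    using Radon_Nikodym[OF ac] inv2_sets[OF \<rho>(1)] inv2_sets[OF \<sigma>] by auto
  have [measurable]: "f \<in> borel_measurable B2"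
    using f(1) by (simp add: measurable_cong_sets[OF inv2_sets[OF \<rho>(1)] refl])
  have AE: "AE p in \<rho>. \<forall>i::nat. f (act (int i) (- int i) p) = f p"
    using density_invariant[OF \<rho>(1), of f] f \<sigma> by simp
  have dich: "(AE p in \<rho>. P (f p)) \<or> (AE p in \<rho>. \<not> P (f p))" if P: "Measurable.pred borel P" for P
  proof -
    note [measurable] = P
    have "often (\<lambda>p. P (f p)) \<in> sets B2" by (rule often_sets) measurable
    from erg2_AE[OF \<rho> this often_invariant] show ?thesis
    proof
      assume "AE p in \<rho>. p \<in> often (\<lambda>p. P (f p))"
      with often_AE_iff[OF \<rho>(1) AE, of P] have "AE p in \<rho>. P (f p)" by eventually_elim simp
      then show ?thesis ..
    next
      assume "AE p in \<rho>. p \<notin> often (\<lambda>p. P (f p))"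
      with often_AE_iff[OF \<rho>(1) AE, of P] have "AE p in \<rho>. \<not> P (f p)" by eventually_elim simp
      then show ?thesis ..
    qed
  qed
  let ?W = "rect n0 f0 g0"
  have W[measurable]: "?W \<in> sets B2" by simp
  define c where "c = emeasure \<sigma> ?W / emeasure \<rho> ?W"
  have fin: "emeasure \<rho> ?W \<noteq> \<infinity>" "emeasure \<sigma> ?W \<noteq> \<infinity>"
    using inv2_fin \<rho>(1) \<sigma> nz by auto
  then have c: "c \<noteq> \<infinity>" using nz(3) by (simp add: c_def ennreal_divide_eq_top_iff)
  have cW: "c * emeasure \<rho> ?W = emeasure \<sigma> ?W"
    unfolding c_def using nz(3) fin by (simp add: ennreal_divide_times ennreal_times_divide mult_divide_eq_ennreal)
  have int: "(\<integral>\<^sup>+p. f p * indicator ?W p \<partial>\<rho>) = emeasure \<sigma> ?W"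
    unfolding f(2)[symmetric] by (rule emeasure_density[symmetric]) (auto simp: inv2_sets[OF \<rho>(1)])
  have intc: "(\<integral>\<^sup>+p. c * indicator ?W p \<partial>\<rho>) = emeasure \<sigma> ?W"
    by (subst nn_integral_cmult_indicator) (auto simp: cW inv2_sets[OF \<rho>(1)])
  have notall: False if "AE p in \<rho>. p \<notin> ?W"
  proof -
    have "emeasure \<rho> ?W = 0" using that by (subst (asm) AE_iff_null_sets[symmetric]) (auto simp: inv2_sets[OF \<rho>(1)])
    then show False using nz(3) by simp
  qed
  have "AE p in \<rho>. \<not> c < f p"
  proof (rule ccontr)
    assume "\<not> (AE p in \<rho>. \<not> c < f p)"
    then have gt: "AE p in \<rho>. c < f p" using dich[of "\<lambda>x. c < x"] by auto
    then have "AE p in \<rho>. c * indicator ?W p \<le> f p * indicator ?W p"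
      by eventually_elim (auto simp: indicator_def)
    then have "AE p in \<rho>. f p * indicator ?W p \<le> c * indicator ?W p"
      by (rule nn_integral_eq_imp_AE_eq[rotated 2]) (use int intc fin in auto)
    with gt have "AE p in \<rho>. p \<notin> ?W" by eventually_elim (auto simp: indicator_def)
    then show False by (rule notall)
  qed
  moreover have "AE p in \<rho>. \<not> f p < c"
  proof (rule ccontr)
    assume "\<not> (AE p in \<rho>. \<not> f p < c)"
    then have lt: "AE p in \<rho>. f p < c" using dich[of "\<lambda>x. x < c"] by auto
    then have "AE p in \<rho>. f p * indicator ?W p \<le> c * indicator ?W p"
      by eventually_elim (auto simp: indicator_def)
    then have "AE p in \<rho>. c * indicator ?W p \<le> f p * indicator ?W p"
      by (rule nn_integral_eq_imp_AE_eq[rotated 2]) (use int intc fin in auto)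
    with lt have "AE p in \<rho>. p \<notin> ?W" by eventually_elim (auto simp: indicator_def)
    then show False by (rule notall)
  qed
  ultimately have fc: "AE p in \<rho>. f p = c" by eventually_elim auto
  have "\<sigma> = density \<rho> (\<lambda>_. c)"
    unfolding f(2)[symmetric] using fc by (intro density_cong) auto
  also have "\<dots> = scale_measure c \<rho>"
    by (rule measure_eqI) (auto simp: emeasure_density_const)
  finally show ?thesis using c by blast
qed

lemma inv2_add: "inv2 \<rho> \<Longrightarrow> inv2 \<sigma> \<Longrightarrow> inv2 (add_measure \<rho> \<sigma>)"
  unfolding inv2_def by (auto simp: emeasure_add_measure)

text \<open>The set where the density of \<open>\<rho>\<close> over \<open>\<rho> + \<sigma>\<close>
  is positive carries \<open>\<rho>\<close>; \<open>often\<close> makes it strictly invariant, so it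
  is null or conull for \<open>\<sigma>\<close>. In the first case the measures are mutually
  singular, in the second \<open>\<sigma>\<close> is absolutely continuous and
  \<open>ergodic_unique\<close> applies.\<close>

lemma ergodic_dichotomy:
  assumes \<rho>: "inv2 \<rho>" "erg2 \<rho>" and \<sigma>: "inv2 \<sigma>" "erg2 \<sigma>"
    and nz: "f0 \<in> F n0" "g0 \<in> F n0" "emeasure \<rho> (rect n0 f0 g0) \<noteq> 0"
  shows "(\<exists>c. c \<noteq> \<infinity> \<and> \<sigma> = scale_measure c \<rho>) \<or>
    (\<exists>Z\<in>sets B2. emeasure \<rho> (X \<times> X - Z) = 0 \<and> emeasure \<sigma> Z = 0)"
proof -
  define m where "m = add_measure \<rho> \<sigma>"
  have m: "inv2 m" using inv2_add \<rho> \<sigma> by (simp add: m_def)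
  have em: "emeasure m E = emeasure \<rho> E + emeasure \<sigma> E" if "E \<in> sets B2" for E
    using that inv2_sets[OF \<rho>(1)] inv2_sets[OF \<sigma>(1)] by (simp add: m_def emeasure_add_measure)
  interpret m: sigma_finite_measure m by (rule inv2_sigma_finite[OF m])
  note [measurable_cong] = inv2_sets[OF m]
  have "absolutely_continuous m \<rho>"
    unfolding absolutely_continuous_def null_sets_def
    using em inv2_sets[OF m] inv2_sets[OF \<rho>(1)] by auto
  then obtain f where f: "f \<in> borel_measurable m" "density m f = \<rho>"
    using m.Radon_Nikodym inv2_sets[OF \<rho>(1)] inv2_sets[OF m] by metis
  have [measurable]: "f \<in> borel_measurable B2"
    using f(1) by (simp add: measurable_cong_sets[OF inv2_sets[OF m] refl])
  have AE: "AE p in m. \<forall>i::nat. f (act (int i) (- int i) p) = f p"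
    using density_invariant[OF m, of f] f \<rho> by simp
  define Z where "Z = often (\<lambda>p. 0 < f p)"
  have Z[measurable]: "Z \<in> sets B2" unfolding Z_def by (rule often_sets) measurable
  have iff: "AE p in m. p \<in> Z \<longleftrightarrow> 0 < f p"
    unfolding Z_def using often_AE_iff[OF m AE, of "\<lambda>x. 0 < x"] by simp
  have null_iff: "emeasure \<rho> E = 0 \<longleftrightarrow> (AE p in m. p \<in> E \<longrightarrow> f p = 0)" if "E \<in> sets B2" for E
    using null_sets_density_iff[of f m E] f that inv2_sets[OF m] by (auto simp: null_sets_def)
  have Zc: "emeasure \<rho> (X \<times> X - Z) = 0"
    unfolding null_iff[OF compl_sets[OF Z]] using iff by eventually_elim auto
  have "emeasure \<sigma> Z = 0 \<or> emeasure \<sigma> (X \<times> X - Z) = 0"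
    using \<sigma>(2) Z often_invariant unfolding erg2_def Z_def by blast
  then show ?thesis
  proof
    assume "emeasure \<sigma> Z = 0"
    then show ?thesis using Zc Z by blast
  next
    assume 0: "emeasure \<sigma> (X \<times> X - Z) = 0"
    have "absolutely_continuous \<rho> \<sigma>"
      unfolding absolutely_continuous_def
    proof
      fix E assume "E \<in> null_sets \<rho>"
      then have E: "E \<in> sets B2" "emeasure \<rho> E = 0" using inv2_sets[OF \<rho>(1)] by auto
      then have "AE p in m. p \<in> E \<longrightarrow> f p = 0" using null_iff by simp
      with iff have "AE p in m. p \<notin> E \<inter> Z" by eventually_elim auto
      then have "E \<inter> Z \<in> null_sets m"
        using E Z by (subst AE_iff_null_sets) (auto simp: inv2_sets[OF m])
      then have "emeasure \<sigma> (E \<inter> Z) = 0" using em[of "E \<inter> Z"] E Z by (auto simp: null_sets_def)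
      moreover have "emeasure \<sigma> E \<le> emeasure \<sigma> (E \<inter> Z) + emeasure \<sigma> (X \<times> X - Z)"
      proof -
        have "emeasure \<sigma> E \<le> emeasure \<sigma> ((E \<inter> Z) \<union> (X \<times> X - Z))"
          by (rule emeasure_mono) (use E B2_sub compl_sets[OF Z] in \<open>auto simp: inv2_sets[OF \<sigma>(1)]\<close>)
        also have "\<dots> \<le> emeasure \<sigma> (E \<inter> Z) + emeasure \<sigma> (X \<times> X - Z)"
          by (rule emeasure_subadditive) (use E compl_sets[OF Z] in \<open>auto simp: inv2_sets[OF \<sigma>(1)]\<close>)
        finally show ?thesis .
      qed
      ultimately have "emeasure \<sigma> E = 0" using 0 by simp
      then show "E \<in> null_sets \<sigma>" using E inv2_sets[OF \<sigma>(1)] by auto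
    qed
    then show ?thesis using ergodic_unique[OF \<rho> \<sigma>(1) _ nz] by blast
  qed
qed

section \<open>Images of an invariant measure under translations of the first coordinate\<close>

definition shifted where "shifted j \<rho> = distr \<rho> B2 (act j 0)"

lemma sets_shifted [simp]: "sets (shifted j \<rho>) = sets B2"
  by (simp add: shifted_def)

lemma emeasure_shifted:
  assumes "inv2 \<rho>" "E \<in> sets B2"
  shows "emeasure (shifted j \<rho>) E = emeasure \<rho> (pre j 0 E)"
  unfolding shifted_def using assms(2)
  by (subst emeasure_distr)
    (auto simp: measurable_cong_sets[OF inv2_sets[OF assms(1)] refl] inv2_space[OF assms(1)] pre_def)

text \<open>Modulo \<open>T 1 \<times> T (- 1)\<close> the translation by \<open>(i, j)\<close> acts
  as the one by \<open>(i + j, 0)\<close>, so only the total displacement matters.\<close>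

lemma emeasure_pre:
  assumes "inv2 \<rho>" "E \<in> sets B2"
  shows "emeasure \<rho> (pre i j E) = emeasure (shifted (i + j) \<rho>) E"
proof -
  have "pre i j E = pre (- j) (- (- j)) (pre (i + j) 0 E)" by (simp add: pre_pre)
  then show ?thesis using inv2_pre[OF assms(1), of "pre (i + j) 0 E" "- j"] assms
    by (simp add: emeasure_shifted)
qed

lemma inv2_XX2: "inv2 \<rho> \<Longrightarrow> emeasure \<rho> (XX n \<times> XX n) \<noteq> \<infinity>"
proof -
  assume \<rho>: "inv2 \<rho>"
  have "radon_measure_on topo2 \<rho>"
    unfolding C2.radon_measure_on_iff
    using inv2_fin[OF \<rho>] by (auto simp: inv2_sets[OF \<rho>] sets_topo2 coord2_image C2_cell_rect)
  moreover have "compactin topo2 (XX2 n)"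
    by (rule C2.lvl_compact[of n]) (auto simp: C2.lvl_def C2.cell_def)
  ultimately show ?thesis unfolding radon_measure_on_def XX2_def by (auto simp: less_top)
qed

lemma inv2_shifted:
  assumes \<rho>: "inv2 \<rho>"
  shows "inv2 (shifted j \<rho>)"
proof (rule inv2I)
  show "emeasure (shifted j \<rho>) (rect n f g) \<noteq> \<infinity>" for n f g
  proof -
    \<comment> \<open>Large enough for translation by \<open>- j\<close> to send \<open>XX n\<close>
      into \<open>XX (Suc k)\<close>, whose square is compact and hence of finite mass.\<close>
    define k where "k = max n (nat \<bar>j\<bar>)"
    have nk: "XX n \<subseteq> XX (Suc k)" by (rule XX_mono) (simp add: k_def)
    have "pre j 0 (rect n f g) \<subseteq> XX (Suc k) \<times> XX (Suc k)"
    proof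
      fix p assume "p \<in> pre j 0 (rect n f g)"
      then have p: "fst p \<in> X" "snd p \<in> X" "T j (fst p) \<in> XX n" "T 0 (snd p) \<in> XX n"
        by (auto simp: pre_def rect_def act_def cyl_eq)
      have "T (- j) (T j (fst p)) \<in> XX (Suc k)"
      proof (rule T_coord(1))
        show "T j (fst p) \<in> XX (Suc k)" using p(3) nk by blast
        show "- j + coord (Suc k) (T j (fst p)) \<in> F (Suc k)"
          by (rule shift_in_F[OF p(3)]) (auto simp: k_def)
      qed
      moreover have "snd p \<in> XX (Suc k)" using p(2,4) nk by (auto simp: T_zero)
      ultimately show "p \<in> XX (Suc k) \<times> XX (Suc k)" using p(1) by (simp add: T_inverse mem_Times_iff)
    qed
    then have "emeasure \<rho> (pre j 0 (rect n f g)) \<le> emeasure \<rho> (XX (Suc k) \<times> XX (Suc k))"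
      by (rule emeasure_mono) (auto simp: inv2_sets[OF \<rho>])
    then show ?thesis using inv2_XX2[OF \<rho>, of "Suc k"] by (auto simp: emeasure_shifted[OF \<rho>] top_unique)
  qed
  show "emeasure (shifted j \<rho>) (pre 1 (- 1) E) = emeasure (shifted j \<rho>) E" if "E \<in> sets B2" for E
  proof -
    have "pre j 0 (pre 1 (- 1) E) = pre 1 (- 1) (pre j 0 E)" by (simp add: pre_pre add.commute)
    then show ?thesis using that inv2_pre[OF \<rho>, of "pre j 0 E" 1] by (simp add: emeasure_shifted[OF \<rho>])
  qed
qed simp

lemma erg2_shifted:
  assumes \<rho>: "inv2 \<rho>" "erg2 \<rho>"
  shows "erg2 (shifted j \<rho>)"
  unfolding erg2_def
proof (intro ballI impI)
  fix E assume E: "E \<in> sets B2" "pre 1 (- 1) E = E"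
  have "pre 1 (- 1) (pre j 0 E) = pre j 0 (pre 1 (- 1) E)" by (simp add: pre_pre add.commute)
  then have "emeasure \<rho> (pre j 0 E) = 0 \<or> emeasure \<rho> (X \<times> X - pre j 0 E) = 0"
    using \<rho>(2) E pre_sets[of E j 0] unfolding erg2_def by simp
  then show "emeasure (shifted j \<rho>) E = 0 \<or> emeasure (shifted j \<rho>) (X \<times> X - E) = 0"
    using E compl_sets[OF E(1)] by (simp add: emeasure_shifted[OF \<rho>(1)] pre_compl)
qed

section \<open>Joinings\<close>

abbreviation "S \<equiv> inv_into X (T 1)"

lemma map_prod_T: "p \<in> X \<times> X \<Longrightarrow> map_prod (T 1) S p = act 1 (- 1) p"
  by (cases p) (simp add: act_def inv_T)

text \<open>Equivalence of the possibly non sigma-finite projections concerns null sets only, so it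
  can be tested on the strips \<open>N \<times> X\<close> and \<open>X \<times> N\<close>.\<close>

lemma joining_iff:
  "radon_joining topo \<mu> (T 1) topo \<mu> S \<rho> \<longleftrightarrow> inv2 \<rho> \<and> erg2 \<rho> \<and>
     (\<forall>N\<in>sets B1. emeasure \<rho> (N \<times> X) = 0 \<longleftrightarrow> emeasure \<mu> N = 0) \<and>
     (\<forall>N\<in>sets B1. emeasure \<rho> (X \<times> N) = 0 \<longleftrightarrow> emeasure \<mu> N = 0)"
proof (cases "sets \<rho> = sets B2")
  case False
  then have "\<not> inv2 \<rho>" "\<not> radon_measure_on topo2 \<rho>"
    by (simp_all add: inv2_def radon_measure_on_def sets_topo2)
  then show ?thesis unfolding radon_joining_def by blast
next
  case True
  note [measurable_cong] = True
  have sp: "space \<rho> = X \<times> X" using sets_eq_imp_space_eq[OF True] space_B2 by simp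
  have radon: "radon_measure_on topo2 \<rho> \<longleftrightarrow>
      (\<forall>n. \<forall>f\<in>F n. \<forall>g\<in>F n. emeasure \<rho> (rect n f g) \<noteq> \<infinity>)"
    unfolding C2.radon_measure_on_iff by (auto simp: True sets_topo2 coord2_image C2_cell_rect)
  have vi: "map_prod (T 1) S -` E \<inter> X \<times> X = pre 1 (- 1) E" for E
  proof (rule set_eqI)
    fix p
    show "p \<in> map_prod (T 1) S -` E \<inter> X \<times> X \<longleftrightarrow> p \<in> pre 1 (- 1) E"
    proof (cases "p \<in> X \<times> X")
      case True
      then show ?thesis unfolding pre_def Int_iff vimage_eq map_prod_T[OF True] by blast
    qed (simp add: pre_def)
  qed
  have meas: "map_prod (T 1) S \<in> measurable \<rho> \<rho>"
  proof -
    have "act 1 (- 1) \<in> measurable \<rho> \<rho>"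
      unfolding measurable_cong_sets[OF True True] by (rule act_measurable)
    moreover have "map_prod (T 1) S p = act 1 (- 1) p" if "p \<in> space \<rho>" for p
      using that unfolding sp by (rule map_prod_T)
    ultimately show ?thesis by (subst measurable_cong)
  qed
  have em: "emeasure (distr \<rho> \<rho> (map_prod (T 1) S)) E = emeasure \<rho> (pre 1 (- 1) E)" if "E \<in> sets B2" for E
    unfolding vi[symmetric] sp[symmetric]
    by (rule emeasure_distr[OF meas]) (use that True in simp)
  have mp: "measure_preserving_map \<rho> (map_prod (T 1) S) \<longleftrightarrow>
      (\<forall>E\<in>sets B2. emeasure \<rho> (pre 1 (- 1) E) = emeasure \<rho> E)"
  proof
    assume "measure_preserving_map \<rho> (map_prod (T 1) S)"
    then have "distr \<rho> \<rho> (map_prod (T 1) S) = \<rho>" unfolding measure_preserving_map_def by (rule conjunct2)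
    with em show "\<forall>E\<in>sets B2. emeasure \<rho> (pre 1 (- 1) E) = emeasure \<rho> E" by metis
  next
    assume a: "\<forall>E\<in>sets B2. emeasure \<rho> (pre 1 (- 1) E) = emeasure \<rho> E"
    have "distr \<rho> \<rho> (map_prod (T 1) S) = \<rho>"
    proof (rule measure_eqI)
      fix E assume "E \<in> sets (distr \<rho> \<rho> (map_prod (T 1) S))"
      then have E: "E \<in> sets B2" using True by simp
      show "emeasure (distr \<rho> \<rho> (map_prod (T 1) S)) E = emeasure \<rho> E"
        unfolding em[OF E] by (rule bspec[OF a E])
    qed (rule sets_distr)
    with meas show "measure_preserving_map \<rho> (map_prod (T 1) S)"
      unfolding measure_preserving_map_def by (rule conjI)
  qed
  have inv: "radon_measure_on topo2 \<rho> \<and> measure_preserving_map \<rho> (map_prod (T 1) S) \<longleftrightarrow> inv2 \<rho>"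
  proof
    assume a: "radon_measure_on topo2 \<rho> \<and> measure_preserving_map \<rho> (map_prod (T 1) S)"
    show "inv2 \<rho>"
    proof (rule inv2I[OF True])
      show "emeasure \<rho> (rect n f g) \<noteq> \<infinity>" if "f \<in> F n" "g \<in> F n" for n f g
        using conjunct1[OF a, unfolded radon] that by blast
      show "emeasure \<rho> (pre 1 (- 1) E) = emeasure \<rho> E" if "E \<in> sets B2" for E
        by (rule bspec[OF conjunct2[OF a, unfolded mp] that])
    qed
  next
    assume a: "inv2 \<rho>"
    show "radon_measure_on topo2 \<rho> \<and> measure_preserving_map \<rho> (map_prod (T 1) S)"
      unfolding radon mp
    proof (intro conjI allI ballI)
      show "emeasure \<rho> (rect n f g) \<noteq> \<infinity>" if "f \<in> F n" "g \<in> F n" for n f g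
        by (rule inv2_fin[OF a that])
      show "emeasure \<rho> (pre 1 (- 1) E) = emeasure \<rho> E" if "E \<in> sets B2" for E
        by (rule inv2_pre[OF a that])
    qed
  qed
  have erg: "ergodic_map \<rho> (map_prod (T 1) S) \<longleftrightarrow> erg2 \<rho>"
    unfolding ergodic_map_def erg2_def sp vi by (simp add: True)
  have fstsnd: "fst \<in> measurable \<rho> \<mu>" "snd \<in> measurable \<rho> \<mu>"
    unfolding measurable_cong_sets[OF True sets_mu] by (rule measurable_fst measurable_snd)+
  have "fst -` N \<inter> X \<times> X = N \<times> X" "snd -` N \<inter> X \<times> X = X \<times> N" if "N \<in> sets B1" for N
    using sets.sets_into_space[OF that] by auto
  then have dist: "emeasure (distr \<rho> \<mu> fst) N = emeasure \<rho> (N \<times> X)"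
      "emeasure (distr \<rho> \<mu> snd) N = emeasure \<rho> (X \<times> N)" if "N \<in> sets B1" for N
    using that fstsnd by (simp_all add: emeasure_distr sets_mu sp)
  have "null_sets (distr \<rho> \<mu> fst) = null_sets \<mu> \<longleftrightarrow>
      (\<forall>N\<in>sets B1. emeasure \<rho> (N \<times> X) = 0 \<longleftrightarrow> emeasure \<mu> N = 0)"
    unfolding null_sets_def set_eq_iff mem_Collect_eq sets_distr sets_mu using dist(1) by (metis (no_types))
  moreover have "null_sets (distr \<rho> \<mu> snd) = null_sets \<mu> \<longleftrightarrow>
      (\<forall>N\<in>sets B1. emeasure \<rho> (X \<times> N) = 0 \<longleftrightarrow> emeasure \<mu> N = 0)"
    unfolding null_sets_def set_eq_iff mem_Collect_eq sets_distr sets_mu using dist(2) by (metis (no_types))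
  ultimately show ?thesis
    unfolding radon_joining_def erg inv[symmetric] by (simp only: conj_assoc)
qed

text \<open>The entry with index \<open>k + 1\<close>, an element of \<open>C (Suc k)\<close>; the
  shift matches the indices of \<open>lo k\<close>, \<open>hi k\<close> and
  \<open>\<omega> k\<close>.\<close>

definition digit where "digit k x = coord (Suc k) x - coord k x"

lemma digit_measurable [measurable]: "digit k \<in> measurable B1 (count_space UNIV)"
  unfolding digit_def[abs_def] by measurable

lemma digit_in_C: "x \<in> XX n \<Longrightarrow> n \<le> k \<Longrightarrow> digit k x \<in> C (Suc k)"
  unfolding digit_def by (rule coord_step)

lemma switch:
  assumes "x \<in> XX n" "n \<le> k" "digit k x = e" "c \<in> C (Suc k)"
  shows "T (c - e) x \<in> XX n" "digit k (T (c - e) x) = c" "coord n (T (c - e) x) = coord n x"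
    "n \<le> j \<Longrightarrow> j < k \<Longrightarrow> digit j (T (c - e) x) = digit j x"
proof -
  have x: "x \<in> XX k" using assms XX_mono by blast
  note sw = T_switch[OF x assms(3)[unfolded digit_def] assms(4) refl]
  show "T (c - e) x \<in> XX n" using sw(4)[OF assms(2)] assms(1) by simp
  show "digit k (T (c - e) x) = c" using sw(2,3) by (simp add: digit_def)
  show "coord n (T (c - e) x) = coord n x" using sw(5)[OF assms(1), of n] assms(2) by simp
  show "n \<le> j \<Longrightarrow> j < k \<Longrightarrow> digit j (T (c - e) x) = digit j x"
    using sw(5)[OF assms(1), of j] sw(5)[OF assms(1), of "Suc j"] by (simp add: digit_def)
qed

lemma mu_XX: "emeasure \<mu> (XX n) = ennreal (of_int (h n) / 3 ^ n)"
proof -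
  have "emeasure \<mu> (\<Union>f\<in>F n. cyl n f) = (\<Sum>f\<in>F n. emeasure \<mu> (cyl n f))"
    by (rule sum_emeasure[symmetric])
      (use cyl_disjoint in \<open>auto simp: sets_mu finite_chacon_F disjoint_family_on_def\<close>)
  also have "\<dots> = of_nat (card (F n)) * ennreal (1 / 3 ^ n)" by (simp add: mu_cyl)
  also have "card (F n) = nat (h n)"
    using odd_chacon_h[of n] unfolding chacon_F_def by (auto elim!: oddE)
  also have "of_nat (nat (h n)) * ennreal (1 / 3 ^ n) = ennreal (of_int (h n) / 3 ^ n)"
    using chacon_h_pos[of n]
    by (simp add: ennreal_of_nat_eq_real_of_nat ennreal_mult[symmetric])
  finally show ?thesis unfolding XX_cyl .
qed

text \<open>Switching translations carry the sets with the three possible digits at a level onto one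
  another, so these have equal measure. Forbidding one value leaves 2/3 of the measure at each
  level, starting from the finite measure of \<open>XX n\<close>.\<close>

lemma avoiding_null:
  assumes i: "\<And>k. i k \<in> C (Suc k)"
  shows "{x \<in> XX n. \<forall>k\<ge>n. digit k x \<noteq> i k} \<in> null_sets \<mu>"
proof -
  define N where "N m = {x \<in> XX n. \<forall>k\<in>{n..<m}. digit k x \<noteq> i k}" for m
  have XXs: "XX n \<in> sets \<mu>" by (simp add: sets_mu)
  have N_eq: "N m = {x \<in> space B1. x \<in> XX n \<and> (\<forall>k\<in>{n..<m}. digit k x \<noteq> i k)}" for m
    using XX_sub_X by (auto simp: N_def)
  have N[measurable]: "N m \<in> sets B1" for m unfolding N_eq by measurable
  have half: "3 * emeasure \<mu> (N (Suc m)) = 2 * emeasure \<mu> (N m)" if m: "n \<le> m" for m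
  proof -
    define A where "A c = {x \<in> N m. digit m x = c}" for c
    have A_eq: "A c = {x \<in> space B1. x \<in> N m \<and> digit m x = c}" for c
      using XX_sub_X by (auto simp: A_def N_def)
    have A[measurable]: "A c \<in> sets B1" for c unfolding A_eq by measurable
    have move: "T (c - e) x \<in> A c" if "x \<in> A e" "c \<in> C (Suc m)" for c e x
      using switch[of x n m e c] that m by (auto simp: A_def N_def)
    have eq: "emeasure \<mu> (A c) = emeasure \<mu> (A 0)" if c: "c \<in> C (Suc m)" for c
    proof -
      have "A 0 = T c -` A c \<inter> X"
      proof (intro set_eqI iffI)
        fix x assume "x \<in> A 0"
        then show "x \<in> T c -` A c \<inter> X" using move[of x 0 c] c XX_sub_X by (auto simp: A_def N_def)
      next
        fix x assume x: "x \<in> T c -` A c \<inter> X"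
        then have "T (0 - c) (T c x) \<in> A 0" using move[of "T c x" c 0] by (auto simp: C_Suc)
        then show "x \<in> A 0" using x by (simp add: T_inverse)
      qed
      then show ?thesis using emeasure_T[of "A c" c] by (simp add: sets_mu)
    qed
    have disj: "disjoint_family_on A K" for K by (auto simp: disjoint_family_on_def A_def)
    have "N m = (\<Union>c\<in>C (Suc m). A c)"
      using digit_in_C[of _ n m] m by (auto simp: A_def N_def)
    then have "emeasure \<mu> (N m) = (\<Sum>c\<in>C (Suc m). emeasure \<mu> (A c))"
      using sum_emeasure[of A "C (Suc m)" \<mu>] disj by (simp add: sets_mu C_Suc image_subset_iff)
    also have "\<dots> = (\<Sum>c\<in>C (Suc m). emeasure \<mu> (A 0))"
      by (rule sum.cong[OF refl]) (rule eq)
    finally have 3: "emeasure \<mu> (N m) = 3 * emeasure \<mu> (A 0)"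
      by (simp add: C_Suc)
    have "N (Suc m) = (\<Union>c\<in>C (Suc m) - {i m}. A c)"
      using digit_in_C[of _ n m] m by (auto simp: A_def N_def less_Suc_eq)
    then have "emeasure \<mu> (N (Suc m)) = (\<Sum>c\<in>C (Suc m) - {i m}. emeasure \<mu> (A c))"
      using sum_emeasure[of A "C (Suc m) - {i m}" \<mu>] disj
      by (simp add: sets_mu C_Suc image_subset_iff)
    also have "\<dots> = (\<Sum>c\<in>C (Suc m) - {i m}. emeasure \<mu> (A 0))"
      by (rule sum.cong[OF refl], rule eq) auto
    also have "\<dots> = 2 * emeasure \<mu> (A 0)"
      using i[of m] by (simp add: C_Suc)
    finally show ?thesis using 3 by (simp add: mult.assoc[symmetric])
  qed
  have N_meas: "emeasure \<mu> (N (n + j)) \<le> ennreal ((2 / 3) ^ j * (of_int (h n) / 3 ^ n))" for j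
  proof (induction j)
    case 0
    then show ?case using mu_XX[of n] by (simp add: N_def)
  next
    case (Suc j)
    have "3 * emeasure \<mu> (N (n + Suc j)) \<le> 2 * ennreal ((2 / 3) ^ j * (of_int (h n) / 3 ^ n))"
      using half[of "n + j"] Suc by (simp add: mult_left_mono)
    also have "\<dots> = ennreal (2 * ((2 / 3) ^ j * (of_int (h n) / 3 ^ n)))"
      using chacon_h_pos[of n] by (subst ennreal_mult) auto
    also have "\<dots> = ennreal (3 * ((2 / 3) ^ Suc j * (of_int (h n) / 3 ^ n)))"
      by (simp add: mult_ac)
    also have "\<dots> = 3 * ennreal ((2 / 3) ^ Suc j * (of_int (h n) / 3 ^ n))"
      using chacon_h_pos[of n] by (subst ennreal_mult) auto
    finally show ?case by (simp add: ennreal_mult_le_mult_iff)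
  qed
  let ?N = "{x \<in> XX n. \<forall>k\<ge>n. digit k x \<noteq> i k}"
  have le: "emeasure \<mu> ?N \<le> ennreal ((2 / 3) ^ j * (of_int (h n) / 3 ^ n))" for j
    using emeasure_mono[of ?N "N (n + j)" \<mu>] N_meas[of j] by (force simp: N_def[of "n + j"] sets_mu)
  have "(\<lambda>j. ennreal ((2 / 3) ^ j * (of_int (h n) / 3 ^ n))) \<longlonglongrightarrow> ennreal 0"
    by (intro tendsto_ennrealI tendsto_mult_left_zero LIMSEQ_realpow_zero) auto
  then have "emeasure \<mu> ?N \<le> ennreal 0"
    by (rule LIMSEQ_le_const) (use le in auto)
  moreover have "?N \<in> sets \<mu>"
  proof -
    have "?N = {x \<in> space B1. x \<in> XX n \<and> (\<forall>k\<in>{n..}. digit k x \<noteq> i k)}" using XX_sub_X by auto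
    also have "\<dots> \<in> sets B1" by measurable
    finally show ?thesis unfolding sets_mu .
  qed
  ultimately show ?thesis by (intro null_setsI) auto
qed

text \<open>\<open>cancels k p\<close> says that the level \<open>k + 1\<close> digits of the two coordinates add up to \<open>0\<close> up to
  the spacer. Switching between the three configurations changes the sum of the coordinates by
  \<open>\<plusminus>1\<close>, so that it relates \<open>\<rho>\<close> to its images under \<open>T \<times> id\<close> and its inverse.\<close>

definition cancels where
  "cancels k p \<longleftrightarrow> (digit k (fst p), digit k (snd p)) \<in> {(0, 0), (lo k, hi k), (hi k, lo k)}"

lemma cancels_measurable [measurable]: "Measurable.pred B2 (cancels k)"
  unfolding cancels_def[abs_def] by measurable

definition cancel_io where
  "cancel_io = {p \<in> X \<times> X. \<exists>\<^sub>\<infinity>k. cancels k p}"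

lemma cancel_io_sets [measurable]: "cancel_io \<in> sets B2"
proof -
  have "cancel_io = {p \<in> space B2. \<forall>m. \<exists>k>m. cancels k p}"
    by (simp add: cancel_io_def space_B2 INFM_nat)
  also have "\<dots> \<in> sets B2" by measurable
  finally show ?thesis .
qed

lemma act_coord_large:
  assumes "p \<in> X \<times> X"
  obtains n where "\<And>m. n \<le> m \<Longrightarrow> coord m (fst (act i j p)) = i + coord m (fst p) \<and>
    coord m (snd (act i j p)) = j + coord m (snd p)"
proof -
  have p: "fst p \<in> X" "snd p \<in> X" using assms by auto
  obtain a where a: "\<And>m. a \<le> m \<Longrightarrow> coord m (T i (fst p)) = i + coord m (fst p)"
    using T_large[OF p(1), of i] by metis
  obtain b where b: "\<And>m. b \<le> m \<Longrightarrow> coord m (T j (snd p)) = j + coord m (snd p)"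
    using T_large[OF p(2), of j] by metis
  show ?thesis
    by (rule that[of "max a b"]) (use a b in \<open>simp add: act_def\<close>)
qed

text \<open>A translation changes all high-level coordinates by a constant and hence no high-level
  digit, and the event depends only on the tail of the digits.\<close>

lemma cancel_io_invariant: "pre 1 (- 1) cancel_io = cancel_io"
proof (rule set_eqI)
  fix p
  show "p \<in> pre 1 (- 1) cancel_io \<longleftrightarrow> p \<in> cancel_io"
  proof (cases "p \<in> X \<times> X")
    case True
    obtain n where n: "\<And>m. n \<le> m \<Longrightarrow> coord m (fst (act 1 (- 1) p)) = 1 + coord m (fst p) \<and>
        coord m (snd (act 1 (- 1) p)) = - 1 + coord m (snd p)"
      using act_coord_large[OF True, of 1 "- 1"] by blast
    have c: "cancels k (act 1 (- 1) p) \<longleftrightarrow> cancels k p" if "n \<le> k" for k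
      using n[of k] n[of "Suc k"] that by (simp add: cancels_def digit_def)
    have "(\<exists>\<^sub>\<infinity>k. cancels k (act 1 (- 1) p)) \<longleftrightarrow> (\<exists>\<^sub>\<infinity>k. cancels k p)"
      unfolding INFM_nat
    proof (intro iffI allI)
      fix m assume "\<forall>m. \<exists>k>m. cancels k (act 1 (- 1) p)"
      then obtain k where "k > max m n" "cancels k (act 1 (- 1) p)" by blast
      then show "\<exists>k>m. cancels k p" using c[of k] by auto
    next
      fix m assume "\<forall>m. \<exists>k>m. cancels k p"
      then obtain k where "k > max m n" "cancels k p" by blast
      then show "\<exists>k>m. cancels k (act 1 (- 1) p)" using c[of k] by auto
    qed
    then show ?thesis using True act_in[OF True, of 1 "- 1"]
      unfolding cancel_io_def pre_def by (simp only: mem_Collect_eq vimage_eq Int_iff simp_thms)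
  qed (simp add: cancel_io_def pre_def)
qed

definition first_cancel where
  "first_cancel n f g k = {p \<in> rect n f g. (\<forall>j\<in>{n..<k}. \<not> cancels j p) \<and> cancels k p}"

lemma first_cancel_sets [measurable]: "first_cancel n f g k \<in> sets B2"
proof -
  have "first_cancel n f g k =
      {p \<in> space B2. p \<in> rect n f g \<and> (\<forall>j\<in>{n..<k}. \<not> cancels j p) \<and> cancels k p}"
    using B2_sub[OF rect_measurable[of n f g]] by (auto simp: first_cancel_def space_B2)
  also have "\<dots> \<in> sets B2" by measurable
  finally show ?thesis .
qed

abbreviation "nearby \<rho> \<equiv> add_measure (shifted 1 \<rho>) (shifted (- 1) \<rho>)"

lemma emeasure_nearby:
  "E \<in> sets B2 \<Longrightarrow> emeasure (nearby \<rho>) E = emeasure (shifted 1 \<rho>) E + emeasure (shifted (- 1) \<rho>) E"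
  by (simp add: emeasure_add_measure)

text \<open>The three cancelling digit pairs at level \<open>k\<close> split the set into pieces
  that are translates of one another, since switching at \<open>k\<close> leaves the earlier digits
  alone. The total displacement between the piece of (0, 0) and either of the others is
  \<plusminus>1, so each piece is bounded by the \<open>nearby\<close> mass of the whole set; three
  pieces give the factor 3.\<close>

lemma first_cancel_le:
  assumes \<rho>: "inv2 \<rho>" and k: "n \<le> k"
  shows "emeasure \<rho> (first_cancel n f g k) \<le> 3 * emeasure (nearby \<rho>) (first_cancel n f g k)"
proof -
  define P where "P c c' = {p \<in> rect n f g. (\<forall>j\<in>{n..<k}. \<not> cancels j p) \<and>
    digit k (fst p) = c \<and> digit k (snd p) = c'}" for c c'
  have P_eq: "P c c' = {p \<in> space B2. p \<in> rect n f g \<and> (\<forall>j\<in>{n..<k}. \<not> cancels j p) \<and>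
      digit k (fst p) = c \<and> digit k (snd p) = c'}" for c c'
    using B2_sub[OF rect_measurable[of n f g]] by (auto simp: P_def space_B2)
  have P[measurable]: "P c c' \<in> sets B2" for c c' unfolding P_eq by measurable
  have move: "act (c - e) (c' - e') p \<in> P c c'"
    if p: "p \<in> P e e'" and c: "c \<in> C (Suc k)" "c' \<in> C (Suc k)" for c c' e e' p
  proof -
    have *: "fst p \<in> XX n" "snd p \<in> XX n" "digit k (fst p) = e" "digit k (snd p) = e'"
        "coord n (fst p) = f" "coord n (snd p) = g"
      using p by (auto simp: P_def rect_def cyl_eq)
    note s1 = switch[OF *(1) k *(3) c(1)] and s2 = switch[OF *(2) k *(4) c(2)]
    have "cancels j (act (c - e) (c' - e') p) \<longleftrightarrow> cancels j p" if "j \<in> {n..<k}" for j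
      using s1(4)[of j] s2(4)[of j] that by (simp add: cancels_def act_def)
    then show ?thesis
      using p s1(1-3) s2(1-3) * by (simp add: P_def rect_def cyl_eq act_def mem_Times_iff)
  qed
  have P_X: "P c c' \<subseteq> X \<times> X" for c c' by (rule B2_sub[OF P])
  have eq: "emeasure \<rho> (P e e') = emeasure (shifted (c + c' - e - e') \<rho>) (P c c')"
    if c: "c \<in> C (Suc k)" "c' \<in> C (Suc k)" "e \<in> C (Suc k)" "e' \<in> C (Suc k)" for c c' e e'
  proof -
    have "P e e' = pre (c - e) (c' - e') (P c c')"
    proof (intro set_eqI iffI)
      fix p assume p: "p \<in> P e e'"
      with move[OF p c(1,2)] P_X show "p \<in> pre (c - e) (c' - e') (P c c')" by (auto simp: pre_def)
    next
      fix p assume p: "p \<in> pre (c - e) (c' - e') (P c c')"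
      then have "act (e - c) (e' - c') (act (c - e) (c' - e') p) \<in> P e e'"
        using move[OF _ c(3,4)] by (simp add: pre_def)
      then show "p \<in> P e e'" using p by (simp add: act_act act_zero pre_def)
    qed
    then show ?thesis using emeasure_pre[OF \<rho> P[of c c'], of "c - e" "c' - e'"]
      by (simp add: algebra_simps)
  qed
  let ?K = "first_cancel n f g k" and ?m = "nearby \<rho>"
  have K: "?K = P 0 0 \<union> (P (lo k) (hi k) \<union> P (hi k) (lo k))"
    by (auto simp: first_cancel_def P_def cancels_def)
  have le: "emeasure \<rho> (P e e') \<le> emeasure ?m ?K"
    if "c \<in> C (Suc k)" "c' \<in> C (Suc k)" "e \<in> C (Suc k)" "e' \<in> C (Suc k)"
      "\<bar>c + c' - e - e'\<bar> = 1" "P c c' \<subseteq> ?K" for c c' e e'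
  proof -
    have "c + c' - e - e' = 1 \<or> c + c' - e - e' = - 1" using that(5) by linarith
    then have "emeasure \<rho> (P e e') \<le> emeasure ?m (P c c')"
      using eq[OF that(1-4)] by (auto simp: emeasure_nearby)
    also have "\<dots> \<le> emeasure ?m ?K" by (rule emeasure_mono) (use that in auto)
    finally show ?thesis .
  qed
  have one: "\<bar>lo k + hi k\<bar> = 1" using lo_hi_sum[of k] omega[of k] by auto
  have "emeasure \<rho> (P 0 0) \<le> emeasure ?m ?K"
    using one by (intro le[of "lo k" "hi k"]) (auto simp: C_Suc K)
  moreover have "emeasure \<rho> (P (lo k) (hi k)) \<le> emeasure ?m ?K"
    using one by (intro le[of 0 0]) (auto simp: C_Suc K)
  moreover have "emeasure \<rho> (P (hi k) (lo k)) \<le> emeasure ?m ?K"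
    using one by (intro le[of 0 0]) (auto simp: C_Suc K)
  ultimately have sum: "emeasure \<rho> (P 0 0) + (emeasure \<rho> (P (lo k) (hi k)) + emeasure \<rho> (P (hi k) (lo k)))
      \<le> emeasure ?m ?K + (emeasure ?m ?K + emeasure ?m ?K)"
    by (intro add_mono)
  have "emeasure \<rho> ?K \<le> emeasure \<rho> (P 0 0) + emeasure \<rho> (P (lo k) (hi k) \<union> P (hi k) (lo k))"
    unfolding K by (rule emeasure_subadditive) (auto simp: inv2_sets[OF \<rho>])
  also have "\<dots> \<le> emeasure \<rho> (P 0 0) + (emeasure \<rho> (P (lo k) (hi k)) + emeasure \<rho> (P (hi k) (lo k)))"
    by (intro add_mono order_refl emeasure_subadditive) (auto simp: inv2_sets[OF \<rho>])
  also note sum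
  also have "emeasure ?m ?K + (emeasure ?m ?K + emeasure ?m ?K) = 3 * emeasure ?m ?K"
  proof -
    have "(3 :: ennreal) = 1 + (1 + 1)" by simp
    then show ?thesis by (simp only: distrib_right mult_1)
  qed
  finally show ?thesis .
qed

text \<open>Almost every point of a rectangle has a first cancelling level at or beyond
  \<open>n\<close>, so summing \<open>first_cancel_le\<close> gives the bound on rectangles;
  \<open>C2.emeasure_le_cells\<close> extends it to Borel sets.\<close>

lemma le_nearby:
  assumes \<rho>: "inv2 \<rho>" and io: "AE p in \<rho>. p \<in> cancel_io" and E: "E \<in> sets B2"
  shows "emeasure \<rho> E \<le> 3 * emeasure (nearby \<rho>) E"
proof -
  let ?N = "scale_measure 3 (nearby \<rho>)"
  have m: "inv2 (nearby \<rho>)" by (intro inv2_add inv2_shifted \<rho>)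
  have le: "emeasure \<rho> (rect n f g) \<le> 3 * emeasure (nearby \<rho>) (rect n f g)" for n f g
  proof -
    let ?K = "\<lambda>i. first_cancel n f g (n + i)"
    have disj: "disjoint_family ?K"
    proof (unfold disjoint_family_on_def, intro ballI impI)
      fix i j :: nat assume "i \<noteq> j"
      then consider "i < j" | "j < i" by linarith
      then show "?K i \<inter> ?K j = {}" by cases (force simp: first_cancel_def)+
    qed
    have "AE p in \<rho>. p \<in> rect n f g \<longrightarrow> p \<in> (\<Union>i. ?K i)"
      using io
    proof eventually_elim
      case (elim p)
      show ?case
      proof
        assume W: "p \<in> rect n f g"
        have "\<exists>k>n. cancels k p" using elim by (auto simp: cancel_io_def INFM_nat)
        then obtain k0 where k0: "n \<le> k0 \<and> cancels k0 p" using less_imp_le by blast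
        define k where "k = (LEAST k. n \<le> k \<and> cancels k p)"
        have "n \<le> k \<and> cancels k p" unfolding k_def by (rule LeastI[of _ k0]) (rule k0)
        moreover have "\<not> cancels j p" if "n \<le> j" "j < k" for j
          using not_less_Least[of j "\<lambda>k. n \<le> k \<and> cancels k p"] that by (auto simp: k_def)
        ultimately have "p \<in> ?K (k - n)" using W by (auto simp: first_cancel_def)
        then show "p \<in> (\<Union>i. ?K i)" by blast
      qed
    qed
    then have "emeasure \<rho> (rect n f g) \<le> emeasure \<rho> (\<Union>i. ?K i)"
      by (intro emeasure_mono_AE) (auto simp: inv2_sets[OF \<rho>])
    also have "\<dots> = (\<Sum>i. emeasure \<rho> (?K i))"
      by (rule suminf_emeasure[symmetric]) (use disj in \<open>auto simp: inv2_sets[OF \<rho>]\<close>)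
    also have "\<dots> \<le> (\<Sum>i. 3 * emeasure (nearby \<rho>) (?K i))"
      by (intro suminf_le first_cancel_le[OF \<rho>]) auto
    also have "\<dots> = 3 * (\<Sum>i. emeasure (nearby \<rho>) (?K i))" by (rule ennreal_suminf_cmult)
    also have "(\<Sum>i. emeasure (nearby \<rho>) (?K i)) = emeasure (nearby \<rho>) (\<Union>i. ?K i)"
      by (rule suminf_emeasure) (use disj in auto)
    also have "3 * emeasure (nearby \<rho>) (\<Union>i. ?K i) \<le> 3 * emeasure (nearby \<rho>) (rect n f g)"
      by (intro mult_left_mono emeasure_mono) (auto simp: first_cancel_def)
    finally show ?thesis .
  qed
  have "emeasure \<rho> E \<le> emeasure ?N E"
  proof (rule C2.emeasure_le_cells)
    fix n v assume "v \<in> coord2 n ` XX2 n"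
    then obtain f g where v: "v = (f, g)" "f \<in> F n" "g \<in> F n" unfolding coord2_image by auto
    show "emeasure \<rho> (C2.cell n v) \<le> emeasure ?N (C2.cell n v)"
      using le by (simp add: v C2_cell_rect)
    show "emeasure ?N (C2.cell n v) \<noteq> \<infinity>"
      using inv2_fin[OF m v(2,3)] by (simp add: v C2_cell_rect ennreal_mult_eq_top_iff)
  qed (use E in \<open>auto simp: inv2_sets[OF \<rho>] sets_topo2\<close>)
  then show ?thesis by simp
qed

text \<open>By \<open>ergodic_dichotomy\<close> it remains to exclude that \<open>\<rho>\<close> and
  \<open>shifted 1 \<rho>\<close> are mutually singular.\<close>

lemma shifted_proportional:
  assumes \<rho>: "inv2 \<rho>" "erg2 \<rho>" and io: "AE p in \<rho>. p \<in> cancel_io"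
    and nz: "emeasure \<rho> (X \<times> X) \<noteq> 0" "f0 \<in> F n0" "g0 \<in> F n0" "emeasure \<rho> (rect n0 f0 g0) \<noteq> 0"
  obtains c where "0 < c" "shifted 1 \<rho> = scale_measure (ennreal c) \<rho>"
proof -
  have XX: "X \<times> X \<in> sets B2" using sets.top[of B2] by (simp add: space_B2)
  have preXX: "pre i j (X \<times> X) = X \<times> X" for i j using act_in unfolding pre_def by blast
  have "\<not> (\<exists>Z\<in>sets B2. emeasure \<rho> (X \<times> X - Z) = 0 \<and> emeasure (shifted 1 \<rho>) Z = 0)"
  proof
    assume "\<exists>Z\<in>sets B2. emeasure \<rho> (X \<times> X - Z) = 0 \<and> emeasure (shifted 1 \<rho>) Z = 0"
    then obtain Z where Z[measurable]: "Z \<in> sets B2" and Z0: "emeasure \<rho> (X \<times> X - Z) = 0"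
        "emeasure (shifted 1 \<rho>) Z = 0" by blast
    \<comment> \<open>\<open>Z\<close> carries \<open>\<rho>\<close> and is null for
      \<open>shifted 1 \<rho>\<close>; \<open>Z'\<close> plays the same role for
      \<open>shifted (- 1) \<rho>\<close>. So the intersection has \<open>nearby\<close> mass 0
      although it carries \<open>\<rho>\<close>, against \<open>le_nearby\<close>.\<close>
    define Z' where "Z' = X \<times> X - pre 1 0 Z"
    have Z'[measurable]: "Z' \<in> sets B2" unfolding Z'_def by (intro compl_sets pre_sets Z)
    have "pre (- 1) 0 Z' = X \<times> X - Z"
      unfolding Z'_def pre_compl pre_pre using pre_zero[OF B2_sub[OF Z]] by simp
    then have "emeasure (shifted (- 1) \<rho>) Z' = 0" using Z0 by (simp add: emeasure_shifted[OF \<rho>(1)])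
    moreover have "emeasure (shifted 1 \<rho>) (Z \<inter> Z') \<le> emeasure (shifted 1 \<rho>) Z"
        "emeasure (shifted (- 1) \<rho>) (Z \<inter> Z') \<le> emeasure (shifted (- 1) \<rho>) Z'"
      by (intro emeasure_mono; simp)+
    ultimately have "emeasure (nearby \<rho>) (Z \<inter> Z') = 0"
      using Z0 by (simp add: emeasure_nearby)
    then have 0: "emeasure \<rho> (Z \<inter> Z') = 0" using le_nearby[OF \<rho>(1) io, of "Z \<inter> Z'"] by simp
    have 1: "emeasure \<rho> (pre 1 0 Z) = 0" using Z0 by (simp add: emeasure_shifted[OF \<rho>(1)])
    have "Z \<inter> Z' \<union> (X \<times> X - Z) \<union> pre 1 0 Z \<in> null_sets \<rho>"
      using 0 1 Z0 compl_sets[OF Z] by (intro null_sets.Un null_setsI) (auto simp: inv2_sets[OF \<rho>(1)])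
    moreover have "Z \<inter> Z' \<union> (X \<times> X - Z) \<union> pre 1 0 Z = X \<times> X"
      using B2_sub[OF Z] by (auto simp: Z'_def pre_def)
    ultimately show False using nz(1) by (auto simp: null_sets_def)
  qed
  then obtain c where c: "c \<noteq> \<infinity>" "shifted 1 \<rho> = scale_measure c \<rho>"
    using ergodic_dichotomy[OF \<rho> inv2_shifted[OF \<rho>(1)] erg2_shifted[OF \<rho>] nz(2-4)] by blast
  \<comment> \<open>The total masses may be infinite, so their equality yields only a nonzero
    factor. That it is 1 is the content of \<open>shifted_scale_eq_1\<close>.\<close>
  have "emeasure (shifted 1 \<rho>) (X \<times> X) = emeasure \<rho> (X \<times> X)"
    using XX by (simp add: emeasure_shifted[OF \<rho>(1)] preXX)
  then have "c \<noteq> 0" using nz(1) c(2) by (metis emeasure_scale_measure mult_zero_left)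
  then show ?thesis
    using c by (intro that[of "enn2real c"]) (auto simp: enn2real_positive_iff less_top zero_less_iff_neq_zero)
qed

lemma shifted_one_const:
  assumes \<rho>: "inv2 \<rho>" and sh: "shifted 1 \<rho> = scale_measure (ennreal 1) \<rho>"
    and s: "\<bar>s\<bar> < h n" "\<bar>t\<bar> < h n"
  shows "val \<rho> n s = val \<rho> n t"
proof -
  have step: "val \<rho> n (u + 1) = val \<rho> n u" if u: "\<bar>u\<bar> < h n" "\<bar>u + 1\<bar> < h n" for u
  proof -
    obtain k where k: "h n = 2 * k + 1" using odd_chacon_h[of n] by (auto elim: oddE)
    have F: "u div 2 \<in> F n" "u - u div 2 \<in> F n" using half_in_F u by auto
    have F': "u div 2 + 1 \<in> F n"
      using u k unfolding mem_chacon_F by presburger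
    have "pre 1 0 (rect n (u div 2 + 1) (u - u div 2)) = rect n (u div 2) (u - u div 2)"
      using pre_rect[OF F' F(2), of 1 0] F by simp
    then have "emeasure \<rho> (rect n (u div 2) (u - u div 2)) = emeasure \<rho> (rect n (u div 2 + 1) (u - u div 2))"
      using emeasure_shifted[OF \<rho>, of "rect n (u div 2 + 1) (u - u div 2)" 1] sh by simp
    then show ?thesis using rect_val[OF \<rho> F] rect_val[OF \<rho> F' F(2)] by (simp add: add.commute)
  qed
  show ?thesis
    by (rule const_on_int_interval[of "1 - h n" "h n - 1"]) (use step s in \<open>auto simp: abs_less_iff\<close>)
qed

lemma emeasure_pre_power:
  assumes \<rho>: "inv2 \<rho>" and sh: "shifted 1 \<rho> = scale_measure c \<rho>" and E: "E \<in> sets B2"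
  shows "emeasure \<rho> (pre (int N) 0 E) = c ^ N * emeasure \<rho> E"
proof (induction N)
  case 0
  then show ?case using pre_zero[OF B2_sub[OF E]] by simp
next
  case (Suc N)
  have "pre (int (Suc N)) 0 E = pre 1 0 (pre (int N) 0 E)" by (simp add: pre_pre)
  then have "emeasure \<rho> (pre (int (Suc N)) 0 E) = c * emeasure \<rho> (pre (int N) 0 E)"
    using emeasure_shifted[OF \<rho>, of "pre (int N) 0 E" 1] sh E by simp
  then show ?case using Suc by (simp add: mult.assoc)
qed

text \<open>If \<open>\<rho>\<close> is not invariant under \<open>T \<times> id\<close>, the scaling factor makes a zero digit at level
  \<open>k + 1\<close> exponentially less likely than one of the two digits \<open>lo k\<close>, \<open>hi k\<close>.\<close>

lemma shifted_scale_eq_1: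
  assumes \<rho>: "inv2 \<rho>" and c: "0 < c" and sh: "shifted 1 \<rho> = scale_measure (ennreal c) \<rho>"
    and nz: "f \<in> F n" "g \<in> F n" "emeasure \<rho> (rect n f g) \<noteq> 0"
    and marg: "\<And>N. N \<in> sets B1 \<Longrightarrow> emeasure \<mu> N = 0 \<Longrightarrow> emeasure \<rho> (N \<times> X) = 0"
  shows "c = 1"
proof (rule ccontr)
  assume "c \<noteq> 1"
  let ?W = "rect n f g"
  \<comment> \<open>The translation used below is \<open>hi k\<close> if \<open>c < 1\<close> and
    \<open>lo k\<close> otherwise. Its length is at least \<open>h k\<close>, hence at least
    \<open>k\<close>, so it scales the measure by at most \<open>q ^ k\<close>.\<close>
  define q where "q = (if c < 1 then c else 1 / c)"
  have q: "0 < q" "q < 1" using c \<open>c \<noteq> 1\<close> by (auto simp: q_def)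
  \<comment> \<open>The condition \<open>n \<le> k\<close> makes \<open>A k\<close> empty below
    \<open>n\<close>, so the bound on its measure holds for all \<open>k\<close>.\<close>
  define A where "A k = {p \<in> ?W. n \<le> k \<and> digit k (fst p) = 0}" for k
  have A_eq: "A k = {p \<in> space B2. p \<in> ?W \<and> n \<le> k \<and> digit k (fst p) = 0}" for k
    using B2_sub[OF rect_measurable[of n f g]] by (auto simp: A_def space_B2)
  have A[measurable]: "A k \<in> sets B2" for k unfolding A_eq by measurable
  define w where "w = measure \<rho> ?W"
  have Wfin: "emeasure \<rho> ?W \<noteq> \<infinity>" by (rule inv2_fin[OF \<rho> nz(1,2)])
  then have W: "emeasure \<rho> ?W = ennreal w" by (simp add: w_def emeasure_eq_ennreal_measure)
  have move: "A k \<subseteq> pre d 0 ?W" if "d \<in> C (Suc k)" for k d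
  proof
    fix p assume p: "p \<in> A k"
    then have *: "fst p \<in> XX n" "n \<le> k" "digit k (fst p) = 0" "coord n (fst p) = f" "snd p \<in> cyl n g"
        "p \<in> X \<times> X"
      using B2_sub[OF A] by (auto simp: A_def rect_def cyl_eq)
    then have "T 0 (snd p) \<in> cyl n g" using cyl_sub T_zero by force
    then show "p \<in> pre d 0 ?W"
      using switch(1,3)[OF *(1-3) that] * by (simp add: pre_def act_def rect_def cyl_eq)
  qed
  have bound: "emeasure \<rho> (A k) \<le> ennreal (q ^ k * w)" for k
  proof (cases "c < 1")
    case True
    have N: "k \<le> nat (hi k)" using hi_pos[of k] chacon_h_ge[of k] by linarith
    have "emeasure \<rho> (A k) \<le> emeasure \<rho> (pre (hi k) 0 ?W)"
      by (rule emeasure_mono[OF move]) (auto simp: C_Suc inv2_sets[OF \<rho>])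
    also have "pre (hi k) 0 ?W = pre (int (nat (hi k))) 0 ?W"
      using hi_pos[of k] chacon_h_pos[of k] by simp
    also have "emeasure \<rho> \<dots> = ennreal (c ^ nat (hi k) * w)"
      unfolding emeasure_pre_power[OF \<rho> sh rect_measurable] W
      using c by (simp add: ennreal_power ennreal_mult w_def)
    also have "\<dots> \<le> ennreal (c ^ k * w)"
      using c True N by (intro ennreal_leI mult_right_mono power_decreasing) (auto simp: w_def)
    finally show ?thesis using True by (simp add: q_def)
  next
    case False
    then have c1: "1 < c" using \<open>c \<noteq> 1\<close> by simp
    let ?N = "nat (- lo k)"
    have N: "k \<le> ?N" "int ?N = - lo k"
      using lo_neg[of k] chacon_h_ge[of k] by linarith+
    have "emeasure \<rho> (A k) \<le> emeasure \<rho> (pre (lo k) 0 ?W)"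
      by (rule emeasure_mono[OF move]) (auto simp: C_Suc inv2_sets[OF \<rho>])
    moreover have "pre (int ?N) 0 (pre (lo k) 0 ?W) = ?W"
      unfolding pre_pre N using pre_zero[OF B2_sub[OF rect_measurable]] by simp
    then have "ennreal w = ennreal c ^ ?N * emeasure \<rho> (pre (lo k) 0 ?W)"
      using emeasure_pre_power[OF \<rho> sh, of "pre (lo k) 0 ?W" ?N] W by simp
    ultimately have "ennreal c ^ ?N * emeasure \<rho> (A k) \<le> ennreal w"
      by (simp add: mult_left_mono)
    moreover have "ennreal (q ^ ?N) * (ennreal c ^ ?N * emeasure \<rho> (A k)) = emeasure \<rho> (A k)"
    proof -
      have "ennreal (q ^ ?N) * ennreal c ^ ?N = 1"
        using c c1 by (simp add: ennreal_power ennreal_mult[symmetric] power_mult_distrib[symmetric] q_def)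
      then show ?thesis by (simp add: mult.assoc[symmetric])
    qed
    ultimately have "emeasure \<rho> (A k) \<le> ennreal (q ^ ?N) * ennreal w"
      by (metis mult_left_mono zero_le)
    also have "\<dots> = ennreal (q ^ ?N * w)" using q by (simp add: ennreal_mult w_def)
    also have "\<dots> \<le> ennreal (q ^ k * w)"
      using q N by (intro ennreal_leI mult_right_mono power_decreasing) (auto simp: w_def)
    finally show ?thesis .
  qed
  have meas_bound: "measure \<rho> (A k) \<le> q ^ k * w" for k
    unfolding measure_def by (rule enn2real_leI) (use bound q in \<open>auto simp: w_def\<close>)
  \<comment> \<open>Borel-Cantelli: almost every point of \<open>?W\<close> has the digit 0 only
    finitely often, whereas \<open>avoiding_null\<close> and the marginal force this digit to
    recur.\<close>
  have "AE p in \<rho>. eventually (\<lambda>k. p \<in> space \<rho> - A k) sequentially"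
  proof (rule borel_cantelli_AE1)
    show "A k \<in> sets \<rho>" for k by (simp add: inv2_sets[OF \<rho>])
    show "emeasure \<rho> (A k) < \<infinity>" for k
      using le_less_trans[OF bound[of k] ennreal_less_top] by simp
    show "summable (\<lambda>k. measure \<rho> (A k))"
    proof (rule summable_comparison_test)
      show "summable (\<lambda>k. q ^ k * w)" using q by (intro summable_mult2 summable_geometric) auto
      show "\<exists>N. \<forall>k\<ge>N. norm (measure \<rho> (A k)) \<le> q ^ k * w" using meas_bound by auto
    qed
  qed
  moreover have "AE p in \<rho>. \<forall>m. fst p \<notin> {x \<in> XX m. \<forall>k\<ge>m. digit k x \<noteq> 0}"
    unfolding AE_all_countable
  proof
    fix m
    let ?N = "{x \<in> XX m. \<forall>k\<ge>m. digit k x \<noteq> 0}"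
    have N: "?N \<in> null_sets \<mu>" by (rule avoiding_null) (simp add: C_Suc)
    then have "?N \<times> X \<in> null_sets \<rho>"
      using marg[of ?N] sets.top[of B1]
      by (intro null_setsI) (auto simp: null_sets_def sets_mu inv2_sets[OF \<rho>])
    then have "AE p in \<rho>. p \<notin> ?N \<times> X" by (rule AE_not_in)
    with AE_space show "AE p in \<rho>. fst p \<notin> ?N"
      by eventually_elim (auto simp: inv2_space[OF \<rho>])
  qed
  ultimately have "AE p in \<rho>. p \<notin> ?W"
  proof eventually_elim
    case (elim p)
    show ?case
    proof
      assume p: "p \<in> ?W"
      obtain m where m: "\<And>k. m \<le> k \<Longrightarrow> p \<notin> A k"
        using elim(1) unfolding eventually_sequentially by blast
      let ?k = "max m n"
      have "fst p \<in> XX ?k" using p XX_mono[of n ?k] by (auto simp: rect_def cyl_eq)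
      moreover have "digit k (fst p) \<noteq> 0" if "?k \<le> k" for k
        using m[of k] p that by (simp add: A_def)
      ultimately show False using elim(2) by blast
    qed
  qed
  then have "emeasure \<rho> ?W = 0"
    by (subst (asm) AE_iff_null_sets[symmetric]) (auto simp: inv2_sets[OF \<rho>])
  then show False using nz(3) by simp
qed

section \<open>Pairs with only finitely many cancelling levels\<close>

definition orbit_set where "orbit_set E = {p \<in> X \<times> X. \<exists>g. act g (- g) p \<in> E}"

lemma orbit_set_sets: "E \<in> sets B2 \<Longrightarrow> orbit_set E \<in> sets B2"
proof -
  assume "E \<in> sets B2"
  then have "(\<Union>g. pre g (- g) E) \<in> sets B2" by (intro sets.countable_UN) auto
  also have "(\<Union>g. pre g (- g) E) = orbit_set E" unfolding orbit_set_def pre_def by blast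
  finally show ?thesis .
qed

lemma orbit_set_invariant: "pre 1 (- 1) (orbit_set E) = orbit_set E"
proof (rule set_eqI)
  fix p
  show "p \<in> pre 1 (- 1) (orbit_set E) \<longleftrightarrow> p \<in> orbit_set E"
  proof (cases "p \<in> X \<times> X")
    case True
    have a: "act g (- g) (act 1 (- 1) p) = act (g + 1) (- (g + 1)) p" for g
      using act_act[OF True, of g "- g" 1 "- 1"] by (simp add: algebra_simps)
    have "(\<exists>g. act (g + 1) (- (g + 1)) p \<in> E) \<longleftrightarrow> (\<exists>g. act g (- g) p \<in> E)"
      by (metis diff_add_cancel)
    then show ?thesis
      using True act_in[OF True, of 1 "- 1"] unfolding orbit_set_def pre_def
      by (simp only: mem_Collect_eq vimage_eq Int_iff simp_thms a)
  qed (simp add: orbit_set_def pre_def)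
qed

definition coord_sum where "coord_sum k p = coord k (fst p) + coord k (snd p)"

definition no_cancel where
  "no_cancel n = {p \<in> XX n \<times> XX n. \<forall>k\<ge>n. \<not> cancels k p}"

lemma no_cancel_sets [measurable]: "no_cancel n \<in> sets B2"
proof -
  have "no_cancel n = {p \<in> space B2. p \<in> XX n \<times> XX n \<and> (\<forall>k\<in>{n..}. \<not> cancels k p)}"
    using XX_sub_X by (auto simp: no_cancel_def space_B2)
  also have "\<dots> \<in> sets B2" by measurable
  finally show ?thesis .
qed

lemma no_cancel_step:
  assumes "p \<in> no_cancel n" "n \<le> k"
  shows "coord_sum (Suc k) p - coord_sum k p \<in> {2 * lo k, lo k, hi k, 2 * hi k}"
    "digit k (fst p) + digit k (snd p) = coord_sum (Suc k) p - coord_sum k p"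
proof -
  show eq: "digit k (fst p) + digit k (snd p) = coord_sum (Suc k) p - coord_sum k p"
    by (simp add: digit_def coord_sum_def)
  have "digit k (fst p) \<in> C (Suc k)" "digit k (snd p) \<in> C (Suc k)" "\<not> cancels k p"
    using assms digit_in_C by (auto simp: no_cancel_def)
  then show "coord_sum (Suc k) p - coord_sum k p \<in> {2 * lo k, lo k, hi k, 2 * hi k}"
    unfolding eq[symmetric] C_Suc cancels_def by auto
qed

text \<open>On \<open>no_cancel n\<close> the sum of the coordinates at a high level determines the sums at all
  lower levels above \<open>n\<close>, so the digit sums are constant along orbits.\<close>

lemma coord_sum_orbit:
  assumes p: "p \<in> no_cancel n" and q: "act g (- g) p \<in> no_cancel n" and k: "n < k"
  shows "coord_sum k (act g (- g) p) = coord_sum k p"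
proof -
  let ?q = "act g (- g) p"
  have "p \<in> X \<times> X" using p XX_sub_X by (auto simp: no_cancel_def)
  then obtain m where m: "\<And>j. m \<le> j \<Longrightarrow> coord_sum j ?q = coord_sum j p"
    using act_coord_large[of p g "- g"] unfolding coord_sum_def by (smt (verit))
  have "k \<le> max m k" by simp
  then show ?thesis using k
  proof (induction k rule: inc_induct)
    case base
    then show ?case using m by simp
  next
    \<comment> \<open>The four possible digit sums are at least \<open>h j\<close> apart, whereas
      the coordinate sums at level \<open>j\<close> differ by at most \<open>6 * h i\<close>, which
      is below \<open>h j\<close>. So equal sums at level \<open>Suc j\<close> come from equal digit
      sums. The bound uses level \<open>i = j - 1\<close>, whence the strict
      \<open>n < k\<close>.\<close>
    case (step j)
    then obtain i where i: "j = Suc i" "n \<le> i" by (cases j) auto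
    have "XX n \<subseteq> XX i" using i by (intro XX_mono)
    then have "fst p \<in> XX i" "snd p \<in> XX i" "fst ?q \<in> XX i" "snd ?q \<in> XX i"
      using p q by (auto simp: no_cancel_def)
    then have "\<bar>coord j (fst ?q) - coord j (fst p)\<bar> \<le> 3 * h i" "\<bar>coord j (snd ?q) - coord j (snd p)\<bar> \<le> 3 * h i"
      unfolding i(1) by (auto intro: coord_diff_bound)
    then have d: "\<bar>coord_sum j ?q - coord_sum j p\<bar> < h j"
      unfolding coord_sum_def i(1) by simp
    have "n \<le> j" using i by simp
    note 1 = no_cancel_step(1)[OF p this] and 2 = no_cancel_step(1)[OF q this]
    have "coord_sum (Suc j) ?q = coord_sum (Suc j) p" using step by simp
    with 1 2 d show ?case
      using omega[of j] chacon_h_pos[of j] unfolding lo_def hi_def by auto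
  qed
qed

text \<open>If the set had positive measure, ergodicity applied to the saturation
  \<open>orbit_set (E v)\<close> would give almost all its points the same digit sum
  \<open>v\<close> at each level beyond \<open>n\<close>. No admissible \<open>v\<close> can be
  reached from all three digits, so the first coordinate would avoid a digit at each of these
  levels.\<close>

lemma no_cancel_null:
  assumes \<rho>: "inv2 \<rho>" "erg2 \<rho>"
    and marg: "\<And>N. N \<in> sets B1 \<Longrightarrow> emeasure \<mu> N = 0 \<Longrightarrow> emeasure \<rho> (N \<times> X) = 0"
  shows "emeasure \<rho> (no_cancel n) = 0"
proof (rule ccontr)
  assume nz: "emeasure \<rho> (no_cancel n) \<noteq> 0"
  have ex: "\<exists>i\<in>C (Suc k). AE p in \<rho>. p \<in> no_cancel n \<longrightarrow> digit k (fst p) \<noteq> i" if k: "Suc n \<le> k" for k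
  proof -
    let ?V = "{2 * lo k, lo k, hi k, 2 * hi k}"
    define E where "E v = {p \<in> no_cancel n. coord_sum (Suc k) p - coord_sum k p = v}" for v
    have E_eq: "E v = {p \<in> space B2. p \<in> no_cancel n \<and> coord_sum (Suc k) p - coord_sum k p = v}" for v
      using B2_sub[OF no_cancel_sets[of n]] by (auto simp: E_def space_B2)
    have E[measurable]: "E v \<in> sets B2" for v
      unfolding E_eq coord_sum_def by measurable
    have "no_cancel n = (\<Union>v\<in>?V. E v)"
      using no_cancel_step(1)[of _ n k] k by (auto simp: E_def)
    then have "\<exists>v\<in>?V. emeasure \<rho> (E v) \<noteq> 0"
    proof (rule contrapos_pp)
      assume "\<not> (\<exists>v\<in>?V. emeasure \<rho> (E v) \<noteq> 0)"
      then have "(\<Union>v\<in>?V. E v) \<in> null_sets \<rho>"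
        by (intro null_sets_UN') (auto simp: inv2_sets[OF \<rho>(1)] intro!: null_setsI countable_finite)
      then show "no_cancel n \<noteq> (\<Union>v\<in>?V. E v)" using nz by (auto simp: null_sets_def)
    qed
    then obtain v where v: "v \<in> ?V" "emeasure \<rho> (E v) \<noteq> 0" by blast
    have "E v \<subseteq> orbit_set (E v)"
    proof
      fix p assume p: "p \<in> E v"
      then have "p \<in> X \<times> X" using B2_sub[OF E] by blast
      then show "p \<in> orbit_set (E v)" using p act_zero[of p] by (auto simp: orbit_set_def intro!: exI[of _ 0])
    qed
    then have "emeasure \<rho> (E v) \<le> emeasure \<rho> (orbit_set (E v))"
      by (rule emeasure_mono) (simp add: inv2_sets[OF \<rho>(1)] orbit_set_sets)
    then have "emeasure \<rho> (orbit_set (E v)) \<noteq> 0" using v(2) by auto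
    then have "emeasure \<rho> (X \<times> X - orbit_set (E v)) = 0"
      using \<rho>(2) orbit_set_sets[OF E, of v] orbit_set_invariant unfolding erg2_def by blast
    then have "AE p in \<rho>. p \<notin> X \<times> X - orbit_set (E v)"
      by (intro AE_not_in null_setsI) (simp_all add: inv2_sets[OF \<rho>(1)] orbit_set_sets compl_sets)
    then have AE: "AE p in \<rho>. p \<in> no_cancel n \<longrightarrow> coord_sum (Suc k) p - coord_sum k p = v"
      using AE_space
    proof eventually_elim
      case (elim p)
      show ?case
      proof
        assume p: "p \<in> no_cancel n"
        have "p \<in> orbit_set (E v)" using elim by (simp add: inv2_space[OF \<rho>(1)])
        then obtain g where g: "act g (- g) p \<in> E v" by (auto simp: orbit_set_def)
        then have q: "act g (- g) p \<in> no_cancel n" by (simp add: E_def)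
        show "coord_sum (Suc k) p - coord_sum k p = v"
          using g coord_sum_orbit[OF p q, of k] coord_sum_orbit[OF p q, of "Suc k"] k by (simp add: E_def)
      qed
    qed
    \<comment> \<open>A negative digit sum among the four cannot use \<open>hi k\<close>, a positive
      one cannot use \<open>lo k\<close>.\<close>
    have "lo k < 0" "0 < hi k" using lo_neg[of k] hi_pos[of k] chacon_h_pos[of k] by linarith+
    moreover have "v = 2 * lo k \<or> v = lo k \<or> v = hi k \<or> v = 2 * hi k" using v(1) by simp
    ultimately have "\<exists>i\<in>{lo k, 0, hi k}. \<forall>c'\<in>{lo k, 0, hi k}. i + c' \<noteq> v" by auto
    then have "\<exists>i\<in>C (Suc k). \<forall>c\<in>C (Suc k). \<forall>c'\<in>C (Suc k). c + c' = v \<longrightarrow> c \<noteq> i"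
      unfolding C_Suc by blast
    then obtain i where i: "i \<in> C (Suc k)"
        "\<And>c c'. c \<in> C (Suc k) \<Longrightarrow> c' \<in> C (Suc k) \<Longrightarrow> c + c' = v \<Longrightarrow> c \<noteq> i" by blast
    have "AE p in \<rho>. p \<in> no_cancel n \<longrightarrow> digit k (fst p) \<noteq> i"
      using AE
    proof eventually_elim
      case (elim p)
      show ?case
      proof
        assume p: "p \<in> no_cancel n"
        then have "digit k (fst p) \<in> C (Suc k)" "digit k (snd p) \<in> C (Suc k)"
          using digit_in_C k by (auto simp: no_cancel_def)
        then show "digit k (fst p) \<noteq> i"
          using i(2) no_cancel_step(2)[OF p, of k] elim p k by simp
      qed
    qed
    with i(1) show ?thesis by blast
  qed
  \<comment> \<open>Below \<open>Suc n\<close> any digit serves as a placeholder: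
    \<open>avoiding_null\<close> wants a forbidden digit at every level.\<close>
  have "\<exists>i. i \<in> C (Suc k) \<and> (Suc n \<le> k \<longrightarrow> (AE p in \<rho>. p \<in> no_cancel n \<longrightarrow> digit k (fst p) \<noteq> i))" for k
  proof (cases "Suc n \<le> k")
    case True
    then show ?thesis using ex[OF True] by blast
  qed (auto simp: C_Suc)
  then have "\<exists>i. \<forall>k. i k \<in> C (Suc k) \<and> (Suc n \<le> k \<longrightarrow> (AE p in \<rho>. p \<in> no_cancel n \<longrightarrow> digit k (fst p) \<noteq> i k))"
    by (intro choice allI)
  then obtain i where i0: "\<forall>k. i k \<in> C (Suc k) \<and> (Suc n \<le> k \<longrightarrow> (AE p in \<rho>. p \<in> no_cancel n \<longrightarrow> digit k (fst p) \<noteq> i k))" ..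
  have iC: "i k \<in> C (Suc k)" for k using i0 by simp
  have i: "AE p in \<rho>. p \<in> no_cancel n \<longrightarrow> digit k (fst p) \<noteq> i k" if "Suc n \<le> k" for k
    using i0 that by simp
  let ?N = "{x \<in> XX (Suc n). \<forall>k\<ge>Suc n. digit k x \<noteq> i k}"
  have "?N \<in> null_sets \<mu>" by (rule avoiding_null[OF iC])
  then have "?N \<times> X \<in> null_sets \<rho>"
    using marg[of ?N] sets.top[of B1]
    by (intro null_setsI) (auto simp: null_sets_def sets_mu inv2_sets[OF \<rho>(1)])
  then have N: "AE p in \<rho>. p \<notin> ?N \<times> X" by (rule AE_not_in)
  have "AE p in \<rho>. \<forall>k. Suc n \<le> k \<longrightarrow> p \<in> no_cancel n \<longrightarrow> digit k (fst p) \<noteq> i k"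
    unfolding AE_all_countable
  proof
    fix k
    show "AE p in \<rho>. Suc n \<le> k \<longrightarrow> p \<in> no_cancel n \<longrightarrow> digit k (fst p) \<noteq> i k"
      using i[of k] by (cases "Suc n \<le> k") auto
  qed
  with N have "AE p in \<rho>. p \<notin> no_cancel n"
  proof eventually_elim
    case (elim p)
    show ?case
    proof
      assume p: "p \<in> no_cancel n"
      then have "fst p \<in> XX n" "snd p \<in> XX n" by (simp_all add: no_cancel_def mem_Times_iff)
      then have "fst p \<in> XX (Suc n)" "snd p \<in> X"
        using XX_mono[OF le_SucI[OF order_refl], of n] XX_sub_X[of n] by blast+
      moreover have "\<forall>k\<ge>Suc n. digit k (fst p) \<noteq> i k" using elim(2) p by blast
      ultimately have "fst p \<in> ?N" by blast
      then have "p \<in> ?N \<times> X" using \<open>snd p \<in> X\<close> unfolding mem_Times_iff by (rule conjI)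
      with elim(1) show False by contradiction
    qed
  qed
  then have "emeasure \<rho> (no_cancel n) = 0"
    by (subst (asm) AE_iff_null_sets[symmetric]) (auto simp: inv2_sets[OF \<rho>(1)])
  with nz show False by contradiction
qed

section \<open>Uniqueness of the joining and Radon disjointness\<close>

lemma joining_unique:
  assumes "radon_joining topo \<mu> (T 1) topo \<mu> S \<rho>"
  shows "\<exists>c>0. \<rho> = scale_measure (ennreal c) (\<mu> \<Otimes>\<^sub>M \<mu>)"
proof -
  have \<rho>: "inv2 \<rho>" "erg2 \<rho>"
    and marg: "\<And>N. N \<in> sets B1 \<Longrightarrow> emeasure \<rho> (N \<times> X) = 0 \<longleftrightarrow> emeasure \<mu> N = 0"
    using assms unfolding joining_iff by blast+
  have XB: "X \<in> sets B1" using sets.top[of B1] by simp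
  then have XX: "X \<times> X \<in> sets B2" by simp
  have "emeasure \<mu> (XX 0) \<le> emeasure \<mu> X"
    by (rule emeasure_mono[OF XX_sub_X]) (simp add: sets_mu XB)
  then have "emeasure \<mu> X \<noteq> 0" by (auto simp: mu_XX)
  then have nzX: "emeasure \<rho> (X \<times> X) \<noteq> 0" using marg[OF XB] by simp
  then have "X \<times> X \<notin> null_sets \<rho>" by auto
  then obtain n f g where fg: "f \<in> F n" "g \<in> F n" "X \<times> X \<inter> rect n f g \<notin> null_sets \<rho>"
    using rect_cover[OF inv2_sets[OF \<rho>(1)], of "X \<times> X"] by blast
  have nz: "emeasure \<rho> (rect n f g) \<noteq> 0"
  proof
    assume "emeasure \<rho> (rect n f g) = 0"
    then have "rect n f g \<in> null_sets \<rho>" by (intro null_setsI) (auto simp: inv2_sets[OF \<rho>(1)])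
    moreover have "X \<times> X \<inter> rect n f g = rect n f g" using B2_sub[OF rect_measurable] by blast
    ultimately show False using fg by simp
  qed
  have "emeasure \<rho> cancel_io = 0 \<or> emeasure \<rho> (X \<times> X - cancel_io) = 0"
    using \<rho>(2) cancel_io_sets cancel_io_invariant unfolding erg2_def by blast
  moreover have "emeasure \<rho> cancel_io \<noteq> 0"
  proof
    assume 0: "emeasure \<rho> cancel_io = 0"
    have "cancel_io \<in> null_sets \<rho>" "\<And>n. no_cancel n \<in> null_sets \<rho>"
      using 0 no_cancel_null[OF \<rho>] marg by (auto intro!: null_setsI simp: inv2_sets[OF \<rho>(1)])
    then have "cancel_io \<union> (\<Union>n. no_cancel n) \<in> null_sets \<rho>" by (intro null_sets.Un null_sets_UN)
    \<comment> \<open>Beyond its last cancelling level and the level at which it enters, a point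
      outside \<open>cancel_io\<close> belongs to \<open>no_cancel\<close>.\<close>
    moreover have "X \<times> X \<subseteq> cancel_io \<union> (\<Union>n. no_cancel n)"
    proof
      fix p assume p: "p \<in> X \<times> X"
      show "p \<in> cancel_io \<union> (\<Union>n. no_cancel n)"
      proof (cases "p \<in> cancel_io")
        case False
        then obtain m where m: "\<And>k. m < k \<Longrightarrow> \<not> cancels k p"
          using p by (auto simp: cancel_io_def INFM_nat)
        obtain a where a: "p \<in> XX2 a" using p C2.V_cover by auto
        let ?n = "max a (Suc m)"
        have "p \<in> XX ?n \<times> XX ?n" using a C2.V_mono[of a ?n] by (auto simp: XX2_def)
        then have "p \<in> no_cancel ?n" using m by (simp add: no_cancel_def)
        then show ?thesis by blast
      qed simp
    qed
    ultimately have "X \<times> X \<in> null_sets \<rho>"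
      using null_sets_subset[of "cancel_io \<union> (\<Union>n. no_cancel n)" \<rho> "X \<times> X"] XX
      by (simp add: inv2_sets[OF \<rho>(1)])
    with nzX show False by auto
  qed
  ultimately have "emeasure \<rho> (X \<times> X - cancel_io) = 0" by blast
  then have "AE p in \<rho>. p \<notin> X \<times> X - cancel_io"
    by (intro AE_not_in null_setsI) (simp_all add: inv2_sets[OF \<rho>(1)] compl_sets)
  with AE_space have io: "AE p in \<rho>. p \<in> cancel_io"
    by eventually_elim (simp add: inv2_space[OF \<rho>(1)])
  obtain c where c: "0 < c" "shifted 1 \<rho> = scale_measure (ennreal c) \<rho>"
    by (rule shifted_proportional[OF \<rho> io nzX fg(1,2) nz])
  have "c = 1"
    by (rule shifted_scale_eq_1[OF \<rho>(1) c fg(1,2) nz]) (use marg in blast)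
  then have "shifted 1 \<rho> = scale_measure (ennreal 1) \<rho>" using c by simp
  note const = shifted_one_const[OF \<rho>(1) this]
  have eq: "\<rho> = scale_measure (val \<rho> 0 0) (\<mu> \<Otimes>\<^sub>M \<mu>)"
    by (rule inv2_const[OF \<rho>(1) const])
  have "val \<rho> 0 0 \<noteq> \<infinity>"
    unfolding val_def by (rule inv2_fin[OF \<rho>(1)]) (auto simp: mem_chacon_F)
  moreover have "val \<rho> 0 0 \<noteq> 0"
    using nzX by (subst (asm) eq) auto
  ultimately have "0 < enn2real (val \<rho> 0 0)" "ennreal (enn2real (val \<rho> 0 0)) = val \<rho> 0 0"
    by (auto simp: enn2real_positive_iff less_top zero_less_iff_neq_zero)
  with eq show ?thesis by metis
qed

text \<open>The measure of \<open>XX n\<close> is at least \<open>6 ^ n / 3 ^ n = 2 ^ n\<close>. The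
  infinite total mass is what separates the product from a graph joining.\<close>

lemma mu_X: "emeasure \<mu> X = \<infinity>"
proof -
  have pow: "(6::int) ^ n \<le> h n" for n
  proof (induction n)
    case (Suc n)
    then show ?case by simp
  qed simp
  have "ennreal (real n) \<le> emeasure \<mu> X" for n
  proof -
    have "real n \<le> 2 ^ n" by simp
    also have "(2::real) ^ n = 6 ^ n / 3 ^ n" by (simp add: power_divide[symmetric])
    also have "\<dots> \<le> of_int (h n) / 3 ^ n"
    proof (rule divide_right_mono)
      have "real_of_int (6 ^ n) \<le> of_int (h n)" using pow[of n] by (simp only: of_int_le_iff)
      then show "6 ^ n \<le> real_of_int (h n)" by simp
    qed simp
    finally have "ennreal (real n) \<le> emeasure \<mu> (XX n)" unfolding mu_XX by (rule ennreal_leI)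
    also have "\<dots> \<le> emeasure \<mu> X"
      using sets.top[of \<mu>] by (intro emeasure_mono[OF XX_sub_X]) simp
    finally show ?thesis .
  qed
  then have le: "of_nat n \<le> emeasure \<mu> X" for n :: nat
    by (simp add: ennreal_of_nat_eq_real_of_nat)
  show ?thesis
  proof (rule ccontr)
    assume "emeasure \<mu> X \<noteq> \<infinity>"
    then obtain n :: nat where "emeasure \<mu> X < of_nat n"
      using ennreal_Ex_less_of_nat[of "emeasure \<mu> X"] by (auto simp: less_top)
    with le[of n] show False by simp
  qed
qed

text \<open>Since \<open>X\<close> has infinite measure, the projections of the product take only
  the values 0 and \<infinity>, with the right null sets.\<close>

lemma product_joining: "radon_joining topo \<mu> (T 1) topo \<mu> S (\<mu> \<Otimes>\<^sub>M \<mu>)"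
proof -
  interpret sigma_finite_measure \<mu> by (rule sigma_finite_mu)
  have X: "X \<in> sets \<mu>" using sets.top[of \<mu>] by simp
  have "emeasure (\<mu> \<Otimes>\<^sub>M \<mu>) (N \<times> X) = 0 \<longleftrightarrow> emeasure \<mu> N = 0"
    "emeasure (\<mu> \<Otimes>\<^sub>M \<mu>) (X \<times> N) = 0 \<longleftrightarrow> emeasure \<mu> N = 0" if "N \<in> sets B1" for N
    using that X by (simp_all add: emeasure_pair_measure_Times sets_mu mu_X)
  then show ?thesis
    unfolding joining_iff using inv2_mu2 erg2_mu2 by blast
qed

lemma radon_disjoint_T_S: "radon_disjoint topo \<mu> (T 1) topo \<mu> S"
  unfolding radon_disjoint_def using product_joining joining_unique by blast

section \<open>Isomorphism\<close>

text \<open>Invariance is assumed only almost everywhere because an isomorphism intertwines the maps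
  only on a conull forward invariant set. As in \<open>erg2_mu2\<close> the restriction to
  \<open>D\<close> is a multiple of \<open>\<mu>\<close>; here invariance directly makes its values
  on cylinders of one level equal, with no harmonic functions.\<close>

lemma ergodic_mu:
  assumes D: "D \<in> sets B1" and inv: "AE x in \<mu>. T 1 x \<in> D \<longleftrightarrow> x \<in> D"
  shows "emeasure \<mu> D = 0 \<or> emeasure \<mu> (X - D) = 0"
proof -
  define M where "M = density \<mu> (indicator D)"
  have sM: "sets M = sets B1" by (simp add: M_def sets_mu)
  have M: "emeasure M E = emeasure \<mu> (D \<inter> E)" if "E \<in> sets B1" for E
    unfolding M_def by (rule emeasure_restricted) (simp_all add: that D sets_mu)
  have le: "emeasure M E \<le> emeasure \<mu> E" if "E \<in> sets B1" for E
    unfolding M[OF that] by (rule emeasure_mono) (simp_all add: that sets_mu)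
  have pre_sets: "T 1 -` E \<inter> X \<in> sets B1" if "E \<in> sets B1" for E
    using measurable_sets[OF T_measurable that] by simp
  have shift: "emeasure M (T 1 -` E \<inter> X) = emeasure M E" if E: "E \<in> sets B1" for E
  proof -
    have DE: "D \<inter> E \<in> sets B1" using D E by simp
    have "emeasure \<mu> (D \<inter> (T 1 -` E \<inter> X)) = emeasure \<mu> (T 1 -` (D \<inter> E) \<inter> X)"
    proof (rule emeasure_eq_AE)
      show "AE x in \<mu>. x \<in> D \<inter> (T 1 -` E \<inter> X) \<longleftrightarrow> x \<in> T 1 -` (D \<inter> E) \<inter> X"
        using inv by eventually_elim blast
      show "D \<inter> (T 1 -` E \<inter> X) \<in> sets \<mu>"
        unfolding sets_mu by (rule sets.Int[OF D pre_sets[OF E]])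
      show "T 1 -` (D \<inter> E) \<inter> X \<in> sets \<mu>"
        unfolding sets_mu by (rule pre_sets[OF DE])
    qed
    also have "\<dots> = emeasure \<mu> (D \<inter> E)" by (rule emeasure_T) (simp add: sets_mu DE)
    finally show ?thesis unfolding M[OF E] M[OF pre_sets[OF E]] .
  qed
  have step: "emeasure M (cyl n (u + 1)) = emeasure M (cyl n u)" if "u \<in> F n" "u + 1 \<in> F n" for n u
  proof -
    have "T 1 -` cyl n (u + 1) \<inter> X = cyl n u"
      using T_cyl_iff[of _ "u + 1" n 1] that cyl_sub[of n u] by auto
    then show ?thesis using shift[of "cyl n (u + 1)"] by simp
  qed
  have zero: "0 \<in> F n" for n using chacon_h_pos[of n] by (simp add: mem_chacon_F)
  have const: "emeasure M (cyl n f) = emeasure M (cyl n 0)" if "f \<in> F n" for n f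
  proof (rule const_on_int_interval[of "- ((h n - 1) div 2)" "(h n - 1) div 2"])
    fix u assume "- ((h n - 1) div 2) \<le> u" "u < (h n - 1) div 2"
    then show "emeasure M (cyl n (u + 1)) = emeasure M (cyl n u)"
      by (intro step) (auto simp: chacon_F_def)
  qed (use that zero[of n] in \<open>auto simp: chacon_F_def\<close>)
  have Suc: "emeasure M (cyl n 0) = 3 * emeasure M (cyl (Suc n) 0)" for n
  proof -
    have "emeasure M (cyl n 0) = (\<Sum>u\<in>(\<lambda>c. 0 + c) ` C (Suc n). emeasure M (cyl (Suc n) u))"
      using C1.emeasure_cell_Suc[OF sM, of n 0] coord_Suc_cyl[OF zero[of n]] by (simp add: C1_cell)
    also have "\<dots> = (\<Sum>u\<in>(\<lambda>c. 0 + c) ` C (Suc n). emeasure M (cyl (Suc n) 0))"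
      by (rule sum.cong[OF refl], rule const) (use FC_in[OF zero[of n]] in force)
    also have "\<dots> = 3 * emeasure M (cyl (Suc n) 0)" by (simp add: C_Suc)
    finally show ?thesis .
  qed
  define c where "c = emeasure M (cyl 0 0)"
  have c_eq: "c = 3 ^ n * emeasure M (cyl n 0)" for n
  proof (induction n)
    case (Suc n)
    then show ?case unfolding \<open>\<And>n. emeasure M (cyl n 0) = 3 * emeasure M (cyl (Suc n) 0)\<close>[of n]
      by (simp only: power_Suc mult_ac)
  qed (simp add: c_def)
  have c1: "c \<le> 1" using le[of "cyl 0 0"] mu_cyl[OF zero[of 0]] by (simp add: c_def)
  have "M = scale_measure c \<mu>"
  proof (rule C1.measure_eqI_cells)
    fix n f assume "f \<in> coord n ` XX n"
    then have f: "f \<in> F n" by (simp add: coord_image)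
    have "(3 :: ennreal) ^ n = ennreal (3 ^ n)" by (simp add: ennreal_power[symmetric])
    then have "(3 :: ennreal) ^ n * ennreal (1 / 3 ^ n) = 1" by (simp add: ennreal_mult[symmetric])
    then have "emeasure M (cyl n 0) = c * ennreal (1 / 3 ^ n)"
      unfolding c_eq[of n] by (metis mult.assoc mult.commute mult_1)
    then show "emeasure M (C1.cell n f) = emeasure (scale_measure c \<mu>) (C1.cell n f)"
      using const[OF f] by (simp add: C1_cell mu_cyl f)
    show "emeasure M (C1.cell n f) \<noteq> \<infinity>"
      using le[of "cyl n f"] by (auto simp: C1_cell mu_cyl f top_unique)
  qed (auto simp: sM sets_mu)
  then have eq: "emeasure \<mu> (D \<inter> E) = c * emeasure \<mu> E" if "E \<in> sets B1" for E
    using M[OF that] by simp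
  show ?thesis
  proof (cases "c = 1")
    case True
    have "X - D \<in> sets B1" using sets.compl_sets[OF D] by simp
    then show ?thesis using eq[of "X - D"] True by simp
  next
    case False
    have cyl0: "D \<inter> cyl n f \<in> null_sets \<mu>" if f: "f \<in> F n" for n f
    proof -
      let ?x = "emeasure \<mu> (D \<inter> cyl n f)"
      have DC: "D \<inter> cyl n f \<in> sets B1" by (rule sets.Int[OF D cyl_measurable])
      then have "?x = c * ?x" using eq[of "D \<inter> cyl n f"] by (simp add: Int_assoc[symmetric])
      moreover have "?x \<noteq> \<infinity>" using le[of "cyl n f"] by (auto simp: M mu_cyl f top_unique)
      moreover obtain r where "0 \<le> r" "c = ennreal r"
        using c1 by (cases c rule: ennreal_cases) (auto simp: top_unique)
      ultimately have "?x = 0"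
        using False by (cases ?x rule: ennreal_cases) (auto simp: ennreal_mult[symmetric])
      then show ?thesis using DC by (intro null_setsI) (simp_all add: sets_mu)
    qed
    have "D = (\<Union>a\<in>C1.cells. D \<inter> a)"
      using C1.Union_cells sets.sets_into_space[OF D] by auto
    also have "\<dots> \<in> null_sets \<mu>"
      by (rule null_sets_UN'[OF C1.countable_cells]) (use cyl0 in \<open>auto simp: C1.cells_def coord_image C1_cell\<close>)
    finally show ?thesis by (auto simp: null_sets_def)
  qed
qed

lemma not_isomorphic: "\<not> mp_isomorphic \<mu> (T 1) \<mu> S"
proof
  assume "mp_isomorphic \<mu> (T 1) \<mu> S"
  then obtain A B \<phi> where A: "A \<in> sets \<mu>" and B: "B \<in> sets \<mu>"
    and A0: "emeasure \<mu> (space \<mu> - A) = 0" and B0: "emeasure \<mu> (space \<mu> - B) = 0"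
    and TA: "T 1 ` A \<subseteq> A" and bij: "bij_betw \<phi> A B"
    and \<phi>: "\<phi> \<in> measurable (restrict_space \<mu> A) (restrict_space \<mu> B)"
    and mp: "\<forall>E \<in> sets \<mu>. E \<subseteq> B \<longrightarrow> emeasure \<mu> (\<phi> -` E \<inter> A) = emeasure \<mu> E"
    and eqv: "\<forall>x \<in> A. \<phi> (T 1 x) = S (\<phi> x)"
    unfolding mp_isomorphic_def by (elim bexE exE conjE) (rule that; assumption)
  have AX: "A \<subseteq> X" and BX: "B \<subseteq> X" using sets.sets_into_space[OF A] sets.sets_into_space[OF B] by auto
  have \<phi>B: "\<phi> x \<in> B" if "x \<in> A" for x using bij that by (auto simp: bij_betw_def)
  have AE_conull: "AE x in \<mu>. x \<in> D" if "D \<in> sets \<mu>" "emeasure \<mu> (space \<mu> - D) = 0" for D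
  proof -
    have "space \<mu> - D \<in> null_sets \<mu>" using that by (intro null_setsI sets.compl_sets)
    then have "AE x in \<mu>. x \<notin> space \<mu> - D" by (rule AE_not_in)
    with AE_space show ?thesis by eventually_elim simp
  qed
  note AEA = AE_conull[OF A A0] and AEB = AE_conull[OF B B0]
  let ?R = "restrict_space \<mu> A"
  have spR: "space ?R = A" using AX by (auto simp: space_restrict_space)
  have \<phi>': "\<phi> \<in> measurable ?R \<mu>" using \<phi> by (simp add: measurable_restrict_space2_iff)
  have "(\<lambda>x. (x, \<phi> x)) \<in> measurable ?R (\<mu> \<Otimes>\<^sub>M \<mu>)"
    by (intro measurable_Pair \<phi>' measurable_restrict_space1 measurable_ident_sets refl)
  then have G: "(\<lambda>x. (x, \<phi> x)) \<in> measurable ?R B2"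
    unfolding measurable_cong_sets[OF refl sets_mu2] .
  \<comment> \<open>The joining carried by the graph of \<open>\<phi>\<close>;
    \<open>\<Gamma> E\<close> is the trace of \<open>E\<close> on the graph, projected to the first
    coordinate.\<close>
  define \<rho> where "\<rho> = distr ?R B2 (\<lambda>x. (x, \<phi> x))"
  define \<Gamma> where "\<Gamma> E = {x \<in> A. (x, \<phi> x) \<in> E}" for E
  have \<Gamma>: "\<Gamma> E \<in> sets \<mu>" "emeasure \<rho> E = emeasure \<mu> (\<Gamma> E)" if E: "E \<in> sets B2" for E
  proof -
    have G_eq: "(\<lambda>x. (x, \<phi> x)) -` E \<inter> space ?R = \<Gamma> E" by (auto simp: \<Gamma>_def spR)
    have "\<Gamma> E \<in> sets ?R" using measurable_sets[OF G E] unfolding G_eq .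
    then show "\<Gamma> E \<in> sets \<mu>"
      using A by (subst (asm) sets_restrict_space_iff) (simp_all add: Int_absorb2[OF AX])
    have "emeasure \<rho> E = emeasure ?R (\<Gamma> E)"
      unfolding \<rho>_def emeasure_distr[OF G E] G_eq ..
    also have "\<dots> = emeasure \<mu> (\<Gamma> E)"
      using A by (intro emeasure_restrict_space) (auto simp: \<Gamma>_def Int_absorb2[OF AX])
    finally show "emeasure \<rho> E = emeasure \<mu> (\<Gamma> E)" .
  qed
  have \<Gamma>_pre: "\<Gamma> (pre 1 (- 1) E) = A \<inter> (T 1 -` \<Gamma> E \<inter> X)" for E
  proof (rule set_eqI)
    fix x
    show "x \<in> \<Gamma> (pre 1 (- 1) E) \<longleftrightarrow> x \<in> A \<inter> (T 1 -` \<Gamma> E \<inter> X)"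
    proof (cases "x \<in> A")
      case True
      then have x: "x \<in> X" "\<phi> x \<in> X" "T 1 x \<in> A" using AX BX \<phi>B TA by auto
      have "\<phi> (T 1 x) = T (- 1) (\<phi> x)" using eqv True inv_T[OF x(2)] by simp
      then show ?thesis using True x by (simp add: \<Gamma>_def pre_def act_def)
    qed (simp add: \<Gamma>_def)
  qed
  have inv: "inv2 \<rho>"
  proof (rule inv2I)
    show "sets \<rho> = sets B2" by (simp add: \<rho>_def)
    show "emeasure \<rho> (rect n f g) \<noteq> \<infinity>" if "f \<in> F n" "g \<in> F n" for n f g
    proof -
      have "emeasure \<mu> (\<Gamma> (rect n f g)) \<le> emeasure \<mu> (cyl n f)"
        by (rule emeasure_mono) (auto simp: \<Gamma>_def rect_def sets_mu)
      then show ?thesis using mu_cyl[OF that(1)] by (auto simp: \<Gamma> top_unique)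
    qed
    show "emeasure \<rho> (pre 1 (- 1) E) = emeasure \<rho> E" if E: "E \<in> sets B2" for E
    proof -
      have TE: "T 1 -` \<Gamma> E \<inter> X \<in> sets \<mu>"
        using measurable_sets[OF T_measurable, of "\<Gamma> E" 1] \<Gamma>(1)[OF E] by (simp add: sets_mu)
      have "emeasure \<mu> (A \<inter> (T 1 -` \<Gamma> E \<inter> X)) = emeasure \<mu> (T 1 -` \<Gamma> E \<inter> X)"
      proof (rule emeasure_eq_AE)
        show "AE x in \<mu>. x \<in> A \<inter> (T 1 -` \<Gamma> E \<inter> X) \<longleftrightarrow> x \<in> T 1 -` \<Gamma> E \<inter> X"
          using AEA by eventually_elim blast
      qed (rule sets.Int[OF A TE] TE)+
      then show ?thesis
        using emeasure_T[OF \<Gamma>(1)[OF E], of 1] \<Gamma>(2)[OF E] \<Gamma>(2)[OF pre_sets[OF E], of 1 "- 1"] by (simp add: \<Gamma>_pre)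
    qed
  qed
  have "erg2 \<rho>"
    unfolding erg2_def
  proof (intro ballI impI)
    fix E assume E: "E \<in> sets B2" "pre 1 (- 1) E = E"
    \<comment> \<open>\<open>A\<close> is only forward invariant, so a strictly invariant
      \<open>E\<close> has a trace that is invariant on \<open>A\<close> alone, that is, almost
      everywhere.\<close>
    have "\<Gamma> E = A \<inter> (T 1 -` \<Gamma> E \<inter> X)" using \<Gamma>_pre[of E] E(2) by simp
    then have "T 1 x \<in> \<Gamma> E \<longleftrightarrow> x \<in> \<Gamma> E" if "x \<in> A" for x using that AX by blast
    with AEA have "AE x in \<mu>. T 1 x \<in> \<Gamma> E \<longleftrightarrow> x \<in> \<Gamma> E" by (rule eventually_mono)
    then have "emeasure \<mu> (\<Gamma> E) = 0 \<or> emeasure \<mu> (X - \<Gamma> E) = 0"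
      using ergodic_mu[of "\<Gamma> E"] \<Gamma>(1)[OF E(1)] by (simp add: sets_mu)
    moreover have "emeasure \<mu> (\<Gamma> (X \<times> X - E)) \<le> emeasure \<mu> (X - \<Gamma> E)"
      using \<Gamma>(1)[OF E(1)] sets.compl_sets[of "\<Gamma> E" \<mu>] AX by (intro emeasure_mono) (auto simp: \<Gamma>_def)
    ultimately show "emeasure \<rho> E = 0 \<or> emeasure \<rho> (X \<times> X - E) = 0"
      using \<Gamma>(2)[OF E(1)] \<Gamma>(2)[OF compl_sets[OF E(1)]] by auto
  qed
  moreover have marg1: "emeasure \<rho> (N \<times> X) = emeasure \<mu> N" if N: "N \<in> sets B1" for N
  proof -
    have "N \<times> X \<in> sets B2" using N sets.top[of B1] by simp
    moreover have "\<Gamma> (N \<times> X) = A \<inter> N" using \<phi>B BX by (auto simp: \<Gamma>_def)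
    moreover have "emeasure \<mu> (A \<inter> N) = emeasure \<mu> N"
    proof (rule emeasure_eq_AE)
      show "AE x in \<mu>. x \<in> A \<inter> N \<longleftrightarrow> x \<in> N" using AEA by eventually_elim blast
    qed (use A N in \<open>simp_all add: sets_mu sets.Int\<close>)
    ultimately show ?thesis using \<Gamma>(2) by simp
  qed
  moreover have "emeasure \<rho> (X \<times> N) = emeasure \<mu> N" if N: "N \<in> sets B1" for N
  proof -
    have "X \<times> N \<in> sets B2" using N sets.top[of B1] by simp
    \<comment> \<open>Measure preservation of \<open>\<phi>\<close> is stated for subsets of
      \<open>B\<close> only, hence the intersection with \<open>B\<close>.\<close>
    moreover have "\<Gamma> (X \<times> N) = \<phi> -` (N \<inter> B) \<inter> A" using \<phi>B AX by (auto simp: \<Gamma>_def)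
    moreover have "emeasure \<mu> (\<phi> -` (N \<inter> B) \<inter> A) = emeasure \<mu> (N \<inter> B)"
      by (rule mp[rule_format]) (use N B in \<open>simp_all add: sets_mu\<close>)
    moreover have "emeasure \<mu> (N \<inter> B) = emeasure \<mu> N"
    proof (rule emeasure_eq_AE)
      show "AE x in \<mu>. x \<in> N \<inter> B \<longleftrightarrow> x \<in> N" using AEB by eventually_elim blast
    qed (use B N in \<open>simp_all add: sets_mu sets.Int\<close>)
    ultimately show ?thesis using \<Gamma>(2) by simp
  qed
  ultimately have "radon_joining topo \<mu> (T 1) topo \<mu> S \<rho>"
    unfolding joining_iff using inv by simp
  then obtain c where c: "c > 0" "\<rho> = scale_measure (ennreal c) (\<mu> \<Otimes>\<^sub>M \<mu>)"
    using joining_unique by blast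
  interpret sigma_finite_measure \<mu> by (rule sigma_finite_mu)
  have 0: "0 \<in> F 0" by (simp add: mem_chacon_F)
  \<comment> \<open>The multiple of the product measure gives this strip
    \<open>c * (1 * \<infinity>)\<close>, the first marginal of the graph joining gives it
    1.\<close>
  have "emeasure \<rho> (cyl 0 0 \<times> X) = \<infinity>"
    unfolding c(2) using c(1) sets.top[of \<mu>]
    by (simp add: emeasure_pair_measure_Times sets_mu mu_X mu_cyl[OF 0] ennreal_mult_eq_top_iff)
  moreover have "emeasure \<rho> (cyl 0 0 \<times> X) = 1" using marg1[of "cyl 0 0"] mu_cyl[OF 0] by simp
  ultimately show False by simp
qed

end

theorem corollary6p2:
  fixes \<omega> :: "nat \<Rightarrow> int"
  assumes "\<forall>n. \<omega> n \<in> {0, 1}"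
  shows "\<not> mp_isomorphic
             (chacon_measure \<omega>) (chacon_T \<omega> 1)
             (chacon_measure \<omega>) (inv_into (chacon_X \<omega>) (chacon_T \<omega> 1)) \<and>
         radon_disjoint
             (chacon_top \<omega>) (chacon_measure \<omega>) (chacon_T \<omega> 1)
             (chacon_top \<omega>) (chacon_measure \<omega>) (inv_into (chacon_X \<omega>) (chacon_T \<omega> 1))"
proof -
  interpret chacon \<omega>
    by unfold_locales (use assms in blast)
  show ?thesis
    using not_isomorphic radon_disjoint_T_S by blast
qed

end
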